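(* Let $\tau$ be a bi-infinite linear trajectory on $S_O$ in direction $\theta$, with cutting sequence $w=c(\tau)$, and let $k\ge 1$ be such that the Teichmüller cutting sequence $c(r_\theta)=s_0s_1s_2\cdots$ has at least the entries $s_0,\dots,s_{k-1}$. Put $\gamma^{(k)}=\gamma_{s_0}\gamma_{s_1}\cdots\gamma_{s_{k-1}}$ and let $\Psi_{\gamma^{(k)}}:S_O\to S_O$ be the affine automorphism with derivative $\gamma^{(k)}$. Then the $k$-th derived sequence $w^{(k)}$ of $w$ is the cutting sequence of the same trajectory $\tau$ with respect to the sides of $\Psi_{\gamma^{(k)}}O$, with the labeling induced by $\Psi_{\gamma^{(k)}}$.
   Context: Octagon surface. $O\subset\mathbb{R}^2$ is a regular octagon with two horizontal sides, and $S_O$ is the translation surface obtained by gluing opposite parallel sides of $O$ by translations; it has one singular point (the image of the vertices). Each pair of opposite sides gets one letter of $\{A,B,C,D\}$: $A$ for the horizontal sides and then $B,C,D$ for the successive sides met going clockwise around $O$ from the top side. A linear trajectory in direction $\theta$ is a straight line path in $S_O$ making angle $\theta$ with the horizontal; bi-infinite means it never hits the singular point. Its cutting sequence $c(\tau)\in\{A,B,C,D\}^{\mathbb{Z}}$ is the sequence of labels of the sides of $O$ it crosses. Directions are considered in $\mathbb{RP}^1$, with $\theta\in[0,\pi)$. Derivation. A letter in a bi-infinite word is sandwiched if it is preceded and followed by the same letter; the derived sequence $w'$ is obtained from $w$ by keeping only the sandwiched letters. $w^{(k)}$ is the result of deriving $k$ times (for cutting sequences this is always possible). Affine automorphisms.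 An affine automorphism of $S_O$ is a homeomorphism of $S_O$ preserving the singular set, which is a diffeomorphism with constant derivative (an element of $GL(2,\mathbb{R})$, of determinant $\pm1$) off the singular set; orientation-reversing maps are allowed. The Veech group $V(S_O)$ is the group of derivatives. An affine automorphism of $S_O$ is uniquely determined by its derivative; $\Psi_\nu$ denotes the automorphism with derivative $\nu\in V(S_O)$. The following matrices lie in $V(S_O)$: $$\gamma=\begin{pmatrix}-1&2(1+\sqrt2)\\0&1\end{pmatrix},\quad \nu_0=\begin{pmatrix}1&0\\0&1\end{pmatrix},\ \nu_1=\tfrac1{\sqrt2}\begin{pmatrix}1&1\\1&-1\end{pmatrix},\ \nu_2=\tfrac1{\sqrt2}\begin{pmatrix}1&1\\-1&1\end{pmatrix},\ \nu_3=\begin{pmatrix}0&1\\1&0\end{pmatrix},$$ $$\nu_4=\begin{pmatrix}0&1\\-1&0\end{pmatrix},\ \nu_5=\tfrac1{\sqrt2}\begin{pmatrix}-1&1\\1&1\end{pmatrix},\ \nu_6=\tfrac1{\sqrt2}\begin{pmatrix}-1&1\\-1&-1\end{pmatrix},\ \nu_7=\begin{pmatrix}-1&0\\0&1\end{pmatrix}.$$ Put $\gamma_i=\nu_i^{-1}\gamma\nu_i$ for $0\le i\le 7$. Induced labeling. $\Psi_\nu O\subset S_O$ is the image of $O\subset S_O$; the image under $\Psi_\nu$ of a side of $O$ labeled $L\in\{A,B,C,D\}$ is labeled $L$. The cutting sequence of $\tau$ with respect to the sides of $\Psi_\nu O$ is the sequence of labels of the sides of $\Psi_\nu O$ crossed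 by $\tau$. Hyperbolic side (the Teichmüller disk $\mathbb{D}$ of $S_O$ is identified with the upper half-plane $\mathbb{H}$). A matrix $\nu=\begin{pmatrix}a&b\\c&d\end{pmatrix}$ with determinant $\pm1$ acts on the right on $\mathbb{H}$ by $z\nu=\frac{az+c}{bz+d}$ if $\det\nu=1$ and $z\nu=\frac{a\bar z+c}{b\bar z+d}$ if $\det\nu=-1$. Let $E_0$ be the geodesic with endpoints $0$ and $1-\sqrt2$ (the fixed line of $\gamma$), $E_i=E_0\nu_i$, and let $\mathscr{O}$ be the ideal octagon containing $i=\sqrt{-1}$ bounded by $E_0,\dots,E_7$. The group $V_{\mathscr{O}}$ generated by $\gamma_0,\dots,\gamma_7$ (hyperbolic reflections in the sides $E_0,\dots,E_7$) has $\mathscr{O}$ as a strict fundamental domain; the images of $\mathscr{O}$ tessellate $\mathbb{H}$. Side $E_i$ gets label $i$, and the labels are transported to all sides of the tessellation by the action of $V_{\mathscr{O}}$. The ray $r_\theta$ is the geodesic ray in $\mathbb{H}$ from $\sqrt{-1}$ to the boundary point $-\tan\theta\in\mathbb{R}\cup\{\infty\}$; it is the projection of the Teichmüller ray $\{g_t^\theta\cdot S_O\}_{t\ge0}$, where $g_t^\theta$ contracts direction $\theta$ by $e^{-t/2}$ and expands the perpendicular direction by $e^{t/2}$. The Teichmüller cutting sequence $c(r_\theta)=s_0s_1\cdots$ is the (finite or infinite) sequence of labels of the sides of the tessellation crossed by $r_\theta$. *)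

theory Defs
  imports "HOL-Analysis.Analysis"
begin

section \<open>The octagon and its translation surface\<close>

text \<open>
  An octagon is given by its vertices \<open>V 0, V 1, \<dots>\<close>, listed clockwise and
  8-periodically, starting with the left endpoint of the top side.
  Hence \<open>oct_side V j\<close> is the \<open>j\<close>-th side clockwise from the top side, the sides \<open>j\<close>
  and \<open>j + 4\<close> are opposite, and the translation taking side \<open>j\<close> onto side \<open>j + 4\<close> takes
  \<open>V j\<close> to \<open>V (j + 5)\<close>.
\<close>

definition regular_octagon :: "(nat \<Rightarrow> real^2) \<Rightarrow> bool" where
  "regular_octagon V \<longleftrightarrow> (\<exists>c r. 0 < r \<and>
     (\<forall>j. V j = c + r *\<^sub>R vector [cos (5 * pi / 8 - real j * pi / 4), sin (5 * pi / 8 - real j * pi / 4)]))"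

definition octagon :: "(nat \<Rightarrow> real^2) \<Rightarrow> (real^2) set" where
  "octagon V = convex hull (range V)"

definition oct_side :: "(nat \<Rightarrow> real^2) \<Rightarrow> nat \<Rightarrow> (real^2) set" where
  "oct_side V j = closed_segment (V j) (V (j + 1))"

datatype letter = LA | LB | LC | LD

definition side_label :: "nat \<Rightarrow> letter" where
  "side_label j = [LA, LB, LC, LD] ! (j mod 4)"

definition glue :: "(nat \<Rightarrow> real^2) \<Rightarrow> real^2 \<Rightarrow> real^2 \<Rightarrow> bool" where
  "glue V x y \<longleftrightarrow> (\<exists>j. x \<in> oct_side V j \<and> y = x + (V (j + 5) - V j))"

definition glue_rel :: "(nat \<Rightarrow> real^2) \<Rightarrow> ((real^2) \<times> (real^2)) set" where
  "glue_rel V = {(x, y). x \<in> octagon V \<and> y \<in> octagon V \<and> equivclp (glue V) x y}"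

text \<open>Points of \<open>S\<^sub>O\<close> are equivalence classes of points of the closed octagon.\<close>

type_synonym surface_point = "(real^2) set"

definition surface :: "(nat \<Rightarrow> real^2) \<Rightarrow> surface_point set" where
  "surface V = octagon V // glue_rel V"

definition surf_pt :: "(nat \<Rightarrow> real^2) \<Rightarrow> real^2 \<Rightarrow> surface_point" where
  "surf_pt V x = glue_rel V `` {x}"

definition singular :: "(nat \<Rightarrow> real^2) \<Rightarrow> surface_point set" where
  "singular V = surf_pt V ` range V"

text \<open>The quotient topology.\<close>

definition surface_topology :: "(nat \<Rightarrow> real^2) \<Rightarrow> surface_point topology" where
  "surface_topology V = topology (\<lambda>U. U \<subseteq> surface V \<and>
     openin (top_of_set (octagon V)) {x \<in> octagon V. surf_pt V x \<in> U})"

lemma openin_surface_topology: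
  "openin (surface_topology V) U \<longleftrightarrow> U \<subseteq> surface V \<and>
     openin (top_of_set (octagon V)) {x \<in> octagon V. surf_pt V x \<in> U}"
proof -
  let ?P = "\<lambda>U. {x \<in> octagon V. surf_pt V x \<in> U}"
  have "istopology (\<lambda>U. U \<subseteq> surface V \<and> openin (top_of_set (octagon V)) (?P U))"
    unfolding istopology_def
  proof (intro conjI allI impI)
    fix S T
    assume S: "S \<subseteq> surface V \<and> openin (top_of_set (octagon V)) (?P S)"
      and T: "T \<subseteq> surface V \<and> openin (top_of_set (octagon V)) (?P T)"
    show "S \<inter> T \<subseteq> surface V" using S by blast
    have "?P (S \<inter> T) = ?P S \<inter> ?P T" by blast
    then show "openin (top_of_set (octagon V)) (?P (S \<inter> T))"
      using S T by (simp add: openin_Int)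
  next
    fix K
    assume K: "\<forall>U\<in>K. U \<subseteq> surface V \<and> openin (top_of_set (octagon V)) (?P U)"
    show "\<Union>K \<subseteq> surface V" using K by blast
    have "?P (\<Union>K) = \<Union>(?P ` K)" by blast
    moreover have "openin (top_of_set (octagon V)) (\<Union>(?P ` K))"
      using K by (intro openin_Union) blast
    ultimately show "openin (top_of_set (octagon V)) (?P (\<Union>K))" by simp
  qed
  then show ?thesis
    unfolding surface_topology_def by (simp add: topology_inverse')
qed

text \<open>
  The translation structure: \<open>shifted V p v q\<close> says that \<open>q\<close> is reached from \<open>p\<close> by moving
  straight along the vector \<open>v\<close> inside (one copy of) the octagon. The octagon being convex,
  the segment from \<open>x\<close> to \<open>x + v\<close> lies in it. A point in the interior of a side has two
  representatives, so for a nonsingular \<open>p\<close> and all sufficiently small \<open>v\<close> there is exactly one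
  such \<open>q\<close>, and the maps \<open>v \<mapsto> q\<close> are the inverses of the charts of the translation structure.
\<close>

definition shifted :: "(nat \<Rightarrow> real^2) \<Rightarrow> surface_point \<Rightarrow> real^2 \<Rightarrow> surface_point \<Rightarrow> bool" where
  "shifted V p v q \<longleftrightarrow> (\<exists>x\<in>p. x + v \<in> octagon V \<and> q = surf_pt V (x + v))"

definition has_const_derivative ::
    "(nat \<Rightarrow> real^2) \<Rightarrow> (surface_point \<Rightarrow> surface_point) \<Rightarrow> real^2^2 \<Rightarrow> bool" where
  "has_const_derivative V f \<nu> \<longleftrightarrow>
     (\<forall>p \<in> surface V - singular V. \<exists>\<epsilon>>0. \<forall>v q. norm v < \<epsilon> \<longrightarrow>
        shifted V p v q \<longrightarrow> shifted V (f p) (\<nu> *v v) (f q))"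

definition affine_automorphism ::
    "(nat \<Rightarrow> real^2) \<Rightarrow> real^2^2 \<Rightarrow> (surface_point \<Rightarrow> surface_point) \<Rightarrow> bool" where
  "affine_automorphism V \<nu> f \<longleftrightarrow>
     homeomorphic_map (surface_topology V) (surface_topology V) f \<and>
     f ` singular V = singular V \<and>
     invertible \<nu> \<and> has_const_derivative V f \<nu>"

text \<open>
  On \<open>surface V\<close> the automorphism is determined by its derivative; the choice below only
  concerns values at arguments that are not points of the surface.
\<close>

definition Psi :: "(nat \<Rightarrow> real^2) \<Rightarrow> real^2^2 \<Rightarrow> surface_point \<Rightarrow> surface_point" where
  "Psi V \<nu> = (SOME f. affine_automorphism V \<nu> f)"


section \<open>Trajectories, cutting sequences and derivation\<close>

text \<open>
  Directions are elements of the real projective line, so the velocity may be any nonzero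
  multiple of \<open>(cos \<theta>, sin \<theta>)\<close>, of either sign.
\<close>

definition linear_trajectory :: "(nat \<Rightarrow> real^2) \<Rightarrow> real \<Rightarrow> (real \<Rightarrow> surface_point) \<Rightarrow> bool" where
  "linear_trajectory V \<theta> \<tau> \<longleftrightarrow> (\<exists>c. c \<noteq> 0 \<and>
     (\<forall>t. \<tau> t \<in> surface V - singular V \<and>
       (\<exists>\<epsilon>>0. \<forall>s. \<bar>s\<bar> < \<epsilon> \<longrightarrow>
          shifted V (\<tau> t) ((s * c) *\<^sub>R vector [cos \<theta>, sin \<theta>]) (\<tau> (t + s)))))"

text \<open>
  \<open>crosses V f \<tau> t L\<close>: at time \<open>t\<close> the trajectory is on the image under \<open>f\<close> of a side with
  label \<open>L\<close>; this image carries the induced label \<open>L\<close>. A bi-infinite trajectory never runs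
  along a side of an affine image of the octagon, as it would then reach the singular point.
  The words are indexed by the integers and defined up to a shift of the index.
\<close>

definition crosses :: "(nat \<Rightarrow> real^2) \<Rightarrow> (surface_point \<Rightarrow> surface_point) \<Rightarrow>
    (real \<Rightarrow> surface_point) \<Rightarrow> real \<Rightarrow> letter \<Rightarrow> bool" where
  "crosses V f \<tau> t L \<longleftrightarrow>
     (\<exists>j. side_label j = L \<and> \<tau> t \<in> f ` surf_pt V ` oct_side V j)"

definition cutting_sequence :: "(nat \<Rightarrow> real^2) \<Rightarrow> (surface_point \<Rightarrow> surface_point) \<Rightarrow>
    (real \<Rightarrow> surface_point) \<Rightarrow> (int \<Rightarrow> letter) \<Rightarrow> bool" where
  "cutting_sequence V f \<tau> w \<longleftrightarrow> (\<exists>T :: int \<Rightarrow> real. strict_mono T \<and>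
     range T = {t. \<exists>L. crosses V f \<tau> t L} \<and> (\<forall>n. crosses V f \<tau> (T n) (w n)))"

definition sandwiched :: "(int \<Rightarrow> 'a) \<Rightarrow> int \<Rightarrow> bool" where
  "sandwiched w n \<longleftrightarrow> w (n - 1) = w (n + 1)"

text \<open>\<open>derived w w'\<close>: the word \<open>w'\<close> is the derived sequence of \<open>w\<close>, again up to a shift.\<close>

definition derived :: "(int \<Rightarrow> 'a) \<Rightarrow> (int \<Rightarrow> 'a) \<Rightarrow> bool" where
  "derived w w' \<longleftrightarrow> (\<exists>f :: int \<Rightarrow> int. strict_mono f \<and>
     range f = {n. sandwiched w n} \<and> w' = w \<circ> f)"


section \<open>The Veech group elements\<close>

definition mat2 :: "real \<Rightarrow> real \<Rightarrow> real \<Rightarrow> real \<Rightarrow> real^2^2" where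
  "mat2 a b c d = vector [vector [a, b], vector [c, d]]"

definition gamma :: "real^2^2" where
  "gamma = mat2 (-1) (2 * (1 + sqrt 2)) 0 1"

definition nu :: "nat \<Rightarrow> real^2^2" where
  "nu i = [mat2 1 0 0 1,
           (1 / sqrt 2) *\<^sub>R mat2 1 1 1 (-1),
           (1 / sqrt 2) *\<^sub>R mat2 1 1 (-1) 1,
           mat2 0 1 1 0,
           mat2 0 1 (-1) 0,
           (1 / sqrt 2) *\<^sub>R mat2 (-1) 1 1 1,
           (1 / sqrt 2) *\<^sub>R mat2 (-1) 1 (-1) (-1),
           mat2 (-1) 0 0 1] ! i"

definition gamma_i :: "nat \<Rightarrow> real^2^2" where
  "gamma_i i = matrix_inv (nu i) ** gamma ** nu i"

primrec gamma_word :: "(nat \<Rightarrow> nat) \<Rightarrow> nat \<Rightarrow> real^2^2" where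
  "gamma_word s 0 = mat 1"
| "gamma_word s (Suc k) = gamma_word s k ** gamma_i (s k)"


section \<open>The tessellation of the upper half-plane and the Teichmueller cutting sequence\<close>

text \<open>The right action on the upper half-plane, for matrices of determinant 1 or -1.\<close>

definition act :: "complex \<Rightarrow> real^2^2 \<Rightarrow> complex" where
  "act z \<nu> = (let u = (if det \<nu> = 1 then z else cnj z) in
     (of_real (\<nu> $ 1 $ 1) * u + of_real (\<nu> $ 2 $ 1)) /
     (of_real (\<nu> $ 1 $ 2) * u + of_real (\<nu> $ 2 $ 2)))"

text \<open>The geodesic with endpoints \<open>a\<close> and \<open>b\<close> is the half-circle with diameter \<open>[a, b]\<close>.\<close>

definition geodesic :: "real \<Rightarrow> real \<Rightarrow> complex set" where
  "geodesic a b = {z. 0 < Im z \<and> cmod (z - of_real ((a + b) / 2)) = \<bar>a - b\<bar> / 2}"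

definition E :: "nat \<Rightarrow> complex set" where
  "E i = (\<lambda>z. act z (nu i)) ` geodesic 0 (1 - sqrt 2)"

inductive_set V_oct :: "(real^2^2) set" where
  gen: "i < 8 \<Longrightarrow> gamma_i i \<in> V_oct"
| one: "mat 1 \<in> V_oct"
| mult: "g \<in> V_oct \<Longrightarrow> h \<in> V_oct \<Longrightarrow> g ** h \<in> V_oct"
| inv: "g \<in> V_oct \<Longrightarrow> matrix_inv g \<in> V_oct"

text \<open>
  The ideal octagon around \<open>\<i>\<close> is bounded by the complete geodesics \<open>E 0, \<dots>, E 7\<close>, so
  the sides of the tessellation by its images are exactly the sets \<open>tess_side g i\<close>
  with \<open>g \<in> V_oct\<close> and \<open>i < 8\<close>, and \<open>i\<close> is the transported label of \<open>tess_side g i\<close>.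
\<close>

definition tess_side :: "real^2^2 \<Rightarrow> nat \<Rightarrow> complex set" where
  "tess_side g i = (\<lambda>z. act z g) ` E i"

text \<open>
  The points \<open>e\<^sup>-\<^sup>t \<i>\<close> run, at unit hyperbolic speed, along the geodesic ray from \<open>\<i>\<close> to \<open>0\<close>.
  The rotation below is an isometry which fixes \<open>\<i>\<close> and takes the boundary point \<open>0\<close> to
  \<open>- tan \<theta>\<close> (to infinity if \<open>cos \<theta> = 0\<close>).
\<close>

definition teich_ray :: "real \<Rightarrow> real \<Rightarrow> complex" where
  "teich_ray \<theta> t = act (of_real (exp (- t)) * \<i>) (mat2 (cos \<theta>) (sin \<theta>) (- sin \<theta>) (cos \<theta>))"

lemma teich_ray_eq:
  "teich_ray \<theta> t =
     (of_real (cos \<theta>) * (of_real (exp (- t)) * \<i>) - of_real (sin \<theta>)) /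
     (of_real (sin \<theta>) * (of_real (exp (- t)) * \<i>) + of_real (cos \<theta>))"
proof -
  have "det (mat2 (cos \<theta>) (sin \<theta>) (- sin \<theta>) (cos \<theta>)) = 1"
    using sin_cos_squared_add[of \<theta>]
    by (simp add: det_2 mat2_def power2_eq_square algebra_simps)
  then show ?thesis
    unfolding teich_ray_def act_def by (simp add: mat2_def Let_def)
qed

lemma teich_ray_0: "teich_ray \<theta> 0 = \<i>"
proof -
  have "of_real (sin \<theta>) * \<i> + of_real (cos \<theta>) \<noteq> (0 :: complex)"
    using sin_zero_abs_cos_one by (fastforce simp: complex_eq_iff)
  then show ?thesis
    unfolding teich_ray_eq by (simp add: divide_eq_eq algebra_simps)
qed

lemma teich_ray_limit:
  assumes "cos \<theta> \<noteq> 0"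
  shows "(teich_ray \<theta> \<longlongrightarrow> of_real (- tan \<theta>)) at_top"
proof -
  have "((\<lambda>t::real. exp (- t)) \<longlongrightarrow> 0) at_top"
    by (rule filterlim_compose[OF exp_at_bot filterlim_uminus_at_bot_at_top])
  then have e: "((\<lambda>t::real. complex_of_real (exp (- t))) \<longlongrightarrow> of_real 0) at_top"
    by (rule tendsto_of_real)
  have "((\<lambda>t. teich_ray \<theta> t) \<longlongrightarrow>
     (of_real (cos \<theta>) * (of_real 0 * \<i>) - of_real (sin \<theta>)) /
     (of_real (sin \<theta>) * (of_real 0 * \<i>) + of_real (cos \<theta>))) at_top"
    unfolding teich_ray_eq using assms by (intro tendsto_intros e) simp
  then show ?thesis by (simp add: tan_def)
qed

definition teich_crossing_times :: "real \<Rightarrow> real set" where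
  "teich_crossing_times \<theta> =
     {t. 0 \<le> t \<and> (\<exists>g\<in>V_oct. \<exists>i<8. teich_ray \<theta> t \<in> tess_side g i)}"

text \<open>
  \<open>teich_entry \<theta> n i\<close>: the Teichmueller cutting sequence of \<open>r\<^sub>\<theta>\<close> has an entry with index
  \<open>n\<close> (counting from 0), and this entry is \<open>i\<close>.
\<close>

definition teich_entry :: "real \<Rightarrow> nat \<Rightarrow> nat \<Rightarrow> bool" where
  "teich_entry \<theta> n i \<longleftrightarrow> i < 8 \<and> (\<exists>t \<in> teich_crossing_times \<theta>.
     finite {u \<in> teich_crossing_times \<theta>. u < t} \<and>
     card {u \<in> teich_crossing_times \<theta>. u < t} = n \<and>
     (\<exists>g\<in>V_oct. teich_ray \<theta> t \<in> tess_side g i))"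

end

theory Submission imports Defs begin

text \<open>Why deriving a cutting sequence is the same as cutting along the sides of another octagon.

The symmetries of the octagon permute the labels and carry any direction inside one of eight sectors
into the first one, \<open>0 < \<theta> < pi / 8\<close>, which belongs to the first side of the ideal octagon. There,
a trajectory crosses the octagon by chords of only seven kinds (\<open>chord_transition\<close>). The automorphism with
derivative \<open>gamma\<close> maps side A to itself, and a letter A always stands between two letters D, so it
is kept. The automorphism maps the side labelled \<open>L\<close>, for \<open>L\<close> one of B, C, D, to a straight segment through the midpoint of that side, lying in the two copies of the octagon that are
glued along it and joining a vertex of the first to a vertex of the second (\<open>gamma_label_side\<close>).
A trajectory that crosses \<open>L\<close> comes into the first copy through a side that lies entirely on one side
of the line containing this segment, and it leaves the second copy through a side of the same sort.
Going through the seven kinds of chords shows that these two sides are separated by the line if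
and only if the two neighbours of the letter \<open>L\<close> in the cutting sequence are equal
(\<open>sandwiched_sign\<close>). So the crossings with the image of \<open>L\<close> correspond to the sandwiched letters
\<open>L\<close>. Moreover the crossings that belong to successive letters come in the same order as these letters
(\<open>cross_less\<close>), so their labels form the derived sequence (\<open>derived_crossings\<close>).

The iteration rests on two facts. Each \<open>gamma_i i\<close> is an involution, so the cutting sequence with
respect to the image of the octagon is the ordinary cutting sequence of the image trajectory, whose
direction is changed by \<open>gamma_i i\<close> (\<open>iterated_derivation\<close>). And the \<open>j\<close>-th of the directions
obtained in this way lies in sector \<open>s j\<close>: after the ray has been reflected in the sides that it has
crossed so far, it starts again inside the ideal octagon, and as no side of the tessellation enters
the ideal octagon (\<open>tess_side_in_octagon\<close>), the next side crossed is a side of the octagon with the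
endpoint of the ray behind it (\<open>teich_entries_sectors\<close>).

About the surface itself, two facts are needed. An automorphism with derivative \<open>gamma\<close> exists; it is
the reflection in the vertical axis followed by a simple or double Dehn twist in each of the two
horizontal cylinders (\<open>gamma_automorphism_exists\<close>). And it does not matter which automorphism with
a given derivative is chosen: one with derivative 1 fixes every side, because the top side is, up to
gluing, the only horizontal segment of its length that joins the singular point to itself
(\<open>identity_derivative_sides\<close>).\<close>

unbundle inner_syntax

section \<open>The standard octagon\<close>

abbreviation r2 :: real where "r2 \<equiv> sqrt 2"

text \<open>The silver ratio. The octagon is scaled to have sides of length 2; its inradius is then \<open>sg\<close>, which
is also the cotangent of \<open>pi / 8\<close>. All coordinates are linear in \<open>sg\<close>, and \<open>sg_sq\<close> reduces products.\<close>

definition sg :: real where "sg = 1 + r2"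

lemma r2_sq: "r2 * r2 = 2" by simp

lemma r2_bounds: "1.4 < r2" "r2 < 1.5"
proof -
  show "1.4 < r2" by (rule real_less_rsqrt) (simp add: power2_eq_square)
  show "r2 < 1.5" by (rule real_less_lsqrt) (simp_all add: power2_eq_square)
qed

lemma sg_sq: "sg * sg = 2 * sg + 1"
  unfolding sg_def by (simp add: algebra_simps)

lemma sg_bounds: "2.4 < sg" "sg < 2.5"
  using r2_bounds unfolding sg_def by auto

lemma r2_sg: "r2 * sg = sg + 1"
  unfolding sg_def by (simp add: algebra_simps)

definition side_normal :: "nat \<Rightarrow> real^2" where
  "side_normal j = [vector [0, 1], vector [r2/2, r2/2], vector [1, 0], vector [r2/2, -r2/2],
           vector [0, -1], vector [-r2/2, -r2/2], vector [-1, 0], vector [-r2/2, r2/2]] ! (j mod 8)"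

definition vertex :: "nat \<Rightarrow> real^2" where
  "vertex j = [vector [-1, sg], vector [1, sg], vector [sg, 1], vector [sg, -1],
           vector [1, -sg], vector [-1, -sg], vector [-sg, -1], vector [-sg, 1]] ! (j mod 8)"

definition Oct :: "(real^2) set" where "Oct = {u. \<forall>j. side_normal j \<bullet> u \<le> sg}"

definition Side :: "nat \<Rightarrow> (real^2) set" where "Side j = {u \<in> Oct. side_normal j \<bullet> u = sg}"

text \<open>The translation that glues side \<open>j\<close> to the opposite side \<open>j + 4\<close>.\<close>

definition glue_vec :: "nat \<Rightarrow> real^2" where "glue_vec j = - (2 * sg) *\<^sub>R side_normal j"

lemma less8: "(j::nat) < 8 \<longleftrightarrow> j = 0 \<or> j = 1 \<or> j = 2 \<or> j = 3 \<or> j = 4 \<or> j = 5 \<or> j = 6 \<or> j = 7"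
  by auto

lemma mod8_cases:
  "(j::nat) mod 8 = 0 \<or> j mod 8 = 1 \<or> j mod 8 = 2 \<or> j mod 8 = 3 \<or> j mod 8 = 4 \<or> j mod 8 = 5
    \<or> j mod 8 = 6 \<or> j mod 8 = 7"
  by linarith

lemma vec2_eq: "(u::real^2) = v \<longleftrightarrow> u$1 = v$1 \<and> u$2 = v$2"
  by (simp add: vec_eq_iff forall_2)

lemma inner2: "(u::real^2) \<bullet> v = u$1 * v$1 + u$2 * v$2"
  by (simp add: inner_vec_def sum_2)

lemma vector2_nth [simp]: "(vector [a, b] :: real^2) $ 1 = a" "(vector [a, b] :: real^2) $ 2 = b"
  by (simp_all add: vector_2)

lemma side_normal_mod: "side_normal j = side_normal (j mod 8)" and vertex_mod: "vertex j = vertex (j mod 8)"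
  and glue_vec_mod: "glue_vec j = glue_vec (j mod 8)" and Side_mod: "Side j = Side (j mod 8)"
  by (simp_all add: side_normal_def vertex_def glue_vec_def Side_def)

lemma side_normal_simps:
  "side_normal 0 = vector [0, 1]" "side_normal 1 = vector [r2/2, r2/2]" "side_normal 2 = vector [1, 0]"
  "side_normal 3 = vector [r2/2, -r2/2]" "side_normal 4 = vector [0, -1]" "side_normal 5 = vector [-r2/2, -r2/2]"
  "side_normal 6 = vector [-1, 0]" "side_normal 7 = vector [-r2/2, r2/2]" "side_normal (Suc 0) = vector [r2/2, r2/2]"
  by (simp_all add: side_normal_def)

lemma vertex_simps:
  "vertex 0 = vector [-1, sg]" "vertex 1 = vector [1, sg]" "vertex 2 = vector [sg, 1]"
  "vertex 3 = vector [sg, -1]" "vertex 4 = vector [1, -sg]" "vertex 5 = vector [-1, -sg]"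
  "vertex 6 = vector [-sg, -1]" "vertex 7 = vector [-sg, 1]" "vertex (Suc 0) = vector [1, sg]"
  by (simp_all add: vertex_def)

lemma glue_vec_simps:
  "glue_vec 0 = vector [0, - (2 * sg)]" "glue_vec 1 = vector [- (sg + 1), - (sg + 1)]"
  "glue_vec 2 = vector [- (2 * sg), 0]" "glue_vec 3 = vector [- (sg + 1), sg + 1]"
  "glue_vec 4 = vector [0, 2 * sg]" "glue_vec 5 = vector [sg + 1, sg + 1]"
  "glue_vec 6 = vector [2 * sg, 0]" "glue_vec 7 = vector [sg + 1, - (sg + 1)]"
  "glue_vec (Suc 0) = vector [- (sg + 1), - (sg + 1)]"
  using r2_sg by (simp_all add: glue_vec_def side_normal_simps vec2_eq mult.commute)

lemma half_r2_le: "r2 / 2 * x \<le> sg \<longleftrightarrow> x \<le> sg + 1" "r2 / 2 * x = sg \<longleftrightarrow> x = sg + 1"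
proof -
  have e: "r2 / 2 * x = x / r2" by (simp add: field_simps)
  show "r2 / 2 * x \<le> sg \<longleftrightarrow> x \<le> sg + 1" "r2 / 2 * x = sg \<longleftrightarrow> x = sg + 1"
    unfolding e using r2_sg by (simp_all add: field_simps)
qed

lemma side_normal_inner:
  "side_normal 0 \<bullet> u = u$2" "side_normal 1 \<bullet> u = r2 / 2 * (u$1 + u$2)"
  "side_normal 2 \<bullet> u = u$1" "side_normal 3 \<bullet> u = r2 / 2 * (u$1 - u$2)"
  "side_normal 4 \<bullet> u = - u$2" "side_normal 5 \<bullet> u = r2 / 2 * (- u$1 - u$2)"
  "side_normal 6 \<bullet> u = - u$1" "side_normal 7 \<bullet> u = r2 / 2 * (u$2 - u$1)"
  by (simp_all add: side_normal_simps inner2 algebra_simps)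

lemma side_normal_inner_le:
  "side_normal 0 \<bullet> u \<le> sg \<longleftrightarrow> u$2 \<le> sg" "side_normal 1 \<bullet> u \<le> sg \<longleftrightarrow> u$1 + u$2 \<le> sg + 1"
  "side_normal 2 \<bullet> u \<le> sg \<longleftrightarrow> u$1 \<le> sg" "side_normal 3 \<bullet> u \<le> sg \<longleftrightarrow> u$1 - u$2 \<le> sg + 1"
  "side_normal 4 \<bullet> u \<le> sg \<longleftrightarrow> - u$2 \<le> sg" "side_normal 5 \<bullet> u \<le> sg \<longleftrightarrow> - u$1 - u$2 \<le> sg + 1"
  "side_normal 6 \<bullet> u \<le> sg \<longleftrightarrow> - u$1 \<le> sg" "side_normal 7 \<bullet> u \<le> sg \<longleftrightarrow> u$2 - u$1 \<le> sg + 1"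
  unfolding side_normal_inner half_r2_le by simp_all

lemma side_normal_inner_eq:
  "side_normal 0 \<bullet> u = sg \<longleftrightarrow> u$2 = sg" "side_normal 1 \<bullet> u = sg \<longleftrightarrow> u$1 + u$2 = sg + 1"
  "side_normal 2 \<bullet> u = sg \<longleftrightarrow> u$1 = sg" "side_normal 3 \<bullet> u = sg \<longleftrightarrow> u$1 - u$2 = sg + 1"
  "side_normal 4 \<bullet> u = sg \<longleftrightarrow> u$2 = -sg" "side_normal 5 \<bullet> u = sg \<longleftrightarrow> u$1 + u$2 = - sg - 1"
  "side_normal 6 \<bullet> u = sg \<longleftrightarrow> u$1 = -sg" "side_normal 7 \<bullet> u = sg \<longleftrightarrow> u$2 - u$1 = sg + 1"
  unfolding side_normal_inner half_r2_le by auto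

lemma all_mod8:
  assumes "\<And>j. P j \<longleftrightarrow> P (j mod 8)"
  shows "(\<forall>j::nat. P j) \<longleftrightarrow> P 0 \<and> P 1 \<and> P 2 \<and> P 3 \<and> P 4 \<and> P 5 \<and> P 6 \<and> P 7"
proof -
  have "P j" if "P 0 \<and> P 1 \<and> P 2 \<and> P 3 \<and> P 4 \<and> P 5 \<and> P 6 \<and> P 7" for j
    using that mod8_cases[of j] assms[of j] by auto
  then show ?thesis by blast
qed

lemma mem_Oct: "u \<in> Oct \<longleftrightarrow> \<bar>u$1\<bar> \<le> sg \<and> \<bar>u$2\<bar> \<le> sg \<and> \<bar>u$1 + u$2\<bar> \<le> sg + 1 \<and> \<bar>u$1 - u$2\<bar> \<le> sg + 1"
proof -
  have "(\<forall>j. side_normal j \<bullet> u \<le> sg) \<longleftrightarrow> side_normal 0 \<bullet> u \<le> sg \<and> side_normal 1 \<bullet> u \<le> sg \<and> side_normal 2 \<bullet> u \<le> sg \<and> side_normal 3 \<bullet> u \<le> sg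
    \<and> side_normal 4 \<bullet> u \<le> sg \<and> side_normal 5 \<bullet> u \<le> sg \<and> side_normal 6 \<bullet> u \<le> sg \<and> side_normal 7 \<bullet> u \<le> sg"
    by (rule all_mod8) (metis side_normal_mod)
  also have "\<dots> \<longleftrightarrow> \<bar>u$1\<bar> \<le> sg \<and> \<bar>u$2\<bar> \<le> sg \<and> \<bar>u$1 + u$2\<bar> \<le> sg + 1 \<and> \<bar>u$1 - u$2\<bar> \<le> sg + 1"
    unfolding side_normal_inner_le by linarith
  finally show ?thesis by (simp add: Oct_def)
qed

text \<open>The simplifier rewrites the index 1 to \<open>Suc 0\<close>, hence the additional first clause.\<close>

lemma mem_Side:
  "u \<in> Side (Suc 0) \<longleftrightarrow> u$1 = sg + 1 - u$2 \<and> 1 \<le> u$2 \<and> u$2 \<le> sg"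
  "u \<in> Side 0 \<longleftrightarrow> u$2 = sg \<and> \<bar>u$1\<bar> \<le> 1"
  "u \<in> Side 1 \<longleftrightarrow> u$1 = sg + 1 - u$2 \<and> 1 \<le> u$2 \<and> u$2 \<le> sg"
  "u \<in> Side 2 \<longleftrightarrow> u$1 = sg \<and> \<bar>u$2\<bar> \<le> 1"
  "u \<in> Side 3 \<longleftrightarrow> u$1 = sg + 1 + u$2 \<and> -sg \<le> u$2 \<and> u$2 \<le> -1"
  "u \<in> Side 4 \<longleftrightarrow> u$2 = -sg \<and> \<bar>u$1\<bar> \<le> 1"
  "u \<in> Side 5 \<longleftrightarrow> u$1 = - sg - 1 - u$2 \<and> -sg \<le> u$2 \<and> u$2 \<le> -1"
  "u \<in> Side 6 \<longleftrightarrow> u$1 = -sg \<and> \<bar>u$2\<bar> \<le> 1"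
  "u \<in> Side 7 \<longleftrightarrow> u$1 = - sg - 1 + u$2 \<and> 1 \<le> u$2 \<and> u$2 \<le> sg"
  using sg_bounds
  unfolding Side_def mem_Oct mem_Collect_eq One_nat_def[symmetric] side_normal_inner_eq by (auto simp: abs_le_iff)

lemma ex_mod8:
  assumes "\<And>j. P j \<longleftrightarrow> P (j mod 8)"
  shows "(\<exists>j::nat. P j) \<longleftrightarrow> P 0 \<or> P 1 \<or> P 2 \<or> P 3 \<or> P 4 \<or> P 5 \<or> P 6 \<or> P 7"
  using all_mod8[of "\<lambda>j. \<not> P j"] assms by blast

lemma Suc_mod8: "vertex (Suc j) = vertex (Suc (j mod 8))" "vertex (j + k) = vertex (j mod 8 + k)"
  by (simp_all add: vertex_def mod_simps)

lemma Side_segment_less8: "j < 8 \<Longrightarrow> Side j = closed_segment (vertex j) (vertex (j + 1))"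
proof -
  have sgm: "closed_segment p q = {u. \<exists>t\<ge>0. t \<le> 1 \<and> u$1 = p$1 + t * (q$1 - p$1) \<and> u$2 = p$2 + t * (q$2 - p$2)}"
    for p q :: "real^2"
    by (auto simp: closed_segment_def vec2_eq algebra_simps)
  have vx8: "vertex 8 = vector [-1, sg]" by (simp add: vertex_def)
  have sg1: "sg - 1 > 0" using sg_bounds by simp
  have par: "(\<exists>t\<ge>0. t \<le> 1 \<and> R (t * (sg - 1))) \<longleftrightarrow> (\<exists>r\<ge>0. r \<le> sg - 1 \<and> R r)" for R
  proof safe
    fix t :: real assume "0 \<le> t" "t \<le> 1" "R (t * (sg - 1))"
    then show "\<exists>r\<ge>0. r \<le> sg - 1 \<and> R r"
      using sg1 by (intro exI[of _ "t * (sg - 1)"]) (simp add: mult_left_le_one_le)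
  next
    fix r assume "0 \<le> r" "r \<le> sg - 1" "R r"
    then show "\<exists>t\<ge>0. t \<le> 1 \<and> R (t * (sg - 1))"
      using sg1 by (intro exI[of _ "r / (sg - 1)"]) simp
  qed
  have sgn: "t * (1 - sg) = - (t * (sg - 1))" "t * (- 1 - - sg) = t * (sg - 1)" "t * (- sg - - 1) = - (t * (sg - 1))" for t
    by (simp_all add: algebra_simps)
  assume "j < 8"
  then consider "j = 0" | "j = 1" | "j = 2" | "j = 3" | "j = 4" | "j = 5" | "j = 6" | "j = 7" by linarith
  then show ?thesis
  proof cases
    case 1 have "u \<in> Side 0 \<longleftrightarrow> u \<in> closed_segment (vertex 0) (vertex 1)" for u
      unfolding sgm mem_Side vertex_simps by (auto intro!: exI[of _ "(u$1 + 1) / 2"] simp: field_simps)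
    then show ?thesis using 1 by auto
  next
    case 5 have "u \<in> Side 4 \<longleftrightarrow> u \<in> closed_segment (vertex 4) (vertex 5)" for u
      unfolding sgm mem_Side vertex_simps by (auto intro!: exI[of _ "(1 - u$1) / 2"] simp: field_simps)
    then show ?thesis using 5 by auto
  next
    case 3 have "u \<in> Side 2 \<longleftrightarrow> u \<in> closed_segment (vertex 2) (vertex 3)" for u
      unfolding sgm mem_Side vertex_simps by (auto intro!: exI[of _ "(1 - u$2) / 2"] simp: field_simps)
    then show ?thesis using 3 by auto
  next
    case 7 have "u \<in> Side 6 \<longleftrightarrow> u \<in> closed_segment (vertex 6) (vertex 7)" for u
      unfolding sgm mem_Side vertex_simps by (auto intro!: exI[of _ "(u$2 + 1) / 2"] simp: field_simps)
    then show ?thesis using 7 by auto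
  next
    case 2 have "u \<in> Side 1 \<longleftrightarrow> u \<in> closed_segment (vertex 1) (vertex 2)" for u
      unfolding sgm mem_Side vertex_simps vector2_nth
      unfolding sgn mem_Collect_eq par[of "\<lambda>r. u$1 = 1 + r \<and> u$2 = sg + - r"] par[of "\<lambda>r. u$1 = _ + r \<and> u$2 = _ + r"]
        par[of "\<lambda>r. u$1 = _ + - r \<and> u$2 = _ + - r"] par[of "\<lambda>r. u$1 = _ + - r \<and> u$2 = _ + r"]
      by (auto simp: algebra_simps intro!: exI[of _ "u$1 - 1"])
    then show ?thesis using 2 by (auto simp: numeral_2_eq_2)
  next
    case 4 have "u \<in> Side 3 \<longleftrightarrow> u \<in> closed_segment (vertex 3) (vertex 4)" for u
      unfolding sgm mem_Side vertex_simps vector2_nth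
      unfolding sgn mem_Collect_eq par[of "\<lambda>r. u$1 = _ + r \<and> u$2 = _ + - r"] par[of "\<lambda>r. u$1 = _ + r \<and> u$2 = _ + r"]
        par[of "\<lambda>r. u$1 = _ + - r \<and> u$2 = _ + - r"] par[of "\<lambda>r. u$1 = _ + - r \<and> u$2 = _ + r"]
      by (auto simp: algebra_simps intro!: exI[of _ "-1 - u$2"])
    then show ?thesis using 4 by auto
  next
    case 6 have "u \<in> Side 5 \<longleftrightarrow> u \<in> closed_segment (vertex 5) (vertex 6)" for u
      unfolding sgm mem_Side vertex_simps vector2_nth
      unfolding sgn mem_Collect_eq par[of "\<lambda>r. u$1 = _ + r \<and> u$2 = _ + - r"] par[of "\<lambda>r. u$1 = _ + r \<and> u$2 = _ + r"]
        par[of "\<lambda>r. u$1 = _ + - r \<and> u$2 = _ + - r"] par[of "\<lambda>r. u$1 = _ + - r \<and> u$2 = _ + r"]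
      by (auto simp: algebra_simps intro!: exI[of _ "u$2 + sg"])
    then show ?thesis using 6 by auto
  next
    case 8 have "u \<in> Side 7 \<longleftrightarrow> u \<in> closed_segment (vertex 7) (vertex 8)" for u
      unfolding sgm mem_Side vertex_simps vector2_nth vx8
      unfolding sgn mem_Collect_eq par[of "\<lambda>r. u$1 = _ + r \<and> u$2 = _ + - r"] par[of "\<lambda>r. u$1 = _ + r \<and> u$2 = _ + r"]
        par[of "\<lambda>r. u$1 = _ + - r \<and> u$2 = _ + - r"] par[of "\<lambda>r. u$1 = _ + - r \<and> u$2 = _ + r"]
      by (auto simp: algebra_simps intro!: exI[of _ "u$2 - 1"])
    then show ?thesis using 8 by auto
  qed
qed

lemma Side_segment: "Side j = closed_segment (vertex j) (vertex (j + 1))"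
  using Side_segment_less8[of "j mod 8"] Side_mod[of j] vertex_mod[of j] Suc_mod8(2)[of j 1] by simp

lemma convex_Oct: "convex Oct"
proof -
  have "Oct = (\<Inter>j. {u. side_normal j \<bullet> u \<le> sg})" by (auto simp: Oct_def)
  then show ?thesis using convex_INT[of UNIV "\<lambda>j. {u. side_normal j \<bullet> u \<le> sg}"] convex_halfspace_le by metis
qed

lemma closed_Oct: "closed Oct"
proof -
  have "Oct = (\<Inter>j. {u. side_normal j \<bullet> u \<le> sg})" by (auto simp: Oct_def)
  then show ?thesis using closed_INT[of UNIV "\<lambda>j. {u. side_normal j \<bullet> u \<le> sg}"] closed_halfspace_le by metis
qed

lemma closed_Side: "closed (Side j)" by (simp add: Side_segment)

lemma vertex_in_Side: "vertex j \<in> Side j" "vertex (Suc j) \<in> Side j" by (simp_all add: Side_segment)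
lemma Side_subset: "Side j \<subseteq> Oct" by (auto simp: Side_def)
lemma vertex_in_Oct: "vertex j \<in> Oct" using vertex_in_Side Side_subset by blast

lemma Oct_hull: "Oct = convex hull (range vertex)"
proof
  show "convex hull range vertex \<subseteq> Oct"
    by (rule hull_minimal) (auto simp: vertex_in_Oct convex_Oct)
  show "Oct \<subseteq> convex hull range vertex"
  proof
    fix u assume u: "u \<in> Oct"
    have Side_in_hull: "x \<in> Side j \<Longrightarrow> x \<in> convex hull range vertex" for x j
    proof -
      assume "x \<in> Side j"
      then have "x \<in> closed_segment (vertex j) (vertex (j + 1))" by (simp add: Side_segment)
      moreover have "closed_segment (vertex j) (vertex (j + 1)) \<subseteq> convex hull range vertex"
        by (rule closed_segment_subset_convex_hull) (auto intro: hull_inc)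
      ultimately show ?thesis by blast
    qed
    \<comment> \<open>the horizontal chord through the point ends on two sides\<close>
    have chord: "u \<in> convex hull range vertex"
      if "vector [a, u$2] \<in> Side j" "vector [-a, u$2] \<in> Side k" "\<bar>u$1\<bar> \<le> a" "0 < a" for a j k
    proof -
      have "u = (1 - (u$1 + a) / (2 * a)) *\<^sub>R vector [-a, u$2] + ((u$1 + a) / (2 * a)) *\<^sub>R vector [a, u$2]"
        using that by (simp add: vec2_eq field_simps)
      then have "u \<in> closed_segment (vector [-a, u$2]) (vector [a, u$2])"
        unfolding in_segment using that(3,4) by (intro exI[of _ "(u$1 + a) / (2 * a)"]) (auto simp: field_simps)
      then show ?thesis
        using closed_segment_subset_convex_hull[OF Side_in_hull[OF that(2)] Side_in_hull[OF that(1)]] by blast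
    qed
    consider "\<bar>u$2\<bar> \<le> 1" | "u$2 > 1" | "u$2 < -1" by linarith
    then show "u \<in> convex hull range vertex"
    proof cases
      case 1 show ?thesis using u 1 sg_bounds by (intro chord[of sg 2 6]) (auto simp: mem_Side mem_Oct)
    next
      case 2 show ?thesis using u 2 sg_bounds by (intro chord[of "sg + 1 - u$2" 1 7]) (auto simp: mem_Side mem_Oct)
    next
      case 3 show ?thesis using u 3 sg_bounds by (intro chord[of "sg + 1 + u$2" 3 5]) (auto simp: mem_Side mem_Oct)
    qed
  qed
qed

lemma side_normal_add4: "side_normal (j + 4) = - side_normal j"
proof -
  have "\<And>j. j < 8 \<Longrightarrow> side_normal (j + 4) = - side_normal j"
    unfolding less8 by (auto simp: side_normal_def vec2_eq)
  moreover have "side_normal (j + 4) = side_normal (j mod 8 + 4)" by (simp add: side_normal_def mod_simps)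
  ultimately show ?thesis using side_normal_mod[of j] by simp
qed

lemma side_normal_norm: "side_normal j \<bullet> side_normal j = 1"
proof -
  have "\<And>j. j < 8 \<Longrightarrow> side_normal j \<bullet> side_normal j = 1"
    unfolding less8 by (auto simp: side_normal_simps inner2)
  then show ?thesis using side_normal_mod[of j] by simp
qed

lemma glue_vec_add4: "glue_vec (j + 4) = - glue_vec j" by (simp add: glue_vec_def side_normal_add4)

lemma glue_vec_vertex: "vertex (j + 5) - vertex j = glue_vec j"
proof -
  have "\<And>j. j < 8 \<Longrightarrow> vertex (j + 5) - vertex j = glue_vec j"
    unfolding less8 by (auto simp: vertex_def glue_vec_simps vec2_eq)
  moreover have "vertex (j + 5) = vertex (j mod 8 + 5)" by (simp add: vertex_def mod_simps)
  ultimately show ?thesis using vertex_mod[of j] glue_vec_mod[of j] by simp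
qed

text \<open>Opposite sides have distance \<open>2 * sg\<close>, so a gluing vector moves a point of the octagon out of it
unless the point is on the side. Hence two points of the octagon that differ by a gluing vector are
glued.\<close>

lemma glue_vec_Side:
  assumes "u \<in> Oct" "u + glue_vec j \<in> Oct"
  shows "u \<in> Side j" "u + glue_vec j \<in> Side (j + 4)"
proof -
  have "side_normal (j + 4) \<bullet> (u + glue_vec j) \<le> sg" using assms by (auto simp: Oct_def)
  moreover have eq: "side_normal (j + 4) \<bullet> (u + glue_vec j) = 2 * sg - side_normal j \<bullet> u"
    by (simp add: side_normal_add4 glue_vec_def inner_diff_right side_normal_norm)
  moreover have "side_normal j \<bullet> u \<le> sg" using assms by (auto simp: Oct_def)
  ultimately have "side_normal j \<bullet> u = sg" by simp
  then show "u \<in> Side j" "u + glue_vec j \<in> Side (j + 4)" using assms eq by (auto simp: Side_def)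
qed

lemma Side_glue_vec:
  assumes "u \<in> Side j" shows "u + glue_vec j \<in> Oct"
proof -
  have "(j + 9) mod 8 = (j + 1) mod 8" using mod_add_self2[of "j + 1" 8] by (simp add: add.commute)
  then have "vertex (j + 9) = vertex (j + 1)" by (metis vertex_mod)
  then have e2: "vertex (j + 1) + glue_vec j = vertex (j + 4)"
    using glue_vec_vertex[of "j + 4"] by (simp add: glue_vec_add4 algebra_simps)
  have e1: "vertex j + glue_vec j = vertex (j + 5)" using glue_vec_vertex[of j] by (simp add: algebra_simps)
  have "u + glue_vec j \<in> closed_segment (vertex j + glue_vec j) (vertex (j + 1) + glue_vec j)"
    using assms unfolding Side_segment in_segment by (auto simp: algebra_simps)
  then show ?thesis unfolding e1 e2
    using convex_Oct vertex_in_Oct by (meson convex_contains_segment subsetD)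
qed

definition Verts :: "(real^2) set" where "Verts = range vertex"

lemma Verts_subset: "Verts \<subseteq> Oct" by (auto simp: Verts_def vertex_in_Oct)

lemma Verts_eq: "Verts = vertex ` {..<8}"
  unfolding Verts_def using vertex_mod by (auto simp: image_iff) (metis lessThan_iff mod_less_divisor zero_less_numeral)

lemma finite_Verts: "finite Verts" by (simp add: Verts_eq)

lemma mem_Verts: "u \<in> Verts \<longleftrightarrow> \<bar>u$1\<bar> = 1 \<and> \<bar>u$2\<bar> = sg \<or> \<bar>u$1\<bar> = sg \<and> \<bar>u$2\<bar> = 1"
proof -
  have "u \<in> Verts \<longleftrightarrow> (\<exists>j. u = vertex j)" by (auto simp: Verts_def)
  also have "\<dots> \<longleftrightarrow> u = vertex 0 \<or> u = vertex 1 \<or> u = vertex 2 \<or> u = vertex 3 \<or> u = vertex 4 \<or> u = vertex 5 \<or> u = vertex 6 \<or> u = vertex 7"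
    by (rule ex_mod8) (metis vertex_mod)
  also have "\<dots> \<longleftrightarrow> \<bar>u$1\<bar> = 1 \<and> \<bar>u$2\<bar> = sg \<or> \<bar>u$1\<bar> = sg \<and> \<bar>u$2\<bar> = 1"
  proof -
    have e: "\<bar>a\<bar> = 1 \<longleftrightarrow> a = 1 \<or> a = -1" "\<bar>a\<bar> = sg \<longleftrightarrow> a = sg \<or> a = -sg" for a :: real
      using sg_bounds by linarith+
    show ?thesis unfolding vertex_simps vec2_eq vector2_nth e by blast
  qed
  finally show ?thesis .
qed

lemma mem_open_Side:
  assumes "u \<notin> Verts"
  shows "u \<in> Side 0 \<longleftrightarrow> u$2 = sg \<and> -1 < u$1 \<and> u$1 < 1"
    "u \<in> Side 1 \<longleftrightarrow> u$1 = sg + 1 - u$2 \<and> 1 < u$2 \<and> u$2 < sg"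
    "u \<in> Side (Suc 0) \<longleftrightarrow> u$1 = sg + 1 - u$2 \<and> 1 < u$2 \<and> u$2 < sg"
    "u \<in> Side 2 \<longleftrightarrow> u$1 = sg \<and> -1 < u$2 \<and> u$2 < 1"
    "u \<in> Side 3 \<longleftrightarrow> u$1 = sg + 1 + u$2 \<and> -sg < u$2 \<and> u$2 < -1"
    "u \<in> Side 4 \<longleftrightarrow> u$2 = -sg \<and> -1 < u$1 \<and> u$1 < 1"
    "u \<in> Side 5 \<longleftrightarrow> u$1 = - sg - 1 - u$2 \<and> -sg < u$2 \<and> u$2 < -1"
    "u \<in> Side 6 \<longleftrightarrow> u$1 = -sg \<and> -1 < u$2 \<and> u$2 < 1"
    "u \<in> Side 7 \<longleftrightarrow> u$1 = - sg - 1 + u$2 \<and> 1 < u$2 \<and> u$2 < sg"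
proof -
  have side_normal: "u \<noteq> vertex j" for j using assms by (auto simp: Verts_def)
  note n = side_normal[of 0] side_normal[of 1] side_normal[of 2] side_normal[of 3] side_normal[of 4] side_normal[of 5] side_normal[of 6] side_normal[of 7]
  note n' = n[unfolded vertex_simps vec2_eq vector2_nth]
  show "u \<in> Side 0 \<longleftrightarrow> u$2 = sg \<and> -1 < u$1 \<and> u$1 < 1" unfolding mem_Side using n'(1,2) by linarith
  show 1: "u \<in> Side 1 \<longleftrightarrow> u$1 = sg + 1 - u$2 \<and> 1 < u$2 \<and> u$2 < sg" unfolding mem_Side using n'(2,3) by linarith
  show "u \<in> Side 2 \<longleftrightarrow> u$1 = sg \<and> -1 < u$2 \<and> u$2 < 1" unfolding mem_Side using n'(3,4) by linarith
  show "u \<in> Side 3 \<longleftrightarrow> u$1 = sg + 1 + u$2 \<and> -sg < u$2 \<and> u$2 < -1" unfolding mem_Side using n'(4,5) by linarith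
  show "u \<in> Side 4 \<longleftrightarrow> u$2 = -sg \<and> -1 < u$1 \<and> u$1 < 1" unfolding mem_Side using n'(5,6) by linarith
  show "u \<in> Side 5 \<longleftrightarrow> u$1 = - sg - 1 - u$2 \<and> -sg < u$2 \<and> u$2 < -1" unfolding mem_Side using n'(6,7) by linarith
  show "u \<in> Side 6 \<longleftrightarrow> u$1 = -sg \<and> -1 < u$2 \<and> u$2 < 1" unfolding mem_Side using n'(7,8) by linarith
  show "u \<in> Side 7 \<longleftrightarrow> u$1 = - sg - 1 + u$2 \<and> 1 < u$2 \<and> u$2 < sg" unfolding mem_Side using n'(8,1) by linarith
  show "u \<in> Side (Suc 0) \<longleftrightarrow> u$1 = sg + 1 - u$2 \<and> 1 < u$2 \<and> u$2 < sg" using 1 by simp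
qed

lemma Side_inter:
  assumes "u \<in> Side j" "u \<in> Side k" "j mod 8 \<noteq> k mod 8"
  shows "u \<in> Verts"
proof (rule ccontr)
  assume u: "u \<notin> Verts"
  have "\<And>j k. j < 8 \<Longrightarrow> k < 8 \<Longrightarrow> j \<noteq> k \<Longrightarrow> u \<in> Side j \<Longrightarrow> u \<in> Side k \<Longrightarrow> False"
    unfolding less8 using sg_bounds by (elim disjE; simp add: mem_open_Side[OF u])
  then show False using assms Side_mod by (metis mod_less_divisor zero_less_numeral)
qed

lemma Verts_glue_vec:
  assumes "u \<in> Verts" "u \<in> Side j" shows "u + glue_vec j \<in> Verts"
proof -
  have "\<And>j. j < 8 \<Longrightarrow> u \<in> Side j \<Longrightarrow> u + glue_vec j \<in> Verts"
    using assms(1) unfolding less8 mem_Verts using sg_bounds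
    by (elim disjE) (simp_all add: mem_Side glue_vec_simps abs_if split: if_splits)
  then show ?thesis using assms(2) Side_mod glue_vec_mod by (metis mod_less_divisor zero_less_numeral)
qed

section \<open>The surface in normalized coordinates\<close>

text \<open>The gluing relation, made explicit: all vertices form one class, and every other class is a single
point or a pair of opposite side points.\<close>

definition eqv :: "real^2 \<Rightarrow> real^2 \<Rightarrow> bool" where
  "eqv u u' \<longleftrightarrow> u = u' \<or> (\<exists>j. u \<in> Side j \<and> u' = u + glue_vec j) \<or> (u \<in> Verts \<and> u' \<in> Verts)"

lemma eqv_refl [simp]: "eqv u u" by (simp add: eqv_def)

lemma Side_glue_vec4: "u \<in> Side j \<Longrightarrow> u + glue_vec j \<in> Side (j + 4)"
  using Side_glue_vec glue_vec_Side(2) Side_subset by blast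

lemma eqv_sym: assumes "eqv u u'" shows "eqv u' u"
proof -
  have "\<exists>k. u + glue_vec j \<in> Side k \<and> u = (u + glue_vec j) + glue_vec k" if "u \<in> Side j" for j
    using that Side_glue_vec4 by (intro exI[of _ "j + 4"]) (simp add: glue_vec_add4)
  then show ?thesis using assms unfolding eqv_def by metis
qed

lemma eqv_Verts: "eqv u u' \<Longrightarrow> u \<in> Verts \<longleftrightarrow> u' \<in> Verts"
  using eqv_sym Verts_glue_vec unfolding eqv_def by (metis eqv_def)

lemma eqv_Oct: "eqv u u' \<Longrightarrow> u \<in> Oct \<Longrightarrow> u' \<in> Oct"
  unfolding eqv_def using Side_glue_vec Verts_subset by auto

lemma eqv_trans: assumes "eqv u v" "eqv v w" shows "eqv u w"
proof (cases "v \<in> Verts")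
  case True
  then show ?thesis using eqv_Verts assms by (metis eqv_def)
next
  case False
  show ?thesis
  proof (cases "u = v \<or> v = w")
    case True then show ?thesis using assms by auto
  next
    case neq: False
    obtain j where j: "u \<in> Side j" "v = u + glue_vec j" using neq assms(1) False by (auto simp: eqv_def)
    obtain k where k: "v \<in> Side k" "w = v + glue_vec k" using neq assms(2) False by (auto simp: eqv_def)
    have "v \<in> Side (j + 4)" using Side_glue_vec4 j by simp
    then have "(j + 4) mod 8 = k mod 8" using Side_inter k(1) False by blast
    then have "glue_vec k = - glue_vec j" by (metis glue_vec_add4 glue_vec_mod)
    then show ?thesis using j k by simp
  qed
qed

lemma eqv_glue_vecI: "u \<in> Oct \<Longrightarrow> u' \<in> Oct \<Longrightarrow> u' - u = glue_vec j \<Longrightarrow> eqv u u'"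
  unfolding eqv_def using glue_vec_Side(1)[of u j] by (auto simp: algebra_simps)

locale octagonal_surface =
  fixes V :: "nat \<Rightarrow> real^2" and c :: "real^2" and \<rho> :: real
  assumes \<rho>_pos: "0 < \<rho>" and V_eq: "V j = c + \<rho> *\<^sub>R vertex j"

text \<open>The ratio of the two coordinates of a vertex.\<close>

lemma pi8: "cos (pi / 8) = sg * sin (pi / 8)" "0 < sin (pi / 8)"
proof -
  show s: "0 < sin (pi / 8)" by (rule sin_gt_zero) (use pi_gt_zero in auto)
  have 1: "2 * sin (pi / 8) * cos (pi / 8) = r2 / 2"
    using sin_double[of "pi / 8"] sin_45 by simp
  have 2: "2 * (sin (pi / 8))\<^sup>2 = 1 - r2 / 2"
    using cos_double_sin[of "pi / 8"] cos_45 by (simp add: field_simps)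
  have "sg * (2 * (sin (pi / 8))\<^sup>2) = r2 / 2"
    unfolding 2 sg_def using r2_sq by (simp add: algebra_simps)
  then have "2 * sin (pi / 8) * cos (pi / 8) = 2 * sin (pi / 8) * (sg * sin (pi / 8))"
    using 1 unfolding power2_eq_square by argo
  then show "cos (pi / 8) = sg * sin (pi / 8)" using s by (metis mult_cancel_left mult_eq_0_iff less_irrefl zero_neq_numeral)
qed

lemma vertex_Suc: "vertex (Suc j) = vector [r2 / 2 * (vertex j $ 1 + vertex j $ 2), r2 / 2 * (vertex j $ 2 - vertex j $ 1)]"
proof -
  have e: "r2 / 2 * (1 + sg) = sg" using r2_sg unfolding sg_def by (simp add: algebra_simps)
  have e2: "r2 / 2 * (sg - 1) = 1" unfolding sg_def by simp
  have e3: "r2 / 2 * (-1 - sg) = - sg" "r2 / 2 * (sg + 1) = sg" "r2 / 2 * (1 - sg) = -1"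
      "r2 / 2 * (- 1 + sg) = 1" "r2 / 2 * (- sg - 1) = - sg" "r2 / 2 * (- sg + 1) = -1"
      "r2 / 2 * (- 1 + - sg) = - sg" "r2 / 2 * (- sg + -1) = - sg" "r2 / 2 * (1 + - sg) = - 1"
      "r2 / 2 * (- sg - -1) = - 1" "r2 / 2 * (-1 - - sg) = 1" "r2 / 2 * (sg - -1) = sg" "r2 / 2 * (1 - - sg) = sg"
    using e e2 by (simp_all add: algebra_simps)
  have "j < 8 \<Longrightarrow> vertex (Suc j) = vector [r2 / 2 * (vertex j $ 1 + vertex j $ 2), r2 / 2 * (vertex j $ 2 - vertex j $ 1)]" for j
    unfolding less8 by (elim disjE; simp only:) (simp_all only: vertex_def vec2_eq, simp_all add: e e2 e3 del: times_divide_eq_left divide_minus_left)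
  from this[of "j mod 8"] show ?thesis using vertex_mod[of j] Suc_mod8(1)[of j] by simp
qed

lemma regular_octagon_normalized:
  assumes "regular_octagon V" shows "\<exists>c \<rho>. octagonal_surface V c \<rho>"
proof -
  obtain c r where r: "0 < r" and V: "\<And>j. V j = c + r *\<^sub>R vector [cos (5 * pi / 8 - real j * pi / 4), sin (5 * pi / 8 - real j * pi / 4)]"
    using assms unfolding regular_octagon_def by auto
  have "vector [cos (5 * pi / 8 - real j * pi / 4), sin (5 * pi / 8 - real j * pi / 4)] = sin (pi / 8) *\<^sub>R vertex j" for j
  proof (induction j)
    case 0
    have e: "5 * pi / 8 = pi / 8 + pi / 2" by simp
    have "cos (pi / 8 + pi / 2) = - sin (pi / 8)" "sin (pi / 8 + pi / 2) = cos (pi / 8)"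
      unfolding cos_add sin_add by simp_all
    then show ?case unfolding e[symmetric] vec2_eq using pi8(1) by (simp add: vertex_simps)
  next
    case (Suc j)
    define a where "a = 5 * pi / 8 - real j * pi / 4"
    have a: "5 * pi / 8 - real (Suc j) * pi / 4 = a - pi / 4" by (simp add: a_def field_simps)
    have IH: "cos a = sin (pi / 8) * vertex j $ 1" "sin a = sin (pi / 8) * vertex j $ 2"
      using Suc by (simp_all add: a_def vec2_eq)
    show ?case unfolding a vec2_eq vertex_Suc
      by (simp add: cos_diff sin_diff cos_45 sin_45 IH algebra_simps)
  qed
  then have "octagonal_surface V c (r * sin (pi / 8))"
    using r pi8(2) V by unfold_locales (simp_all)
  then show ?thesis by blast
qed

context octagonal_surface
begin

definition pt :: "real^2 \<Rightarrow> real^2" where "pt u = c + \<rho> *\<^sub>R u"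

definition cls :: "real^2 \<Rightarrow> surface_point" where "cls u = surf_pt V (pt u)"

lemma pt_inject [simp]: "pt u = pt u' \<longleftrightarrow> u = u'"
  using \<rho>_pos by (simp add: pt_def)

lemma V_pt: "V j = pt (vertex j)" by (simp add: V_eq pt_def)

lemma pt_add: "pt u + \<rho> *\<^sub>R a = pt (u + a)" by (simp add: pt_def algebra_simps)

lemma octagon_eq: "octagon V = pt ` Oct"
proof -
  have "range V = (\<lambda>u. c + \<rho> *\<^sub>R u) ` range vertex" by (auto simp: V_eq)
  then show ?thesis unfolding octagon_def Oct_hull pt_def by (simp only: convex_hull_affinity)
qed

lemma oct_side_eq: "oct_side V j = pt ` Side j"
proof -
  have "{V j, V (j + 1)} = (\<lambda>u. c + \<rho> *\<^sub>R u) ` {vertex j, vertex (j + 1)}" by (auto simp: V_eq)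
  then show ?thesis unfolding oct_side_def Side_segment pt_def segment_convex_hull by (simp only: convex_hull_affinity)
qed

lemma glue_eq: "glue V x y \<longleftrightarrow> (\<exists>j u. u \<in> Side j \<and> x = pt u \<and> y = pt (u + glue_vec j))"
proof -
  have "V (j + 5) - V j = \<rho> *\<^sub>R glue_vec j" for j
    unfolding glue_vec_vertex[symmetric] V_eq by (simp add: algebra_simps)
  then show ?thesis unfolding glue_def oct_side_eq by (auto simp: pt_add)
qed

lemma equivclp_glue_vertices: "equivclp (glue V) (V i) (V j)"
proof -
  have step: "equivclp (glue V) (V i) (V (i + 5))" for i
    by (rule r_into_equivclp) (use vertex_in_Side(1) in \<open>auto simp: glue_def oct_side_def\<close>)
  have "equivclp (glue V) (V 0) (V (5 * n))" for n
  proof (induction n)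
    case (Suc n) then show ?case using step[of "5 * n"] equivclp_trans by (metis add.commute mult_Suc_right)
  qed simp
  moreover have "V (5 * (5 * j)) = V j" for j
  proof -
    have "5 * (5 * j) = j + 8 * (3 * j)" by simp
    then have "(5 * (5 * j)) mod 8 = j mod 8" by (metis mod_mult_self2)
    then show ?thesis unfolding V_eq by (metis vertex_mod)
  qed
  ultimately have "equivclp (glue V) (V 0) (V j)" for j by metis
  then show ?thesis by (meson equivclp_sym equivclp_trans)
qed

lemma equivclp_glue:
  assumes "u \<in> Oct" shows "equivclp (glue V) (pt u) y \<longleftrightarrow> (\<exists>u'. y = pt u' \<and> eqv u u')"
proof
  assume "equivclp (glue V) (pt u) y"
  then show "\<exists>u'. y = pt u' \<and> eqv u u'"
  proof (induction rule: equivclp_induct)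
    case base then show ?case by auto
  next
    case (step y z)
    then obtain u' where u': "y = pt u'" "eqv u u'" by blast
    have "\<exists>w. z = pt w \<and> eqv u' w"
    proof -
      consider j u where "u \<in> Side j" "y = pt u" "z = pt (u + glue_vec j)" | j u where "u \<in> Side j" "z = pt u" "y = pt (u + glue_vec j)"
        using step(2) unfolding glue_eq by auto
      then show ?thesis
      proof cases
        case 1 then show ?thesis using u' by (auto simp: eqv_def)
      next
        case (2 j u)
        then have "eqv u u'" using u' by (auto simp: eqv_def)
        then show ?thesis using eqv_sym 2 by blast
      qed
    qed
    then show ?case using u' eqv_trans by blast
  qed
next
  assume "\<exists>u'. y = pt u' \<and> eqv u u'"
  then obtain u' where u': "y = pt u'" "eqv u u'" by blast
  from u'(2) consider "u = u'" | j where "u \<in> Side j" "u' = u + glue_vec j" | "u \<in> Verts" "u' \<in> Verts"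
    by (auto simp: eqv_def)
  then show "equivclp (glue V) (pt u) y"
  proof cases
    case 2 then show ?thesis unfolding u' by (intro r_into_equivclp) (auto simp: glue_eq)
  next
    case 3 then show ?thesis unfolding u' using equivclp_glue_vertices by (auto simp: Verts_def V_pt)
  qed (simp add: u')
qed

lemma glue_rel_eq: "u \<in> Oct \<Longrightarrow> (pt u, y) \<in> glue_rel V \<longleftrightarrow> (\<exists>u'. y = pt u' \<and> eqv u u')"
  unfolding glue_rel_def octagon_eq using eqv_Oct by (auto simp: equivclp_glue)

lemma cls_eq_image: "u \<in> Oct \<Longrightarrow> cls u = pt ` {u'. eqv u u'}"
  unfolding cls_def surf_pt_def by (auto simp: glue_rel_eq)

lemma cls_eq_iff: assumes "u \<in> Oct" "u' \<in> Oct" shows "cls u = cls u' \<longleftrightarrow> eqv u u'"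
proof
  assume "cls u = cls u'"
  then have "pt u' \<in> pt ` {u'. eqv u u'}" using cls_eq_image assms by auto
  then show "eqv u u'" by auto
next
  assume "eqv u u'"
  then have "{w. eqv u w} = {w. eqv u' w}" using eqv_trans eqv_sym by blast
  then show "cls u = cls u'" using cls_eq_image assms by auto
qed

lemma surface_eq: "surface V = cls ` Oct"
  unfolding surface_def quotient_def octagon_eq cls_def surf_pt_def by auto

lemma singular_eq: "singular V = cls ` Verts"
  unfolding singular_def cls_def Verts_def by (auto simp: V_pt)

lemma cls_singular: assumes "u \<in> Oct" shows "cls u \<in> singular V \<longleftrightarrow> u \<in> Verts"
proof
  assume "cls u \<in> singular V"
  then obtain u' where "u' \<in> Verts" "cls u = cls u'" by (auto simp: singular_eq)
  then show "u \<in> Verts" using cls_eq_iff eqv_Verts assms Verts_subset by blast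
qed (auto simp: singular_eq)

lemma surface_regular: "p \<in> surface V - singular V \<longleftrightarrow> (\<exists>u. u \<in> Oct - Verts \<and> p = cls u)"
  using cls_singular by (auto simp: surface_eq)

lemma cls_Side: "surf_pt V ` oct_side V j = cls ` Side j"
  unfolding oct_side_eq cls_def by (simp add: image_image)

lemma shifted_eq:
  assumes "u \<in> Oct"
  shows "shifted V (cls u) (\<rho> *\<^sub>R a) q \<longleftrightarrow> (\<exists>u'\<in>Oct. cls u' = cls u \<and> u' + a \<in> Oct \<and> q = cls (u' + a))"
proof -
  have "shifted V (cls u) (\<rho> *\<^sub>R a) q \<longleftrightarrow> (\<exists>u'. eqv u u' \<and> u' + a \<in> Oct \<and> q = cls (u' + a))"
    unfolding shifted_def cls_eq_image[OF assms] octagon_eq by (auto simp: pt_add cls_def)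
  also have "\<dots> \<longleftrightarrow> (\<exists>u'\<in>Oct. cls u' = cls u \<and> u' + a \<in> Oct \<and> q = cls (u' + a))"
    using cls_eq_iff[OF assms] eqv_Oct[of u] assms by metis
  finally show ?thesis .
qed

lemma openin_surface: "openin (surface_topology V) U \<longleftrightarrow>
    U \<subseteq> cls ` Oct \<and> openin (top_of_set Oct) {u \<in> Oct. cls u \<in> U}"
proof -
  let ?A = "{u \<in> Oct. cls u \<in> U}"
  have 1: "{x \<in> octagon V. surf_pt V x \<in> U} = pt ` ?A"
    unfolding octagon_eq cls_def by auto
  have cpt: "continuous_on UNIV pt" unfolding pt_def by (intro continuous_intros)
  define pi where "pi x = (1 / \<rho>) *\<^sub>R (x - c)" for x
  have cpi: "continuous_on UNIV pi" unfolding pi_def by (intro continuous_intros)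
  have pp: "pi (pt u) = u" for u using \<rho>_pos by (simp add: pi_def pt_def)
  have "openin (top_of_set (pt ` Oct)) (pt ` ?A) \<longleftrightarrow> openin (top_of_set Oct) ?A"
  proof
    assume "openin (top_of_set (pt ` Oct)) (pt ` ?A)"
    then obtain T where T: "open T" "pt ` ?A = pt ` Oct \<inter> T" by (auto simp: openin_open)
    have "?A = Oct \<inter> pt -` T"
    proof (rule set_eqI)
      fix u show "u \<in> ?A \<longleftrightarrow> u \<in> Oct \<inter> pt -` T"
        using arg_cong[OF T(2), of "\<lambda>S. pt u \<in> S"] by (auto simp: image_iff)
    qed
    moreover have "open (pt -` T)" using open_vimage[OF T(1) cpt] .
    ultimately show "openin (top_of_set Oct) ?A" unfolding openin_open by blast
  next
    assume "openin (top_of_set Oct) ?A"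
    then obtain T where T: "open T" "?A = Oct \<inter> T" by (auto simp: openin_open)
    have "pt ` ?A = pt ` Oct \<inter> pi -` T" unfolding T(2) by (auto simp: pp)
    moreover have "open (pi -` T)" using open_vimage[OF T(1) cpi] .
    ultimately show "openin (top_of_set (pt ` Oct)) (pt ` ?A)" unfolding openin_open by blast
  qed
  then show ?thesis unfolding openin_surface_topology 1 surface_eq by (simp add: octagon_eq)
qed

lemma topspace_surface [simp]: "topspace (surface_topology V) = cls ` Oct"
proof -
  have "openin (surface_topology V) (cls ` Oct)"
    unfolding openin_surface using openin_subtopology_self
    by (metis (mono_tags, lifting) Collect_cong Collect_mem_eq image_eqI order_refl)
  then show ?thesis using openin_surface by (meson openin_subset openin_topspace subset_antisym)
qed

end

section \<open>Trajectories\<close>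

text \<open>A ray leaves the octagon through the side whose line it reaches first.\<close>

lemma exit_side:
  assumes x: "x \<in> Oct" and a: "a \<noteq> 0"
  shows "\<exists>S\<ge>0. \<exists>j. x + S *\<^sub>R a \<in> Side j \<and> 0 < side_normal j \<bullet> a"
proof -
  define J where "J = {j. j < 8 \<and> 0 < side_normal j \<bullet> a}"
  have fin: "finite J" by (simp add: J_def)
  have "J \<noteq> {}"
  proof
    assume "J = {}"
    then have "side_normal j \<bullet> a \<le> 0" if "j < 8" for j using that by (force simp: J_def)
    from this[of 0] this[of 2] this[of 4] this[of 6] have "a$1 = 0" "a$2 = 0" by (simp_all add: side_normal_inner)
    then show False using a by (simp add: vec2_eq)
  qed
  define q where "q j = (sg - side_normal j \<bullet> x) / (side_normal j \<bullet> a)" for j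
  define S where "S = Min (q ` J)"
  have "S \<in> q ` J" unfolding S_def using fin \<open>J \<noteq> {}\<close> by (intro Min_in) auto
  then obtain j where j: "j \<in> J" "S = q j" by auto
  have le: "side_normal k \<bullet> x \<le> sg" for k using x by (auto simp: Oct_def)
  have S0: "S \<ge> 0" using j le[of j] by (simp add: q_def J_def)
  have "side_normal k \<bullet> (x + S *\<^sub>R a) \<le> sg" if "k < 8" for k
  proof (cases "k \<in> J")
    case True
    then have "S \<le> q k" unfolding S_def using fin by (intro Min_le) auto
    then have "S * (side_normal k \<bullet> a) \<le> sg - side_normal k \<bullet> x" using True by (simp add: q_def J_def field_simps)
    then show ?thesis by (simp add: inner_add_right)
  next
    case False
    then have "S * (side_normal k \<bullet> a) \<le> 0" using that S0 by (simp add: J_def mult_nonneg_nonpos)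
    then show ?thesis using le[of k] by (simp add: inner_add_right)
  qed
  then have "side_normal (k mod 8) \<bullet> (x + S *\<^sub>R a) \<le> sg" for k by simp
  then have "x + S *\<^sub>R a \<in> Oct" unfolding Oct_def using side_normal_mod by simp
  moreover have "side_normal j \<bullet> (x + S *\<^sub>R a) = sg" using j by (simp add: q_def J_def inner_add_right)
  ultimately show ?thesis using S0 j by (auto simp: Side_def J_def)
qed

context octagonal_surface
begin

text \<open>The two representatives of a point inside a side differ by a gluing vector, and they still do after
a common shift.\<close>

lemma shift_unique:
  assumes "u \<in> Oct" "u' \<in> Oct" "cls u = cls u'" "u \<notin> Verts" "u + b \<in> Oct" "u' + b \<in> Oct"
  shows "cls (u + b) = cls (u' + b)"
proof -
  have "eqv u u'" using assms cls_eq_iff by blast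
  then consider "u = u'" | j where "u' = u + glue_vec j" using assms(4) by (auto simp: eqv_def)
  then show ?thesis
  proof cases
    case 2 then show ?thesis using assms by (intro iffD2[OF cls_eq_iff] eqv_glue_vecI[of _ _ j]) auto
  qed simp
qed

text \<open>Trajectories on a set of times, since the proof that an automorphism with derivative 1 fixes the top
side follows the image of an open segment. The velocity is measured in normalized coordinates.\<close>

definition traj_on :: "real set \<Rightarrow> real^2 \<Rightarrow> (real \<Rightarrow> surface_point) \<Rightarrow> bool" where
  "traj_on I a \<tau> \<longleftrightarrow> (\<forall>t\<in>I. \<tau> t \<in> surface V - singular V \<and>
     (\<exists>\<epsilon>>0. \<forall>s. \<bar>s\<bar> < \<epsilon> \<and> t + s \<in> I \<longrightarrow> shifted V (\<tau> t) (\<rho> *\<^sub>R (s *\<^sub>R a)) (\<tau> (t + s))))"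

lemma traj_on_local:
  assumes "traj_on I a \<tau>" "t \<in> I"
  obtains \<epsilon> where "0 < \<epsilon>" "\<And>s. \<bar>s\<bar> < \<epsilon> \<Longrightarrow> t + s \<in> I \<Longrightarrow>
    \<exists>u\<in>Oct - Verts. cls u = \<tau> t \<and> u + s *\<^sub>R a \<in> Oct \<and> \<tau> (t + s) = cls (u + s *\<^sub>R a)"
proof -
  obtain \<epsilon> where e: "0 < \<epsilon>" "\<And>s. \<bar>s\<bar> < \<epsilon> \<Longrightarrow> t + s \<in> I \<Longrightarrow> shifted V (\<tau> t) (\<rho> *\<^sub>R (s *\<^sub>R a)) (\<tau> (t + s))"
    and r: "\<tau> t \<in> surface V - singular V" using assms unfolding traj_on_def by metis
  obtain x where x: "x \<in> Oct - Verts" "\<tau> t = cls x" using r surface_regular by auto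
  show ?thesis
  proof (rule that[OF e(1)])
    fix s assume "\<bar>s\<bar> < \<epsilon>" "t + s \<in> I"
    from e(2)[OF this] obtain u where "u \<in> Oct" "cls u = cls x" "u + s *\<^sub>R a \<in> Oct" "\<tau> (t + s) = cls (u + s *\<^sub>R a)"
      unfolding x(2) using shifted_eq[of x "s *\<^sub>R a"] x(1) by auto
    then show "\<exists>u\<in>Oct - Verts. cls u = \<tau> t \<and> u + s *\<^sub>R a \<in> Oct \<and> \<tau> (t + s) = cls (u + s *\<^sub>R a)"
      using x cls_eq_iff[of u x] eqv_Verts[of u x] by (intro bexI[of _ u]) auto
  qed
qed

lemma traj_on_regular: "traj_on I a \<tau> \<Longrightarrow> t \<in> I \<Longrightarrow> \<exists>u\<in>Oct - Verts. \<tau> t = cls u"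
  unfolding traj_on_def using surface_regular by blast

text \<open>The set of times at which the trajectory agrees with the straight path is open and closed, because
continuing from a nonsingular point and tracing back to one are both unique.\<close>

lemma traj_straight:
  assumes tr: "traj_on I a \<tau>" and I: "convex I" and t0: "t0 \<in> I" and t1: "t1 \<in> I"
    and x: "x \<in> Oct" "\<tau> t0 = cls x" and x1: "x + (t1 - t0) *\<^sub>R a \<in> Oct"
    and t: "t \<in> closed_segment t0 t1"
  shows "x + (t - t0) *\<^sub>R a \<in> Oct \<and> \<tau> t = cls (x + (t - t0) *\<^sub>R a)"
proof -
  define z where "z t = x + (t - t0) *\<^sub>R a" for t
  let ?J = "closed_segment t0 t1"
  have JI: "?J \<subseteq> I" using I t0 t1 by (simp add: closed_segment_subset)
  have z: "z t \<in> Oct" if tJ: "t \<in> ?J" for t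
  proof -
    obtain r where r: "0 \<le> r" "r \<le> 1" "t = (1 - r) * t0 + r * t1" using tJ by (auto simp: in_segment)
    have "z t = (1 - r) *\<^sub>R x + r *\<^sub>R (x + (t1 - t0) *\<^sub>R a)"
      unfolding z_def r(3) by (simp add: algebra_simps)
    then show ?thesis using convexD_alt[OF convex_Oct x(1) x1 r(1,2)] by simp
  qed
  have loc: "\<exists>\<epsilon>>0. \<forall>t'\<in>?J. \<bar>t' - t\<bar> < \<epsilon> \<longrightarrow> (\<tau> t = cls (z t) \<longleftrightarrow> \<tau> t' = cls (z t'))" if tJ: "t \<in> ?J" for t
  proof -
    obtain \<epsilon> where e: "0 < \<epsilon>" "\<And>s. \<bar>s\<bar> < \<epsilon> \<Longrightarrow> t + s \<in> I \<Longrightarrow>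
      \<exists>u\<in>Oct - Verts. cls u = \<tau> t \<and> u + s *\<^sub>R a \<in> Oct \<and> \<tau> (t + s) = cls (u + s *\<^sub>R a)"
      using traj_on_local[OF tr] tJ JI by blast
    have "\<tau> t = cls (z t) \<longleftrightarrow> \<tau> t' = cls (z t')" if t': "t' \<in> ?J" "\<bar>t' - t\<bar> < \<epsilon>" for t'
    proof -
      define s where "s = t' - t"
      have s: "\<bar>s\<bar> < \<epsilon>" "t + s \<in> I" "t' = t + s" using t' JI by (auto simp: s_def)
      obtain u where u: "u \<in> Oct" "u \<notin> Verts" "cls u = \<tau> t" "u + s *\<^sub>R a \<in> Oct" "\<tau> t' = cls (u + s *\<^sub>R a)"
        using e(2)[OF s(1,2)] s(3) by auto
      have zz: "z t' = z t + s *\<^sub>R a" unfolding z_def s(3) by (simp add: algebra_simps)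
      have side_normal: "u + s *\<^sub>R a \<notin> Verts"
        using traj_on_regular[OF tr] t'(1) JI u(4,5) cls_eq_iff eqv_Verts by (metis DiffD1 DiffD2 subsetD)
      show ?thesis
      proof
        assume "\<tau> t = cls (z t)"
        then show "\<tau> t' = cls (z t')" unfolding u(5) zz
          using u z[OF tJ] z[OF t'(1)] zz by (intro shift_unique) auto
      next
        assume "\<tau> t' = cls (z t')"
        then have "cls (u + s *\<^sub>R a) = cls (z t + s *\<^sub>R a)" by (simp add: zz u(5))
        then have "cls (u + s *\<^sub>R a + (- s *\<^sub>R a)) = cls (z t + s *\<^sub>R a + (- s *\<^sub>R a))"
          using u z[OF tJ] z[OF t'(1)] zz side_normal by (intro shift_unique[of "u + s *\<^sub>R a" "z t + s *\<^sub>R a"]) (simp_all add: algebra_simps)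
        then show "\<tau> t = cls (z t)" using u(3) by simp
      qed
    qed
    then show ?thesis using e(1) by blast
  qed
  have "\<tau> t = cls (z t)"
  proof (rule connected_induction_simple[where S = ?J and P = "\<lambda>t. \<tau> t = cls (z t)" and a = t0 and b = t])
    show "connected ?J" "t0 \<in> ?J" "t \<in> ?J" using t by auto
    show "\<tau> t0 = cls (z t0)" using x by (simp add: z_def)
    fix t assume tJ: "t \<in> ?J"
    obtain \<epsilon> where e: "\<epsilon> > 0" "\<forall>t'\<in>?J. \<bar>t' - t\<bar> < \<epsilon> \<longrightarrow> (\<tau> t = cls (z t) \<longleftrightarrow> \<tau> t' = cls (z t'))"
      using loc[OF tJ] by blast
    show "\<exists>T. openin (top_of_set ?J) T \<and> t \<in> T \<and> (\<forall>x\<in>T. \<forall>y\<in>T. \<tau> x = cls (z x) \<longrightarrow> \<tau> y = cls (z y))"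
    proof (intro exI conjI)
      show "openin (top_of_set ?J) (?J \<inter> ball t \<epsilon>)" by (rule openin_open_Int) simp
      show "t \<in> ?J \<inter> ball t \<epsilon>" using tJ e by simp
      show "\<forall>x\<in>?J \<inter> ball t \<epsilon>. \<forall>y\<in>?J \<inter> ball t \<epsilon>. \<tau> x = cls (z x) \<longrightarrow> \<tau> y = cls (z y)"
      proof (intro ballI impI)
        fix r r' assume r: "r \<in> ?J \<inter> ball t \<epsilon>" "r' \<in> ?J \<inter> ball t \<epsilon>" "\<tau> r = cls (z r)"
        then have "\<bar>r - t\<bar> < \<epsilon>" "\<bar>r' - t\<bar> < \<epsilon>" by (simp_all add: dist_real_def abs_minus_commute)
        then show "\<tau> r' = cls (z r')" using e(2) r by (metis IntD1)
      qed
    qed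
  qed
  then show ?thesis using z[OF t] by (simp add: z_def)
qed

lemma linear_trajectory_traj_on:
  assumes "linear_trajectory V \<theta> \<tau>"
  shows "\<exists>k. k \<noteq> 0 \<and> traj_on UNIV (k *\<^sub>R vector [cos \<theta>, sin \<theta>]) \<tau>"
proof -
  obtain k where k: "k \<noteq> 0" "\<forall>t. \<tau> t \<in> surface V - singular V \<and>
       (\<exists>\<epsilon>>0. \<forall>s. \<bar>s\<bar> < \<epsilon> \<longrightarrow> shifted V (\<tau> t) ((s * k) *\<^sub>R vector [cos \<theta>, sin \<theta>]) (\<tau> (t + s)))"
    using assms unfolding linear_trajectory_def by auto
  have "\<rho> *\<^sub>R (s *\<^sub>R ((k / \<rho>) *\<^sub>R (vector [cos \<theta>, sin \<theta>] :: real^2))) = (s * k) *\<^sub>R vector [cos \<theta>, sin \<theta>]"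
    for s using \<rho>_pos by simp
  then have "traj_on UNIV ((k / \<rho>) *\<^sub>R vector [cos \<theta>, sin \<theta>]) \<tau>"
    unfolding traj_on_def using k(2) by (simp only: UNIV_I simp_thms) blast
  then show ?thesis using k(1) \<rho>_pos by (intro exI[of _ "k / \<rho>"]) auto
qed

lemma traj_reaches_side:
  assumes tr: "traj_on UNIV a \<tau>" and a: "a \<noteq> 0"
  shows "\<exists>t\<ge>t0. \<exists>j. \<tau> t \<in> cls ` Side j" "\<exists>t\<le>t0. \<exists>j. \<tau> t \<in> cls ` Side j"
proof -
  obtain x where x: "x \<in> Oct" "\<tau> t0 = cls x" using traj_on_regular[OF tr, of t0] by auto
  obtain S j where S: "0 \<le> S" "x + S *\<^sub>R a \<in> Side j" using exit_side[OF x(1) a] by auto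
  have "\<tau> (t0 + S) = cls (x + S *\<^sub>R a)"
    using traj_straight[OF tr _ _ _ x, of "t0 + S" "t0 + S"] S Side_subset[of j] by auto
  then show "\<exists>t\<ge>t0. \<exists>j. \<tau> t \<in> cls ` Side j" using S by (intro exI[of _ "t0 + S"]) auto
  obtain S j where S: "0 \<le> S" "x + S *\<^sub>R (- a) \<in> Side j" using exit_side[OF x(1), of "-a"] a by auto
  have "\<tau> (t0 - S) = cls (x + S *\<^sub>R (-a))"
    using traj_straight[OF tr _ _ _ x, of "t0 - S" "t0 - S"] S Side_subset[of j] by auto
  then show "\<exists>t\<le>t0. \<exists>j. \<tau> t \<in> cls ` Side j" using S by (intro exI[of _ "t0 - S"]) auto
qed

section \<open>Affine automorphisms\<close>

lemma affine_automorphism_surface: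
  assumes "affine_automorphism V M f"
  shows "inj_on f (cls ` Oct)" "f ` cls ` Oct = cls ` Oct" "f ` cls ` Verts = cls ` Verts"
    "continuous_map (surface_topology V) (surface_topology V) f"
    "p \<in> surface V - singular V \<Longrightarrow> f p \<in> surface V - singular V"
proof -
  have h: "homeomorphic_map (surface_topology V) (surface_topology V) f" and s: "f ` cls ` Verts = cls ` Verts"
    using assms unfolding affine_automorphism_def singular_eq by auto
  show 1: "inj_on f (cls ` Oct)" "f ` cls ` Oct = cls ` Oct"
    using homeomorphic_imp_injective_map[OF h] homeomorphic_imp_surjective_map[OF h] by simp_all
  show "f ` cls ` Verts = cls ` Verts" by fact
  show "continuous_map (surface_topology V) (surface_topology V) f"
    using h homeomorphic_imp_continuous_map by blast
  assume "p \<in> surface V - singular V"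
  then have p: "p \<in> cls ` Oct" "p \<notin> cls ` Verts" unfolding surface_eq singular_eq by auto
  have "f p \<notin> f ` cls ` Verts"
    using inj_on_image_mem_iff[OF 1(1) p(1), of "cls ` Verts"] p(2) Verts_subset by auto
  then show "f p \<in> surface V - singular V" using imageI[OF p(1), of f] 1(2) s unfolding surface_eq singular_eq by simp
qed

lemma traj_on_automorphism:
  assumes tr: "traj_on I a \<tau>" and f: "affine_automorphism V M f"
  shows "traj_on I (M *v a) (f \<circ> \<tau>)"
  unfolding traj_on_def
proof (intro ballI conjI)
  fix t assume t: "t \<in> I"
  have r: "\<tau> t \<in> surface V - singular V" using tr t by (auto simp: traj_on_def)
  then show "(f \<circ> \<tau>) t \<in> surface V - singular V" using affine_automorphism_surface(5)[OF f] by simp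
  obtain \<epsilon> where e: "0 < \<epsilon>" "\<And>s. \<bar>s\<bar> < \<epsilon> \<Longrightarrow> t + s \<in> I \<Longrightarrow> shifted V (\<tau> t) (\<rho> *\<^sub>R (s *\<^sub>R a)) (\<tau> (t + s))"
    using tr t unfolding traj_on_def by metis
  obtain \<delta> where d: "0 < \<delta>" "\<And>v q. norm v < \<delta> \<Longrightarrow> shifted V (\<tau> t) v q \<Longrightarrow> shifted V (f (\<tau> t)) (M *v v) (f q)"
    using f r unfolding affine_automorphism_def has_const_derivative_def by metis
  define \<eta> where "\<eta> = min \<epsilon> (\<delta> / (\<rho> * norm a + 1))"
  have pos: "\<rho> * norm a + 1 > 0" using \<rho>_pos by (simp add: add_nonneg_pos)
  show "\<exists>\<epsilon>>0. \<forall>s. \<bar>s\<bar> < \<epsilon> \<and> t + s \<in> I \<longrightarrow> shifted V ((f \<circ> \<tau>) t) (\<rho> *\<^sub>R s *\<^sub>R (M *v a)) ((f \<circ> \<tau>) (t + s))"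
  proof (intro exI conjI allI impI)
    show "0 < \<eta>" using e d pos by (simp add: \<eta>_def)
    fix s assume s: "\<bar>s\<bar> < \<eta> \<and> t + s \<in> I"
    have "\<bar>s\<bar> * (\<rho> * norm a + 1) < \<delta>" using s pos by (simp add: \<eta>_def pos_less_divide_eq)
    then have "norm (\<rho> *\<^sub>R s *\<^sub>R a) < \<delta>" using \<rho>_pos by (simp add: algebra_simps abs_mult)
    from d(2)[OF this e(2)] s have "shifted V (f (\<tau> t)) (M *v (\<rho> *\<^sub>R s *\<^sub>R a)) (f (\<tau> (t + s)))"
      by (simp add: \<eta>_def)
    then show "shifted V ((f \<circ> \<tau>) t) (\<rho> *\<^sub>R s *\<^sub>R (M *v a)) ((f \<circ> \<tau>) (t + s))"
      by (simp add: matrix_vector_mult_scaleR)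
  qed
qed

lemma affine_automorphism_compose:
  assumes f: "affine_automorphism V M f" and g: "affine_automorphism V N g"
  shows "affine_automorphism V (M ** N) (f \<circ> g)"
  unfolding affine_automorphism_def
proof (intro conjI)
  have hf: "homeomorphic_map (surface_topology V) (surface_topology V) f"
    and hg: "homeomorphic_map (surface_topology V) (surface_topology V) g"
    and i: "invertible M" "invertible N"
    and s: "f ` singular V = singular V" "g ` singular V = singular V"
    and df: "has_const_derivative V f M" and dg: "has_const_derivative V g N"
    using f g by (auto simp: affine_automorphism_def)
  show "homeomorphic_map (surface_topology V) (surface_topology V) (f \<circ> g)"
    using hf hg homeomorphic_map_compose by blast
  show "(f \<circ> g) ` singular V = singular V" using s by (metis image_comp)
  show "invertible (M ** N)" using i by (rule invertible_mult)
  show "has_const_derivative V (f \<circ> g) (M ** N)"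
    unfolding has_const_derivative_def
  proof
    fix p assume p: "p \<in> surface V - singular V"
    obtain \<epsilon> where e: "0 < \<epsilon>" "\<And>v q. norm v < \<epsilon> \<Longrightarrow> shifted V p v q \<Longrightarrow> shifted V (g p) (N *v v) (g q)"
      using dg p unfolding has_const_derivative_def by metis
    obtain \<delta> where d: "0 < \<delta>" "\<And>v q. norm v < \<delta> \<Longrightarrow> shifted V (g p) v q \<Longrightarrow> shifted V (f (g p)) (M *v v) (f q)"
      using df affine_automorphism_surface(5)[OF g p] unfolding has_const_derivative_def by metis
    obtain B where B: "0 < B" "\<And>v. norm (N *v v) \<le> norm v * B"
      using bounded_linear.pos_bounded[OF matrix_vector_mul_bounded_linear[of N]] by blast
    show "\<exists>\<epsilon>>0. \<forall>v q. norm v < \<epsilon> \<longrightarrow> shifted V p v q \<longrightarrow> shifted V ((f \<circ> g) p) (M ** N *v v) ((f \<circ> g) q)"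
    proof (intro exI[of _ "min \<epsilon> (\<delta> / B)"] conjI allI impI)
      show "0 < min \<epsilon> (\<delta> / B)" using e d B by simp
      fix v q assume v: "norm v < min \<epsilon> (\<delta> / B)" and sh: "shifted V p v q"
      have "norm v * B < \<delta>" using v B by (simp add: pos_less_divide_eq)
      then have "norm (N *v v) < \<delta>" using B(2)[of v] by linarith
      from d(2)[OF this e(2)] v sh show "shifted V ((f \<circ> g) p) (M ** N *v v) ((f \<circ> g) q)"
        by (simp add: matrix_vector_mul_assoc)
    qed
  qed
qed

text \<open>Automorphisms are built from finitely many affine branches. That the pieces are closed gives
continuity, and the common linear part gives the derivative, also where several pieces meet.\<close>

definition piecewise_affine :: "'i set \<Rightarrow> ('i \<Rightarrow> (real^2) set) \<Rightarrow> ('i \<Rightarrow> real^2) \<Rightarrow> real^2^2 \<Rightarrow>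
    (surface_point \<Rightarrow> surface_point) \<Rightarrow> bool" where
  "piecewise_affine I K e M f \<longleftrightarrow> finite I \<and> (\<Union>i\<in>I. K i) = Oct \<and> (\<forall>i\<in>I. closed (K i)) \<and>
     (\<forall>i\<in>I. \<forall>x\<in>K i. M *v x + e i \<in> Oct \<and> f (cls x) = cls (M *v x + e i))"

text \<open>The branches have to agree up to gluing wherever points of their pieces are glued. This covers the
case that a point lies in several pieces.\<close>

lemma piecewise_affine_exists:
  assumes "finite I" "(\<Union>i\<in>I. K i) = Oct" "\<And>i. i \<in> I \<Longrightarrow> closed (K i)"
    "\<And>i x. i \<in> I \<Longrightarrow> x \<in> K i \<Longrightarrow> M *v x + e i \<in> Oct"
    "\<And>i j x y. i \<in> I \<Longrightarrow> j \<in> I \<Longrightarrow> x \<in> K i \<Longrightarrow> y \<in> K j \<Longrightarrow> eqv x y \<Longrightarrow> eqv (M *v x + e i) (M *v y + e j)"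
  shows "\<exists>f. piecewise_affine I K e M f"
proof -
  define R where "R p q \<longleftrightarrow> (\<exists>i\<in>I. \<exists>x\<in>K i. p = cls x \<and> q = cls (M *v x + e i))" for p q
  define f where "f p = (SOME q. R p q)" for p
  have "f (cls x) = cls (M *v x + e i)" if i: "i \<in> I" and x: "x \<in> K i" for i x
  proof -
    have "R (cls x) (cls (M *v x + e i))" using i x by (auto simp: R_def)
    then have "R (cls x) (f (cls x))" unfolding f_def by (rule someI)
    then obtain j y where j: "j \<in> I" "y \<in> K j" "cls x = cls y" "f (cls x) = cls (M *v y + e j)" by (auto simp: R_def)
    have "eqv x y" using j(1-3) i x assms(2) cls_eq_iff by blast
    then have "eqv (M *v x + e i) (M *v y + e j)" using assms(5) i x j by blast
    then have "cls (M *v x + e i) = cls (M *v y + e j)"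
      by (intro iffD2[OF cls_eq_iff] assms(4) i x j(1,2))
    then show ?thesis using j(4) by simp
  qed
  then have "piecewise_affine I K e M f" using assms(1-4) unfolding piecewise_affine_def by simp
  then show "\<exists>f. piecewise_affine I K e M f" by (intro exI[of _ f])
qed

lemma piecewise_affine_continuous:
  assumes "piecewise_affine I K e M f"
  shows "continuous_map (surface_topology V) (surface_topology V) f"
proof -
  have pcs: "finite I" "(\<Union>i\<in>I. K i) = Oct" "\<And>i. i \<in> I \<Longrightarrow> closed (K i)"
    "\<And>i x. i \<in> I \<Longrightarrow> x \<in> K i \<Longrightarrow> M *v x + e i \<in> Oct \<and> f (cls x) = cls (M *v x + e i)"
    using assms unfolding piecewise_affine_def by auto
  have im: "f p \<in> cls ` Oct" if p: "p \<in> cls ` Oct" for p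
  proof -
    obtain x where x: "p = cls x" "x \<in> Oct" using p by (rule imageE)
    then obtain i where "i \<in> I" "x \<in> K i" using pcs(2) by blast
    from pcs(4)[OF this] show ?thesis unfolding x(1) by simp
  qed
  have cl: "openin (top_of_set Oct) (Oct - C) \<longleftrightarrow> closed C" if "C \<subseteq> Oct" for C
    using that closedin_closed_eq[OF closed_Oct, of C] by (auto simp: closedin_def)
  have "openin (surface_topology V) {p \<in> cls ` Oct. f p \<in> U}" if U: "openin (surface_topology V) U" for U
  proof -
    define C where "C = {u \<in> Oct. cls u \<notin> U}"
    have "Oct - C = {u \<in> Oct. cls u \<in> U}" by (auto simp: C_def)
    then have "closed C" using U cl[of C] by (auto simp: openin_surface C_def)
    define D where "D = {u \<in> Oct. f (cls u) \<notin> U}"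
    have "D = (\<Union>i\<in>I. K i \<inter> (\<lambda>u. M *v u + e i) -` C)"
    proof (intro equalityI subsetI)
      fix u assume u: "u \<in> D"
      then obtain i where i: "i \<in> I" "u \<in> K i" using pcs(2) by (auto simp: D_def)
      then show "u \<in> (\<Union>i\<in>I. K i \<inter> (\<lambda>u. M *v u + e i) -` C)" using u pcs(4)[OF i] by (auto simp: D_def C_def)
    next
      fix u assume "u \<in> (\<Union>i\<in>I. K i \<inter> (\<lambda>u. M *v u + e i) -` C)"
      then obtain i where i: "i \<in> I" "u \<in> K i" "M *v u + e i \<in> C" by auto
      then show "u \<in> D" using pcs(2) pcs(4)[OF i(1,2)] by (auto simp: D_def C_def)
    qed
    moreover have "closed ((\<lambda>u. M *v u + e i) -` C)" for i
      by (rule closed_vimage[OF \<open>closed C\<close>]) (intro continuous_intros linear_continuous_on matrix_vector_mul_bounded_linear)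
    ultimately have "closed D" using pcs(1,3) by (auto intro!: closed_UN closed_Int)
    moreover have "Oct - D = {u \<in> Oct. cls u \<in> {p \<in> cls ` Oct. f p \<in> U}}" by (auto simp: D_def)
    ultimately show ?thesis using cl[of D] unfolding openin_surface by (auto simp: D_def)
  qed
  then show ?thesis unfolding continuous_map_def topspace_surface using im by auto
qed

lemma finite_fibre: "finite {x \<in> Oct. cls x = p}"
proof (cases "\<exists>x\<in>Oct. cls x = p")
  case True
  then obtain x where x: "x \<in> Oct" "cls x = p" by blast
  have "{y \<in> Oct. cls y = p} \<subseteq> {x} \<union> (\<lambda>j. x + glue_vec j) ` {..<8} \<union> Verts"
  proof
    fix y assume "y \<in> {y \<in> Oct. cls y = p}"
    then have "eqv x y" using x cls_eq_iff by auto
    then consider "x = y" | j where "y = x + glue_vec (j mod 8)" | "y \<in> Verts" using glue_vec_mod unfolding eqv_def by metis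
    then show "y \<in> {x} \<union> (\<lambda>j. x + glue_vec j) ` {..<8} \<union> Verts" by cases auto
  qed
  then show ?thesis using finite_Verts by (meson finite.emptyI finite_Un finite_imageI finite_insert finite_lessThan finite_subset)
next
  case False
  then have "{x \<in> Oct. cls x = p} = {}" by auto
  then show ?thesis by (simp only: finite.emptyI)
qed

text \<open>A short segment starting at \<open>x\<close> ends in a piece that contains \<open>x\<close> as well, so the branch of the end
point can be used for both ends. As a point has finitely many representatives, one bound on the
length serves all of them.\<close>

lemma piecewise_affine_derivative:
  assumes "piecewise_affine I K e M f"
  shows "has_const_derivative V f M"
  unfolding has_const_derivative_def
proof
  have pcs: "finite I" "(\<Union>i\<in>I. K i) = Oct" "\<And>i. i \<in> I \<Longrightarrow> closed (K i)"
    "\<And>i x. i \<in> I \<Longrightarrow> x \<in> K i \<Longrightarrow> M *v x + e i \<in> Oct \<and> f (cls x) = cls (M *v x + e i)"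
    using assms unfolding piecewise_affine_def by auto
  fix p assume "p \<in> surface V - singular V"
  then obtain x0 where x0: "x0 \<in> Oct" "p = cls x0" using surface_regular by auto
  let ?F = "{x \<in> Oct. cls x = p}"
  \<comment> \<open>a point close to \<open>x\<close> lies only in pieces that contain \<open>x\<close>\<close>
  have "\<exists>d>0. \<forall>y i. dist y x < d \<longrightarrow> i \<in> I \<longrightarrow> y \<in> K i \<longrightarrow> x \<in> K i" for x
  proof -
    have "open (- (\<Union>i\<in>{i\<in>I. x \<notin> K i}. K i))" using pcs(1,3) by (intro open_Compl closed_UN) auto
    moreover have "x \<in> - (\<Union>i\<in>{i\<in>I. x \<notin> K i}. K i)" by auto
    ultimately obtain d where "d > 0" "ball x d \<subseteq> - (\<Union>i\<in>{i\<in>I. x \<notin> K i}. K i)"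
      by (rule openE)
    then show ?thesis by (intro exI[of _ d]) (auto simp: dist_commute subset_iff)
  qed
  then obtain d where d: "\<And>x. d x > 0" "\<And>x y i. dist y x < d x \<Longrightarrow> i \<in> I \<Longrightarrow> y \<in> K i \<Longrightarrow> x \<in> K i"
    by metis
  define \<epsilon> where "\<epsilon> = Min (d ` ?F)"
  have ne: "?F \<noteq> {}" using x0 by auto
  have e0: "0 < \<epsilon>" unfolding \<epsilon>_def using finite_fibre ne d(1) by (subst Min_gr_iff) auto
  have ed: "\<epsilon> \<le> d x" if "x \<in> ?F" for x unfolding \<epsilon>_def using that finite_fibre by (intro Min_le) auto
  show "\<exists>\<epsilon>>0. \<forall>v q. norm v < \<epsilon> \<longrightarrow> shifted V p v q \<longrightarrow> shifted V (f p) (M *v v) (f q)"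
  proof (intro exI[of _ "\<rho> * \<epsilon>"] conjI allI impI)
    show "0 < \<rho> * \<epsilon>" using \<rho>_pos e0 by simp
    fix v q assume v: "norm v < \<rho> * \<epsilon>" and "shifted V p v q"
    define a where "a = (1 / \<rho>) *\<^sub>R v"
    have va: "v = \<rho> *\<^sub>R a" using \<rho>_pos by (simp add: a_def)
    have na: "norm a < \<epsilon>" using v \<rho>_pos by (simp add: va)
    obtain x where x: "x \<in> Oct" "cls x = p" "x + a \<in> Oct" "q = cls (x + a)"
      using \<open>shifted V p v q\<close> unfolding x0(2) va shifted_eq[OF x0(1)] by blast
    obtain i where i: "i \<in> I" "x + a \<in> K i" using pcs(2) x(3) by auto
    have "dist (x + a) x < d x" using na ed[of x] x by (simp add: dist_norm)
    then have xi: "x \<in> K i" using d(2) i by blast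
    have m: "M *v (x + a) + e i = M *v x + e i + M *v a" by (simp add: matrix_vector_right_distrib)
    have "shifted V (cls (M *v x + e i)) (\<rho> *\<^sub>R (M *v a)) (cls (M *v x + e i + M *v a))"
      using pcs(4)[OF i] pcs(4)[OF i(1) xi] m by (subst shifted_eq) auto
    then show "shifted V (f p) (M *v v) (f q)"
      using pcs(4)[OF i] pcs(4)[OF i(1) xi] m x by (simp add: va matrix_vector_mult_scaleR)
  qed
qed

lemma affine_automorphismI:
  assumes "piecewise_affine I K e M f" "piecewise_affine I' K' e' M' g"
    "\<And>p. p \<in> cls ` Oct \<Longrightarrow> g (f p) = p" "\<And>p. p \<in> cls ` Oct \<Longrightarrow> f (g p) = p"
    "f ` cls ` Verts = cls ` Verts" "invertible M"
  shows "affine_automorphism V M f"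
proof -
  have "homeomorphic_maps (surface_topology V) (surface_topology V) f g"
    unfolding homeomorphic_maps_def topspace_surface
    using piecewise_affine_continuous[OF assms(1)] piecewise_affine_continuous[OF assms(2)] assms(3,4) by simp
  then have "homeomorphic_map (surface_topology V) (surface_topology V) f"
    by (simp add: homeomorphic_maps_map)
  then show ?thesis unfolding affine_automorphism_def singular_eq
    using assms(5,6) piecewise_affine_derivative[OF assms(1)] by simp
qed

end

section \<open>Symmetries of the octagon\<close>

lemma mat2_nth [simp]: "mat2 a b c d $ 1 $ 1 = a" "mat2 a b c d $ 1 $ 2 = b"
  "mat2 a b c d $ 2 $ 1 = c" "mat2 a b c d $ 2 $ 2 = d"
  by (simp_all add: mat2_def)

lemma mat2_eq: "(M::real^2^2) = N \<longleftrightarrow> M$1$1 = N$1$1 \<and> M$1$2 = N$1$2 \<and> M$2$1 = N$2$1 \<and> M$2$2 = N$2$2"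
  by (auto simp: vec_eq_iff forall_2)

lemma mult2_nth [simp]: "((M::real^2^2) ** N) $ i $ j = M$i$1 * N$1$j + M$i$2 * N$2$j"
  by (simp add: matrix_matrix_mult_def sum_2)

lemma mat2_one: "mat2 1 0 0 1 = mat 1"
  by (simp add: mat2_eq mat_def)

lemma mult_vec2_nth [simp]: "((M::real^2^2) *v u) $ i = M$i$1 * u$1 + M$i$2 * u$2"
  by (simp add: matrix_vector_mult_def sum_2)

definition rot :: "real^2^2" where "rot = (1 / r2) *\<^sub>R mat2 1 1 (-1) 1"
definition rot_inv :: "real^2^2" where "rot_inv = (1 / r2) *\<^sub>R mat2 1 (-1) 1 1"
definition flip :: "real^2^2" where "flip = mat2 (-1) 0 0 1"

lemma inv_r2: "1 / r2 = r2 / 2" by (simp add: field_simps)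

lemma rot_nth: "rot$1$1 = r2/2" "rot$1$2 = r2/2" "rot$2$1 = -(r2/2)" "rot$2$2 = r2/2"
  "rot_inv$1$1 = r2/2" "rot_inv$1$2 = -(r2/2)" "rot_inv$2$1 = r2/2" "rot_inv$2$2 = r2/2"
  "flip$1$1 = -1" "flip$1$2 = 0" "flip$2$1 = 0" "flip$2$2 = 1"
  unfolding rot_def rot_inv_def flip_def inv_r2 by simp_all

lemma mod8_less: "(j::nat) mod 8 < 8" by simp

lemma rot_vertex: "rot *v vertex j = vertex (Suc j)" "rot_inv *v vertex (Suc j) = vertex j"
proof -
  show 1: "rot *v vertex j = vertex (Suc j)"
    unfolding vec2_eq vertex_Suc by (simp add: rot_nth algebra_simps)
  have "rot_inv ** rot = mat 1" by (simp add: mat2_eq rot_nth mat_def)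
  then show "rot_inv *v vertex (Suc j) = vertex j"
    by (simp add: 1[symmetric] matrix_vector_mul_assoc del: mult_vec2_nth)
qed

lemma rot_side_normal: "rot *v side_normal j = side_normal (Suc j)" "rot_inv *v side_normal (Suc j) = side_normal j"
proof -
  have "j < 8 \<Longrightarrow> rot *v side_normal j = side_normal (Suc j)" for j
    unfolding less8 vec2_eq by (elim disjE; simp only:) (simp_all add: rot_nth side_normal_def)
  from this[of "j mod 8"] show 1: "rot *v side_normal j = side_normal (Suc j)"
    using side_normal_mod[of j] side_normal_mod[of "Suc j"] side_normal_mod[of "Suc (j mod 8)"] by (simp add: mod_Suc_eq)
  have "rot_inv ** rot = mat 1" by (simp add: mat2_eq rot_nth mat_def)
  then show "rot_inv *v side_normal (Suc j) = side_normal j"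
    by (simp add: 1[symmetric] matrix_vector_mul_assoc del: mult_vec2_nth)
qed

lemma side_label_simps:
  "side_label 0 = LA" "side_label 1 = LB" "side_label (Suc 0) = LB" "side_label 2 = LC" "side_label 3 = LD"
  "side_label 4 = LA" "side_label 5 = LB" "side_label 6 = LC" "side_label 7 = LD"
  by (simp_all add: side_label_def)

lemma side_label_mod: "side_label j = side_label (j mod 8)"
proof -
  have "j mod 8 mod 4 = j mod 4" by (rule mod_mod_cancel) simp
  then show ?thesis by (simp add: side_label_def)
qed

lemma side_label_Suc: "side_label (Suc j) = (case side_label j of LA \<Rightarrow> LB | LB \<Rightarrow> LC | LC \<Rightarrow> LD | LD \<Rightarrow> LA)"
proof -
  have "j < 8 \<Longrightarrow> side_label (Suc j) = (case side_label j of LA \<Rightarrow> LB | LB \<Rightarrow> LC | LC \<Rightarrow> LD | LD \<Rightarrow> LA)" for j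
    unfolding less8 by (elim disjE; simp only:) (simp_all add: side_label_def)
  from this[of "j mod 8"] show ?thesis
    using side_label_mod[of j] side_label_mod[of "Suc j"] side_label_mod[of "Suc (j mod 8)"] by (simp add: mod_Suc_eq)
qed

lemma flip_side_normal: "\<exists>k. flip *v side_normal j = side_normal k \<and> side_label k = (case side_label j of LA \<Rightarrow> LA | LB \<Rightarrow> LD | LC \<Rightarrow> LC | LD \<Rightarrow> LB)"
proof -
  have "j < 8 \<Longrightarrow> flip *v side_normal j = side_normal ((8 - j) mod 8) \<and> side_label ((8 - j) mod 8) = (case side_label j of LA \<Rightarrow> LA | LB \<Rightarrow> LD | LC \<Rightarrow> LC | LD \<Rightarrow> LB)" for j
    unfolding less8 vec2_eq by (elim disjE; simp only:) (simp_all add: rot_nth side_normal_simps side_label_simps)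
  from this[of "j mod 8"] show ?thesis using side_normal_mod[of j] side_label_mod[of j] by auto
qed

lemma flip_Verts: "x \<in> Verts \<Longrightarrow> flip *v x \<in> Verts"
  by (simp add: mem_Verts rot_nth)

context octagonal_surface
begin

definition label_side :: "letter \<Rightarrow> surface_point set" where
  "label_side L = (\<Union>j\<in>{j. side_label j = L}. cls ` Side j)"

lemma crosses_eq: "crosses V f \<tau> t L \<longleftrightarrow> \<tau> t \<in> f ` label_side L"
  unfolding crosses_def label_side_def cls_Side by auto

lemma label_side_subset: "label_side L \<subseteq> cls ` Oct"
  unfolding label_side_def using Side_subset by auto

text \<open>An automorphism together with an inverse, both with their derivatives, where the automorphism
permutes the labels by \<open>\<pi>\<close>: it changes the direction of a trajectory, but not which letters of the
cutting sequence are sandwiched.\<close>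

definition symmetry_pair ::
    "real^2^2 \<Rightarrow> (surface_point \<Rightarrow> surface_point) \<Rightarrow> real^2^2 \<Rightarrow> (surface_point \<Rightarrow> surface_point) \<Rightarrow>
     (letter \<Rightarrow> letter) \<Rightarrow> bool" where
  "symmetry_pair M f N g \<pi> \<longleftrightarrow> affine_automorphism V M f \<and> affine_automorphism V N g \<and>
     M ** N = mat 1 \<and> N ** M = mat 1 \<and>
     (\<forall>p\<in>cls ` Oct. f (g p) = p \<and> g (f p) = p) \<and> inj \<pi> \<and> (\<forall>L. f ` label_side L = label_side (\<pi> L))"

lemma symmetry_pair_compose:
  assumes "symmetry_pair M f N g \<pi>" "symmetry_pair M' f' N' g' \<pi>'"
  shows "symmetry_pair (M ** M') (f \<circ> f') (N' ** N) (g' \<circ> g) (\<pi> \<circ> \<pi>')"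
proof -
  note a = assms[unfolded symmetry_pair_def]
  have im: "f' p \<in> cls ` Oct" "g p \<in> cls ` Oct" if "p \<in> cls ` Oct" for p
    using affine_automorphism_surface(2) a that by (metis imageI)+
  have "M ** M' ** (N' ** N) = M ** (M' ** N') ** N" "N' ** N ** (M ** M') = N' ** (N ** M) ** M'"
    by (simp_all only: matrix_mul_assoc)
  then have 1: "M ** M' ** (N' ** N) = mat 1" "N' ** N ** (M ** M') = mat 1" using a by simp_all
  have 2: "(f \<circ> f') ` label_side L = label_side ((\<pi> \<circ> \<pi>') L)" for L
    using a unfolding image_comp[symmetric] by simp
  have 3: "(f \<circ> f') ((g' \<circ> g) p) = p" "(g' \<circ> g) ((f \<circ> f') p) = p" if "p \<in> cls ` Oct" for p
  proof -
    have b: "\<And>p. p \<in> cls ` Oct \<Longrightarrow> f (g p) = p" "\<And>p. p \<in> cls ` Oct \<Longrightarrow> g (f p) = p"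
      "\<And>p. p \<in> cls ` Oct \<Longrightarrow> f' (g' p) = p" "\<And>p. p \<in> cls ` Oct \<Longrightarrow> g' (f' p) = p"
      using a by metis+
    have "f (g p) = p" "f' (g' (g p)) = g p" using b(1)[OF that] b(3)[OF im(2)[OF that]] .
    then show "(f \<circ> f') ((g' \<circ> g) p) = p" by simp
    have "g (f (f' p)) = f' p" "g' (f' p) = p" using b(2)[OF im(1)[OF that]] b(4)[OF that] .
    then show "(g' \<circ> g) ((f \<circ> f') p) = p" by simp
  qed
  show ?thesis unfolding symmetry_pair_def
    using 1 2 3 affine_automorphism_compose[of M f M' f'] affine_automorphism_compose[of N' g' N g]
      inj_compose[of \<pi> \<pi>'] a by simp
qed

text \<open>The octagon and its sides are given by the side normals, so an orthogonal map that permutes the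
normals respects the octagon, the sides and the gluing.\<close>

lemma linear_symmetry:
  assumes MN: "M ** N = mat 1" "N ** M = mat 1" "N = transpose M" and pi: "inj \<pi>"
    and M: "\<And>j. \<exists>k. M *v side_normal j = side_normal k \<and> side_label k = \<pi> (side_label j)"
    and N: "\<And>k. \<exists>j. N *v side_normal k = side_normal j \<and> side_label k = \<pi> (side_label j)"
    and Verts: "\<And>x. x \<in> Verts \<Longrightarrow> M *v x \<in> Verts" "\<And>x. x \<in> Verts \<Longrightarrow> N *v x \<in> Verts"
  shows "\<exists>f g. symmetry_pair M f N g \<pi> \<and> (\<forall>x\<in>Oct. f (cls x) = cls (M *v x))"
proof -
  \<comment> \<open>the normals are moved by the inverse, which is the transpose\<close>
  have adj: "u \<bullet> (M *v x) = (N *v u) \<bullet> x" "u \<bullet> (N *v x) = (M *v u) \<bullet> x" for u x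
    unfolding MN(3) by (simp_all add: inner2 transpose_def algebra_simps)
  have inv: "N *v (M *v x) = x" "M *v (N *v x) = x" for x
    unfolding matrix_vector_mul_assoc using MN(1,2) by simp_all
  have MO: "M *v x \<in> Oct" if "x \<in> Oct" for x
    unfolding Oct_def mem_Collect_eq adj using N that by (metis Oct_def mem_Collect_eq)
  have NO: "N *v x \<in> Oct" if "x \<in> Oct" for x
    unfolding Oct_def mem_Collect_eq adj using M that by (metis Oct_def mem_Collect_eq)
  have MS: "M *v x \<in> Side k" if "x \<in> Side j" "M *v side_normal j = side_normal k" for x j k
    using that MO inv(1) adj(1)[of "side_normal k" x] by (auto simp: Side_def that(2)[symmetric])
  have NS: "N *v x \<in> Side k" if "x \<in> Side j" "N *v side_normal j = side_normal k" for x j k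
    using that NO inv(2) adj(2)[of "side_normal k" x] by (auto simp: Side_def that(2)[symmetric])
  have eM: "eqv (M *v x) (M *v y)" if "eqv x y" for x y
  proof -
    consider "x = y" | j where "x \<in> Side j" "y = x + glue_vec j" | "x \<in> Verts" "y \<in> Verts"
      using \<open>eqv x y\<close> by (auto simp: eqv_def)
    then show ?thesis
    proof cases
      case 2
      obtain k where k: "M *v side_normal j = side_normal k" using M by blast
      have "M *v glue_vec j = glue_vec k" by (simp only: glue_vec_def matrix_vector_mult_scaleR k)
      then have "M *v y = M *v x + glue_vec k" using 2 by (simp only: matrix_vector_right_distrib)
      then show ?thesis using MS[OF 2(1) k] by (auto simp: eqv_def)
    next
      case 3 then show ?thesis using Verts by (auto simp: eqv_def)
    qed simp
  qed
  have eN: "eqv (N *v x) (N *v y)" if "eqv x y" for x y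
  proof -
    consider "x = y" | j where "x \<in> Side j" "y = x + glue_vec j" | "x \<in> Verts" "y \<in> Verts"
      using \<open>eqv x y\<close> by (auto simp: eqv_def)
    then show ?thesis
    proof cases
      case 2
      obtain k where k: "N *v side_normal j = side_normal k" using N by blast
      have "N *v glue_vec j = glue_vec k" by (simp only: glue_vec_def matrix_vector_mult_scaleR k)
      then have "N *v y = N *v x + glue_vec k" using 2 by (simp only: matrix_vector_right_distrib)
      then show ?thesis using NS[OF 2(1) k] by (auto simp: eqv_def)
    next
      case 3 then show ?thesis using Verts by (auto simp: eqv_def)
    qed simp
  qed
  obtain f where f: "piecewise_affine {()} (\<lambda>_. Oct) (\<lambda>_. 0) M f"
    using piecewise_affine_exists[of "{()}" "\<lambda>_. Oct" M "\<lambda>_. 0"] MO eM closed_Oct by (auto simp del: mult_vec2_nth)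
  obtain g where g: "piecewise_affine {()} (\<lambda>_. Oct) (\<lambda>_. 0) N g"
    using piecewise_affine_exists[of "{()}" "\<lambda>_. Oct" N "\<lambda>_. 0"] NO eN closed_Oct by (auto simp del: mult_vec2_nth)
  have fx: "f (cls x) = cls (M *v x)" if "x \<in> Oct" for x
    using f that unfolding piecewise_affine_def by simp
  have gx: "g (cls x) = cls (N *v x)" if "x \<in> Oct" for x
    using g that unfolding piecewise_affine_def by simp
  have fg: "f (g p) = p" "g (f p) = p" if p: "p \<in> cls ` Oct" for p
  proof -
    obtain x where x: "p = cls x" "x \<in> Oct" using p by (rule imageE)
    show "f (g p) = p" "g (f p) = p" using x fx gx MO NO inv by simp_all
  qed
  have fV: "f ` cls ` Verts = cls ` Verts"
  proof (intro equalityI subsetI)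
    fix p assume "p \<in> f ` cls ` Verts"
    then obtain x where x: "x \<in> Verts" "p = f (cls x)" by auto
    then show "p \<in> cls ` Verts" using fx Verts Verts_subset by (metis imageI subsetD)
  next
    fix p assume "p \<in> cls ` Verts"
    then obtain x where x: "p = cls x" "x \<in> Verts" by (rule imageE)
    have "f (cls (N *v x)) = p" using fx[of "N *v x"] x Verts(2)[of x] Verts_subset inv(2) by auto
    then show "p \<in> f ` cls ` Verts" using Verts(2)[OF x(2)] by (metis imageI)
  qed
  have gV: "g ` cls ` Verts = cls ` Verts"
  proof (intro equalityI subsetI)
    fix p assume "p \<in> g ` cls ` Verts"
    then obtain x where x: "x \<in> Verts" "p = g (cls x)" by auto
    then show "p \<in> cls ` Verts" using gx Verts Verts_subset by (metis imageI subsetD)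
  next
    fix p assume "p \<in> cls ` Verts"
    then obtain x where x: "p = cls x" "x \<in> Verts" by (rule imageE)
    have "g (cls (M *v x)) = p" using gx[of "M *v x"] x Verts(1)[of x] Verts_subset inv(1) by auto
    then show "p \<in> g ` cls ` Verts" using Verts(1)[OF x(2)] by (metis imageI)
  qed
  have "invertible M" "invertible N" using MN unfolding invertible_def by blast+
  then have af: "affine_automorphism V M f" "affine_automorphism V N g"
    using affine_automorphismI[OF f g fg(2) fg(1) fV] affine_automorphismI[OF g f fg(1) fg(2) gV] by auto
  have lab: "f ` label_side L = label_side (\<pi> L)" for L
  proof (intro equalityI subsetI)
    fix p assume "p \<in> f ` label_side L"
    then obtain j x where j: "side_label j = L" "x \<in> Side j" "p = f (cls x)" by (auto simp: label_side_def)
    obtain k where k: "M *v side_normal j = side_normal k" "side_label k = \<pi> (side_label j)" using M by blast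
    have "p = cls (M *v x)" using j fx Side_subset by blast
    then show "p \<in> label_side (\<pi> L)" using MS[OF j(2) k(1)] k(2) j(1) unfolding label_side_def by blast
  next
    fix p assume "p \<in> label_side (\<pi> L)"
    then obtain k x where k: "side_label k = \<pi> L" "x \<in> Side k" "p = cls x" by (auto simp: label_side_def)
    obtain j where j: "N *v side_normal k = side_normal j" "side_label k = \<pi> (side_label j)" using N by blast
    have L: "side_label j = L" using j(2) k(1) pi by (simp add: inj_eq)
    have NS': "N *v x \<in> Side j" using NS[OF k(2) j(1)] .
    have "p = f (cls (N *v x))" using fx[of "N *v x"] NS' Side_subset[of j] inv(2) k(3) by (simp add: subset_iff)
    then show "p \<in> f ` label_side L" using NS' L unfolding label_side_def by blast
  qed
  have "symmetry_pair M f N g \<pi>" unfolding symmetry_pair_def using af MN fg pi lab by simp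
  then show ?thesis using fx by blast
qed

lemma rot_symmetry: "\<exists>f g \<pi>. symmetry_pair rot f rot_inv g \<pi> \<and> (\<forall>x\<in>Oct. f (cls x) = cls (rot *v x))"
proof -
  let ?p = "\<lambda>L. case L of LA \<Rightarrow> LB | LB \<Rightarrow> LC | LC \<Rightarrow> LD | LD \<Rightarrow> LA"
  have V2: "rot_inv *v x \<in> Verts" if "x \<in> Verts" for x
  proof -
    obtain j where "x = vertex j" using \<open>x \<in> Verts\<close> unfolding Verts_def by (elim rangeE)
    moreover have "vertex j = vertex (Suc (j + 7))" by (simp add: vertex_def)
    ultimately show ?thesis using rot_vertex(2)[of "j + 7"] by (simp add: Verts_def del: mult_vec2_nth)
  qed
  have N: "\<exists>j. rot_inv *v side_normal k = side_normal j \<and> side_label k = ?p (side_label j)" for k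
  proof -
    have "Suc (k + 7) mod 8 = k mod 8" by simp
    then have "side_normal k = side_normal (Suc (k + 7))" "side_label k = side_label (Suc (k + 7))"
      by (metis side_normal_mod, metis side_label_mod)
    then show ?thesis using rot_side_normal(2)[of "k + 7"] side_label_Suc[of "k + 7"] by metis
  qed
  have "\<exists>f g. symmetry_pair rot f rot_inv g ?p \<and> (\<forall>x\<in>Oct. f (cls x) = cls (rot *v x))"
  proof (rule linear_symmetry)
    show "rot ** rot_inv = mat 1" "rot_inv ** rot = mat 1" "rot_inv = transpose rot"
      by (simp_all add: mat2_eq rot_nth mat_def transpose_def)
    show "inj ?p" by (auto simp: inj_def split: letter.splits)
    show "\<exists>k. rot *v side_normal j = side_normal k \<and> side_label k = ?p (side_label j)" for j
      using rot_side_normal(1) side_label_Suc by blast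
    show "rot *v x \<in> Verts" if "x \<in> Verts" for x
    proof -
      obtain j where "x = vertex j" using \<open>x \<in> Verts\<close> unfolding Verts_def by (elim rangeE)
      then show ?thesis using rot_vertex(1)[of j] by (simp add: Verts_def del: mult_vec2_nth)
    qed
  qed (use N V2 in auto)
  then show ?thesis by blast
qed

lemma flip_symmetry: "\<exists>f g \<pi>. symmetry_pair flip f flip g \<pi>"
proof -
  let ?p = "\<lambda>L. case L of LA \<Rightarrow> LA | LB \<Rightarrow> LD | LC \<Rightarrow> LC | LD \<Rightarrow> LB"
  have "\<exists>f g. symmetry_pair flip f flip g ?p \<and> (\<forall>x\<in>Oct. f (cls x) = cls (flip *v x))"
  proof (rule linear_symmetry)
    show "flip ** flip = mat 1" "flip ** flip = mat 1" "flip = transpose flip"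
      by (simp_all add: mat2_eq rot_nth mat_def transpose_def)
    show "inj ?p" by (auto simp: inj_def split: letter.splits)
    show "\<exists>k. flip *v side_normal j = side_normal k \<and> side_label k = ?p (side_label j)" for j using flip_side_normal .
    show "\<exists>j. flip *v side_normal k = side_normal j \<and> side_label k = ?p (side_label j)" for k
    proof -
      obtain j where j: "flip *v side_normal k = side_normal j" "side_label j = ?p (side_label k)" using flip_side_normal by blast
      have "side_label k = ?p (side_label j)" unfolding j(2) by (cases "side_label k") simp_all
      then show ?thesis using j by blast
    qed
  qed (use flip_Verts in auto)
  then show ?thesis by blast
qed

text \<open>All the matrices \<open>nu i\<close> are products of the rotation by an eighth of a full turn and the reflection
in the vertical axis; four rotations give the sign \<open>-1\<close>.\<close>

lemma nu_symmetry:
  assumes "i < 8" "\<epsilon> = 1 \<or> \<epsilon> = (-1::real)"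
  shows "\<exists>f N g \<pi>. symmetry_pair (\<epsilon> *\<^sub>R nu i) f N g \<pi>"
proof -
  let ?P = "\<lambda>M. \<exists>f N g \<pi>. symmetry_pair M f N g \<pi>"
  have comp: "?P M \<Longrightarrow> ?P M' \<Longrightarrow> ?P (M ** M')" for M M' using symmetry_pair_compose by blast
  have R: "?P rot" using rot_symmetry by blast
  have S: "?P flip" using flip_symmetry by blast
  define R4 where "R4 = rot ** (rot ** (rot ** rot))"
  have P4: "?P R4" unfolding R4_def by (intro comp R)
  have i2: "1 / r2 = r2 / 2" "-1 / r2 = -(r2 / 2)" by (simp_all add: field_simps)
  have nus: "nu 0 = flip ** flip" "nu 1 = rot ** (rot ** (rot ** flip))" "nu 2 = rot"
    "nu 3 = rot ** (rot ** flip)" "nu 4 = rot ** rot" "nu 5 = rot ** flip"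
    "nu 6 = rot ** (rot ** rot)" "nu 7 = flip"
    by (simp_all add: nu_def mat2_eq rot_nth i2 del: mult_cancel_left mult_cancel_right)
  have P: "?P (nu i)" using assms(1) unfolding less8
    by (elim disjE; simp only: nus; intro comp R S)
  have "(-1) *\<^sub>R nu i = R4 ** nu i" by (simp add: mat2_eq R4_def rot_nth)
  then have Pn: "?P ((-1) *\<^sub>R nu i)" using comp[OF P4 P] by (simp only:)
  from assms(2) show ?thesis
  proof
    assume "\<epsilon> = 1" then show ?thesis using P by (simp only: scaleR_one)
  next
    assume "\<epsilon> = -1" then show ?thesis using Pn by (simp only:)
  qed
qed

end

section \<open>The automorphism with derivative gamma\<close>

lemma gamma_nth: "gamma$1$1 = -1" "gamma$1$2 = 2 * sg" "gamma$2$1 = 0" "gamma$2$2 = 1"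
  unfolding gamma_def sg_def by simp_all

text \<open>The derivative \<open>gamma\<close> takes \<open>(x, y)\<close> to \<open>(2 * sg * y - x, y)\<close>. The surface has two horizontal
cylinders. One is the rectangle between the heights \<open>-1\<close> and 1, of circumference \<open>2 * sg\<close>. The other
consists of the trapezoids above and below the rectangle, glued along the slanted sides; it has
circumference \<open>2 * sg + 2\<close>. The branches 0 to 2 bring the image of a point of the rectangle back
into the octagon by a multiple of the first circumference. The branches 3 to 5 do the same for
the upper trapezoid, unrolling the second cylinder: the image lies in the upper trapezoid, in the
adjacent lower one, or in the next upper one, a full circumference further on. The branches 6 to 8
are the images of these under the rotation by a half turn, for the lower trapezoid. The constants
are such that the branches agree up to gluing on the boundaries of the cylinders.\<close>

definition gamma_offset :: "nat \<Rightarrow> real^2" where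
  "gamma_offset i = [vector [2 * sg, 0], vector [0, 0], vector [- (2 * sg), 0],
     vector [- (2 * sg), 0], vector [- (3 * sg + 1), - (sg + 1)], vector [- (4 * sg + 2), 0],
     vector [2 * sg, 0], vector [3 * sg + 1, sg + 1], vector [4 * sg + 2, 0]] ! i"

definition gamma_piece :: "nat \<Rightarrow> (real^2) set" where
  "gamma_piece i = {x \<in> Oct. (if i < 3 then \<bar>x$2\<bar> \<le> 1 else if i < 6 then 1 \<le> x$2 else x$2 \<le> -1)
      \<and> gamma *v x + gamma_offset i \<in> Oct}"

text \<open>All points obtained from \<open>x\<close> by the branches that apply to it. They are glued to each other
(\<open>twist_same_eqv\<close>). Working with this relation makes use of the symmetries under inversion
(\<open>twist_sym\<close>) and under the half turn (\<open>twist_uminus\<close>).\<close>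

definition twist :: "real^2 \<Rightarrow> real^2 \<Rightarrow> bool" where
  "twist x y \<longleftrightarrow> (\<exists>i<9. x \<in> gamma_piece i \<and> y = gamma *v x + gamma_offset i)"

lemma less9: "(\<exists>i<(9::nat). P i) \<longleftrightarrow> (P 0 \<or> P 1 \<or> P 2) \<or> (P 3 \<or> P 4 \<or> P 5) \<or> P 6 \<or> P 7 \<or> P 8"
proof -
  have "(i < (9::nat)) = (i = 0 \<or> i = 1 \<or> i = 2 \<or> i = 3 \<or> i = 4 \<or> i = 5 \<or> i = 6 \<or> i = 7 \<or> i = 8)" for i
    by linarith
  then show ?thesis by auto
qed

lemma twist_iff:
  "twist x y \<longleftrightarrow> x \<in> Oct \<and> y \<in> Oct \<and>
    (-1 \<le> x$2 \<and> x$2 \<le> 1 \<and> y$2 = x$2 \<and> (y$1 = - x$1 + 2 * (sg * x$2) + 2 * sg \<or> y$1 = - x$1 + 2 * (sg * x$2) \<or> y$1 = - x$1 + 2 * (sg * x$2) - 2 * sg) \<or>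
     1 \<le> x$2 \<and> (y$2 = x$2 \<and> y$1 = - x$1 + 2 * (sg * x$2) - 2 * sg
        \<or> y$2 = x$2 - sg - 1 \<and> y$1 = - x$1 + 2 * (sg * x$2) - 3 * sg - 1
        \<or> y$2 = x$2 \<and> y$1 = - x$1 + 2 * (sg * x$2) - 4 * sg - 2) \<or>
     x$2 \<le> -1 \<and> (y$2 = x$2 \<and> y$1 = - x$1 + 2 * (sg * x$2) + 2 * sg
        \<or> y$2 = x$2 + sg + 1 \<and> y$1 = - x$1 + 2 * (sg * x$2) + 3 * sg + 1
        \<or> y$2 = x$2 \<and> y$1 = - x$1 + 2 * (sg * x$2) + 4 * sg + 2))"
proof -
  have "twist x y \<longleftrightarrow> x \<in> Oct \<and> y \<in> Oct \<and> (\<exists>i<9. (if i < 3 then \<bar>x$2\<bar> \<le> 1 else if i < 6 then 1 \<le> x$2 else x$2 \<le> -1)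
     \<and> y = gamma *v x + gamma_offset i)"
    unfolding twist_def gamma_piece_def by blast
  also have "\<dots> = (x \<in> Oct \<and> y \<in> Oct \<and>
    (\<bar>x$2\<bar> \<le> 1 \<and> (y = gamma *v x + gamma_offset 0 \<or> y = gamma *v x + gamma_offset 1 \<or> y = gamma *v x + gamma_offset 2) \<or>
     1 \<le> x$2 \<and> (y = gamma *v x + gamma_offset 3 \<or> y = gamma *v x + gamma_offset 4 \<or> y = gamma *v x + gamma_offset 5) \<or>
     x$2 \<le> -1 \<and> (y = gamma *v x + gamma_offset 6 \<or> y = gamma *v x + gamma_offset 7 \<or> y = gamma *v x + gamma_offset 8)))"
    unfolding less9 by (simp del: One_nat_def) blast
  finally show ?thesis
    by (simp add: vec2_eq gamma_offset_def gamma_nth algebra_simps) (simp add: abs_le_iff conj_ac; argo)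
qed

lemma twistI:
  assumes "x \<in> Oct" "y \<in> Oct"
  shows "-1 \<le> x$2 \<Longrightarrow> x$2 \<le> 1 \<Longrightarrow> y$2 = x$2 \<Longrightarrow> y$1 = - x$1 + 2 * (sg * x$2) + 2 * sg \<Longrightarrow> twist x y"
    "-1 \<le> x$2 \<Longrightarrow> x$2 \<le> 1 \<Longrightarrow> y$2 = x$2 \<Longrightarrow> y$1 = - x$1 + 2 * (sg * x$2) \<Longrightarrow> twist x y"
    "-1 \<le> x$2 \<Longrightarrow> x$2 \<le> 1 \<Longrightarrow> y$2 = x$2 \<Longrightarrow> y$1 = - x$1 + 2 * (sg * x$2) - 2 * sg \<Longrightarrow> twist x y"
    "1 \<le> x$2 \<Longrightarrow> y$2 = x$2 \<Longrightarrow> y$1 = - x$1 + 2 * (sg * x$2) - 2 * sg \<Longrightarrow> twist x y"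
    "1 \<le> x$2 \<Longrightarrow> y$2 = x$2 - sg - 1 \<Longrightarrow> y$1 = - x$1 + 2 * (sg * x$2) - 3 * sg - 1 \<Longrightarrow> twist x y"
    "1 \<le> x$2 \<Longrightarrow> y$2 = x$2 \<Longrightarrow> y$1 = - x$1 + 2 * (sg * x$2) - 4 * sg - 2 \<Longrightarrow> twist x y"
    "x$2 \<le> -1 \<Longrightarrow> y$2 = x$2 \<Longrightarrow> y$1 = - x$1 + 2 * (sg * x$2) + 2 * sg \<Longrightarrow> twist x y"
    "x$2 \<le> -1 \<Longrightarrow> y$2 = x$2 + sg + 1 \<Longrightarrow> y$1 = - x$1 + 2 * (sg * x$2) + 3 * sg + 1 \<Longrightarrow> twist x y"
    "x$2 \<le> -1 \<Longrightarrow> y$2 = x$2 \<Longrightarrow> y$1 = - x$1 + 2 * (sg * x$2) + 4 * sg + 2 \<Longrightarrow> twist x y"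
  using assms unfolding twist_iff by blast+

lemma mem_Oct': "u \<in> Oct \<longleftrightarrow> -sg \<le> u$1 \<and> u$1 \<le> sg \<and> -sg \<le> u$2 \<and> u$2 \<le> sg \<and> u$1 + u$2 \<le> sg + 1
   \<and> - u$1 - u$2 \<le> sg + 1 \<and> u$1 - u$2 \<le> sg + 1 \<and> u$2 - u$1 \<le> sg + 1"
  unfolding mem_Oct by linarith

text \<open>Corresponds to the fact that \<open>gamma\<close> is an involution: the inverse of each branch is again a branch.\<close>

lemma twist_sym: assumes "twist x y" shows "twist y x"
proof -
  note O = assms[unfolded twist_iff, THEN conjunct1] assms[unfolded twist_iff, THEN conjunct2, THEN conjunct1]
  note tw = assms[unfolded twist_iff, THEN conjunct2, THEN conjunct2]
  note b = O(1)[unfolded mem_Oct']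
  note r = twistI[OF O(2,1)]
  have e: "sg * (x$2 - sg - 1) = sg * x$2 - 3 * sg - 1" "sg * (x$2 + sg + 1) = sg * x$2 + 3 * sg + 1"
    using sg_sq by (simp_all add: algebra_simps)
  have m: "twist y x" if "y$2 = x$2 - sg - 1" "y$1 = - x$1 + 2 * (sg * x$2) - 3 * sg - 1"
  proof -
    have "sg * y$2 = sg * x$2 - 3 * sg - 1" using that(1) e(1) by (simp only:)
    then show ?thesis using that b by (intro r(8)) linarith+
  qed
  have m': "twist y x" if "y$2 = x$2 + sg + 1" "y$1 = - x$1 + 2 * (sg * x$2) + 3 * sg + 1"
  proof -
    have "sg * y$2 = sg * x$2 + 3 * sg + 1" using that(1) e(2) by (simp only:)
    then show ?thesis using that b by (intro r(5)) linarith+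
  qed
  from tw show ?thesis
  proof (elim conjE disjE, goal_cases)
    case 1 then show ?case by (intro r(1)) simp_all next
    case 2 then show ?case by (intro r(2)) simp_all next
    case 3 then show ?case by (intro r(3)) simp_all next
    case 4 then show ?case by (intro r(4)) simp_all next
    case 5 then show ?case by (intro m) next
    case 6 then show ?case by (intro r(6)) simp_all next
    case 7 then show ?case by (intro r(7)) simp_all next
    case 8 then show ?case by (intro m') next
    case 9 then show ?case by (intro r(9)) simp_all
  qed
qed

text \<open>Within each cylinder the horizontal coordinate of the image is in one of three ranges, and each range
is brought back into the octagon by one of the three branches.\<close>

lemma twist_ex: assumes x: "x \<in> Oct" shows "\<exists>y. twist x y"
proof -
  have b: "\<bar>x$1\<bar> \<le> sg" "\<bar>x$2\<bar> \<le> sg" "\<bar>x$1 + x$2\<bar> \<le> sg + 1" "\<bar>x$1 - x$2\<bar> \<le> sg + 1"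
    using x by (auto simp: mem_Oct)
  have sg0: "sg > 0" using sg_bounds by simp
  note sb = sg_bounds
  define t where "t = - x$1 + 2 * (sg * x$2)"
  consider "\<bar>x$2\<bar> \<le> 1" | "1 \<le> x$2" | "x$2 \<le> -1" by linarith
  then show ?thesis
  proof cases
    case 1
    have "\<bar>sg * x$2\<bar> \<le> sg" using 1 sg0 by (simp add: abs_mult mult_left_le)
    then have t: "-3 * sg \<le> t" "t \<le> 3 * sg" using b unfolding t_def by linarith+
    consider "t < - sg" | "-sg \<le> t \<and> t \<le> sg" | "t > sg" by linarith
    then show ?thesis
    proof cases
      case a: 1
      then have "vector [t + 2 * sg, x$2] \<in> Oct" using 1 t b sb unfolding mem_Oct' t_def by (simp; linarith)
      from twistI(1)[OF x this] show ?thesis using 1 a unfolding t_def[symmetric] by (intro exI[of _ "vector [t + 2 * sg, x$2]"]) (simp_all add: abs_le_iff)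
    next
      case a: 2
      then have "vector [t, x$2] \<in> Oct" using 1 t b sb unfolding mem_Oct' t_def by (simp; linarith)
      from twistI(2)[OF x this] show ?thesis using 1 a unfolding t_def[symmetric] by (intro exI[of _ "vector [t, x$2]"]) (simp_all add: abs_le_iff)
    next
      case a: 3
      then have "vector [t - 2 * sg, x$2] \<in> Oct" using 1 t b sb unfolding mem_Oct' t_def by (simp; linarith)
      from twistI(3)[OF x this] show ?thesis using 1 a unfolding t_def[symmetric] by (intro exI[of _ "vector [t - 2 * sg, x$2]"]) (simp_all add: abs_le_iff)
    qed
  next
    case 2
    have "sg * x$2 \<le> sg * sg" "sg * 1 \<le> sg * x$2" using 2 b(2) sg0 by (intro mult_left_mono; linarith)+
    then have s: "sg * x$2 \<le> 2 * sg + 1" "sg \<le> sg * x$2" using sg_sq by linarith+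
    consider "t - 2 * sg \<le> sg + 1 - x$2" | "t - 2 * sg > sg + 1 - x$2 \<and> t - 2 * sg \<le> sg + 1 + x$2" | "t - 2 * sg > sg + 1 + x$2" by linarith
    then show ?thesis
    proof cases
      case a: 1
      then have "vector [t - 2 * sg, x$2] \<in> Oct" using 2 s b sb unfolding mem_Oct' t_def by (simp; linarith)
      from twistI(4)[OF x this] show ?thesis using 2 a unfolding t_def[symmetric] by (intro exI[of _ "vector [t - 2 * sg, x$2]"]) (simp_all add: abs_le_iff)
    next
      case a: 2
      then have "vector [t - 3 * sg - 1, x$2 - sg - 1] \<in> Oct" using 2 s b sb unfolding mem_Oct' t_def by (simp; linarith)
      from twistI(5)[OF x this] show ?thesis using 2 a unfolding t_def[symmetric] by (intro exI[of _ "vector [t - 3 * sg - 1, x$2 - sg - 1]"]) (simp_all add: abs_le_iff)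
    next
      case a: 3
      then have "vector [t - 4 * sg - 2, x$2] \<in> Oct" using 2 s b sb unfolding mem_Oct' t_def by (simp; linarith)
      from twistI(6)[OF x this] show ?thesis using 2 a unfolding t_def[symmetric] by (intro exI[of _ "vector [t - 4 * sg - 2, x$2]"]) (simp_all add: abs_le_iff)
    qed
  next
    case 3
    have "sg * (- x$2) \<le> sg * sg" "sg * 1 \<le> sg * (- x$2)" using 3 b(2) sg0 by (intro mult_left_mono; linarith)+
    then have s: "- (sg * x$2) \<le> 2 * sg + 1" "sg \<le> - (sg * x$2)" using sg_sq by simp_all
    consider "- t - 2 * sg \<le> sg + 1 + x$2" | "- t - 2 * sg > sg + 1 + x$2 \<and> - t - 2 * sg \<le> sg + 1 - x$2" | "- t - 2 * sg > sg + 1 - x$2" by linarith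
    then show ?thesis
    proof cases
      case a: 1
      then have "vector [t + 2 * sg, x$2] \<in> Oct" using 3 s b sb unfolding mem_Oct' t_def by (simp; linarith)
      from twistI(7)[OF x this] show ?thesis using 3 a unfolding t_def[symmetric] by (intro exI[of _ "vector [t + 2 * sg, x$2]"]) (simp_all add: abs_le_iff)
    next
      case a: 2
      then have "vector [t + 3 * sg + 1, x$2 + sg + 1] \<in> Oct" using 3 s b sb unfolding mem_Oct' t_def by (simp; linarith)
      from twistI(8)[OF x this] show ?thesis using 3 a unfolding t_def[symmetric] by (intro exI[of _ "vector [t + 3 * sg + 1, x$2 + sg + 1]"]) (simp_all add: abs_le_iff)
    next
      case a: 3
      then have "vector [t + 4 * sg + 2, x$2] \<in> Oct" using 3 s b sb unfolding mem_Oct' t_def by (simp; linarith)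
      from twistI(9)[OF x this] show ?thesis using 3 a unfolding t_def[symmetric] by (intro exI[of _ "vector [t + 4 * sg + 2, x$2]"]) (simp_all add: abs_le_iff)
    qed
  qed
qed

lemma VertsI:
  "u$1 = 1 \<Longrightarrow> u$2 = sg \<Longrightarrow> u \<in> Verts" "u$1 = 1 \<Longrightarrow> u$2 = -sg \<Longrightarrow> u \<in> Verts"
  "u$1 = -1 \<Longrightarrow> u$2 = sg \<Longrightarrow> u \<in> Verts" "u$1 = -1 \<Longrightarrow> u$2 = -sg \<Longrightarrow> u \<in> Verts"
  "u$1 = sg \<Longrightarrow> u$2 = 1 \<Longrightarrow> u \<in> Verts" "u$1 = sg \<Longrightarrow> u$2 = -1 \<Longrightarrow> u \<in> Verts"
  "u$1 = -sg \<Longrightarrow> u$2 = 1 \<Longrightarrow> u \<in> Verts" "u$1 = -sg \<Longrightarrow> u$2 = -1 \<Longrightarrow> u \<in> Verts"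
  unfolding mem_Verts using sg_bounds by auto

lemma Oct_uminus: "- u \<in> Oct \<longleftrightarrow> u \<in> Oct"
  unfolding mem_Oct by (simp; linarith)

lemma Verts_uminus: "- u \<in> Verts \<longleftrightarrow> u \<in> Verts"
  unfolding mem_Verts by simp

lemma twist_uminus: assumes "twist x y" shows "twist (- x) (- y)"
proof -
  note O = assms[unfolded twist_iff, THEN conjunct1] assms[unfolded twist_iff, THEN conjunct2, THEN conjunct1]
  note tw = assms[unfolded twist_iff, THEN conjunct2, THEN conjunct2]
  note r = twistI[of "-x" "-y", unfolded Oct_uminus, OF O]
  from tw show ?thesis
  proof (elim conjE disjE, goal_cases)
    case 1 then show ?case by (intro r(3)) simp_all next
    case 2 then show ?case by (intro r(2)) simp_all next
    case 3 then show ?case by (intro r(1)) simp_all next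
    case 4 then show ?case by (intro r(7)) simp_all next
    case 5 then show ?case by (intro r(8)) simp_all next
    case 6 then show ?case by (intro r(9)) simp_all next
    case 7 then show ?case by (intro r(4)) simp_all next
    case 8 then show ?case by (intro r(5)) simp_all next
    case 9 then show ?case by (intro r(6)) simp_all
  qed
qed

lemma twist_Verts: assumes "twist x y" "x \<in> Verts" shows "y \<in> Verts"
proof -
  have upper: "y \<in> Verts" if tw: "twist x y" and V: "x \<in> Verts" and pos: "x$2 > 0" for x y
  proof -
    have b: "- sg \<le> y$1" "y$1 \<le> sg" using tw unfolding twist_iff mem_Oct' by simp_all
    have e: "\<bar>a\<bar> = 1 \<longleftrightarrow> a = 1 \<or> a = -1" "\<bar>a\<bar> = sg \<longleftrightarrow> a = sg \<or> a = -sg" for a :: real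
      using sg_bounds by linarith+
    consider "x$2 = 1" "x$1 = sg \<or> x$1 = -sg" | "x$2 = sg" "x$1 = 1 \<or> x$1 = -1"
      using V pos sg_bounds unfolding mem_Verts e by fastforce
    then show ?thesis
    proof cases
      case 1
      then have "y$2 = 1 \<and> (y$1 = - x$1 + 4 * sg \<or> y$1 = - x$1 + 2 * sg \<or> y$1 = - x$1 \<or> y$1 = - x$1 - 2 * sg - 2)
          \<or> y$2 = - sg \<and> y$1 = - x$1 - sg - 1"
        using tw unfolding twist_iff by auto
      then have "y$2 = 1 \<and> (y$1 = sg \<or> y$1 = -sg) \<or> y$2 = -sg \<and> y$1 = -1"
        using 1(2) b sg_bounds by (elim disjE conjE) simp_all
      then show ?thesis using VertsI by blast
    next
      case 2
      have "sg * x$2 = 2 * sg + 1" using 2 sg_sq by simp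
      then have "y$2 = sg \<and> (y$1 = - x$1 + 2 * sg + 2 \<or> y$1 = - x$1) \<or> y$2 = -1 \<and> y$1 = - x$1 + sg + 1"
        using tw 2(1) sg_bounds unfolding twist_iff by auto
      then have "y$2 = sg \<and> (y$1 = 1 \<or> y$1 = -1) \<or> y$2 = -1 \<and> y$1 = sg"
        using 2(2) b sg_bounds by (elim disjE conjE) simp_all
      then show ?thesis using VertsI by blast
    qed
  qed
  have "x$2 \<noteq> 0" using assms(2) sg_bounds unfolding mem_Verts by auto
  then consider "x$2 > 0" | "(- x)$2 > 0" by (simp; linarith)
  then show ?thesis
  proof cases
    case 2
    then have "- y \<in> Verts" using upper[of "-x" "-y"] twist_uminus[OF assms(1)] assms(2) Verts_uminus by blast
    then show ?thesis by (simp only: Verts_uminus)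
  qed (use upper assms in blast)
qed

lemma eqv_diffI:
  assumes "y \<in> Oct" "y' \<in> Oct"
  shows "y'$1 = y$1 \<Longrightarrow> y'$2 = y$2 \<Longrightarrow> eqv y y'"
    "y'$1 = y$1 \<Longrightarrow> y'$2 = y$2 - 2 * sg \<Longrightarrow> eqv y y'"
    "y'$1 = y$1 \<Longrightarrow> y'$2 = y$2 + 2 * sg \<Longrightarrow> eqv y y'"
    "y'$1 = y$1 - 2 * sg \<Longrightarrow> y'$2 = y$2 \<Longrightarrow> eqv y y'"
    "y'$1 = y$1 + 2 * sg \<Longrightarrow> y'$2 = y$2 \<Longrightarrow> eqv y y'"
    "y'$1 = y$1 + sg + 1 \<Longrightarrow> y'$2 = y$2 + sg + 1 \<Longrightarrow> eqv y y'"
    "y'$1 = y$1 + sg + 1 \<Longrightarrow> y'$2 = y$2 - sg - 1 \<Longrightarrow> eqv y y'"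
    "y'$1 = y$1 - sg - 1 \<Longrightarrow> y'$2 = y$2 + sg + 1 \<Longrightarrow> eqv y y'"
    "y'$1 = y$1 - sg - 1 \<Longrightarrow> y'$2 = y$2 - sg - 1 \<Longrightarrow> eqv y y'"
proof -
  note g = eqv_glue_vecI[OF assms]
  show "y'$1 = y$1 \<Longrightarrow> y'$2 = y$2 \<Longrightarrow> eqv y y'" by (simp add: eqv_def vec2_eq)
  show "y'$1 = y$1 \<Longrightarrow> y'$2 = y$2 - 2 * sg \<Longrightarrow> eqv y y'" by (rule g[of 0]) (simp add: vec2_eq glue_vec_simps)
  show "y'$1 = y$1 \<Longrightarrow> y'$2 = y$2 + 2 * sg \<Longrightarrow> eqv y y'" by (rule g[of 4]) (simp add: vec2_eq glue_vec_simps)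
  show "y'$1 = y$1 - 2 * sg \<Longrightarrow> y'$2 = y$2 \<Longrightarrow> eqv y y'" by (rule g[of 2]) (simp add: vec2_eq glue_vec_simps)
  show "y'$1 = y$1 + 2 * sg \<Longrightarrow> y'$2 = y$2 \<Longrightarrow> eqv y y'" by (rule g[of 6]) (simp add: vec2_eq glue_vec_simps)
  show "y'$1 = y$1 + sg + 1 \<Longrightarrow> y'$2 = y$2 + sg + 1 \<Longrightarrow> eqv y y'" by (rule g[of 5]) (simp add: vec2_eq glue_vec_simps)
  show "y'$1 = y$1 + sg + 1 \<Longrightarrow> y'$2 = y$2 - sg - 1 \<Longrightarrow> eqv y y'" by (rule g[of 7]) (simp add: vec2_eq glue_vec_simps)
  show "y'$1 = y$1 - sg - 1 \<Longrightarrow> y'$2 = y$2 + sg + 1 \<Longrightarrow> eqv y y'" by (rule g[of 3]) (simp add: vec2_eq glue_vec_simps)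
  show "y'$1 = y$1 - sg - 1 \<Longrightarrow> y'$2 = y$2 - sg - 1 \<Longrightarrow> eqv y y'" by (rule g[of 1]) (simp add: vec2_eq glue_vec_simps)
qed

lemma eqv_uminus: assumes "eqv u v" shows "eqv (- u) (- v)"
proof -
  have S: "- u \<in> Side (j + 4)" if "u \<in> Side j" for j
    using that by (auto simp: Side_def side_normal_add4 Oct_uminus)
  have "- (u + glue_vec j) = - u + glue_vec (j + 4)" for j by (simp add: glue_vec_add4)
  then show ?thesis using assms S Verts_uminus unfolding eqv_def by metis
qed

text \<open>Here \<open>a\<close>, \<open>a'\<close> and \<open>p\<close>, \<open>p'\<close> stand for the horizontal and vertical coordinates of two images of a
point, or of a point and one glued to it, for all combinations of branches. As the octagon has
width \<open>2 * s\<close>, most combinations are impossible; in the others the images differ by a gluing vector.\<close>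

lemma shift_arith:
  fixes a a' b b' p p' q q' s :: real
  assumes "0 < s" "-s \<le> a" "a \<le> s" "-s \<le> a'" "a' \<le> s"
  shows "a = b + 2 * s \<or> a = b \<or> a = b - 2 * s \<Longrightarrow> a' = b' + 2 * s \<or> a' = b' \<or> a' = b' - 2 * s \<Longrightarrow>
      b' = b \<or> b' = b + 2 * s \<Longrightarrow> a' = a \<or> a' = a - 2 * s \<or> a' = a + 2 * s"
    "p = q \<and> a = b \<or> p = q - s - 1 \<and> a = b - s - 1 \<or> p = q \<and> a = b - 2 * s - 2 \<Longrightarrow>
     p' = q \<and> a' = b \<or> p' = q - s - 1 \<and> a' = b - s - 1 \<or> p' = q \<and> a' = b - 2 * s - 2 \<Longrightarrow>
     a' = a \<and> p' = p \<or> a' = a + s + 1 \<and> p' = p + s + 1 \<or> a' = a + s + 1 \<and> p' = p - s - 1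
      \<or> a' = a - s - 1 \<and> p' = p + s + 1 \<or> a' = a - s - 1 \<and> p' = p - s - 1"
    "p = q \<and> a = b \<or> p = q - s - 1 \<and> a = b - s - 1 \<or> p = q \<and> a = b - 2 * s - 2 \<Longrightarrow>
     p' = q - s - 1 \<and> a' = b - s - 1 \<or> p' = q \<and> a' = b \<or> p' = q - s - 1 \<and> a' = b + s + 1 \<Longrightarrow>
     a' = a \<and> p' = p \<or> a' = a + s + 1 \<and> p' = p + s + 1 \<or> a' = a + s + 1 \<and> p' = p - s - 1
      \<or> a' = a - s - 1 \<and> p' = p + s + 1 \<or> a' = a - s - 1 \<and> p' = p - s - 1"
    "p = q \<and> a = b \<or> p = q + s + 1 \<and> a = b + s + 1 \<or> p = q \<and> a = b + 2 * s + 2 \<Longrightarrow>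
     p' = q + s + 1 \<and> a' = b + 3 * s + 3 \<or> p' = q \<and> a' = b + 2 * s + 2 \<or> p' = q + s + 1 \<and> a' = b + s + 1 \<Longrightarrow>
     a' = a \<and> p' = p \<or> a' = a + s + 1 \<and> p' = p + s + 1 \<or> a' = a + s + 1 \<and> p' = p - s - 1
      \<or> a' = a - s - 1 \<and> p' = p + s + 1 \<or> a' = a - s - 1 \<and> p' = p - s - 1"
  using assms by (smt (verit))+

lemma twist_rect_eqv:
  assumes "twist x y" "twist x' y'" "-1 < x$2" "x$2 < 1" "x'$2 = x$2" "x'$1 = x$1 \<or> x$1 = sg \<and> x'$1 = - sg"
  shows "eqv y y'"
proof -
  have O: "y \<in> Oct" "y' \<in> Oct" using assms(1,2) by (auto simp: twist_iff)
  have b: "- sg \<le> y$1" "y$1 \<le> sg" "- sg \<le> y'$1" "y'$1 \<le> sg" using O unfolding mem_Oct' by simp_all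
  have y: "y$2 = x$2 \<and> (y$1 = - x$1 + 2 * (sg * x$2) + 2 * sg \<or> y$1 = - x$1 + 2 * (sg * x$2) \<or> y$1 = - x$1 + 2 * (sg * x$2) - 2 * sg)"
    using assms(1,3,4) unfolding twist_iff by linarith
  have y': "y'$2 = x$2 \<and> (y'$1 = - x'$1 + 2 * (sg * x$2) + 2 * sg \<or> y'$1 = - x'$1 + 2 * (sg * x$2) \<or> y'$1 = - x'$1 + 2 * (sg * x$2) - 2 * sg)"
    using assms(2-5) unfolding twist_iff by auto
  have "y'$2 = y$2" using y y' by simp
  moreover have "y'$1 = y$1 \<or> y'$1 = y$1 - 2 * sg \<or> y'$1 = y$1 + 2 * sg"
    using sg_bounds assms(6)
    by (intro shift_arith(1)[OF _ b conjunct2[OF y] conjunct2[OF y']]) auto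
  ultimately show ?thesis using eqv_diffI[OF O] by blast
qed

text \<open>On the common boundary of the two cylinders all branches give the same point, the mirror image.\<close>

lemma twist_edge:
  assumes "twist x y" "x$2 = 1" "x \<notin> Verts" shows "y$1 = - x$1 \<and> y$2 = 1"
proof -
  have O: "x \<in> Oct" "y \<in> Oct" using assms(1) by (auto simp: twist_iff)
  have "x$1 \<noteq> sg" "x$1 \<noteq> -sg" using assms(2,3) VertsI by blast+
  then have x1: "-sg < x$1" "x$1 < sg" using O(1) unfolding mem_Oct' by linarith+
  have b: "- sg \<le> y$1" "y$1 \<le> sg" "- y$1 - y$2 \<le> sg + 1" using O(2) unfolding mem_Oct' by simp_all
  have "y$2 = 1 \<and> (y$1 = - x$1 + 4 * sg \<or> y$1 = - x$1 + 2 * sg \<or> y$1 = - x$1 \<or> y$1 = - x$1 - 2 * sg - 2)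
      \<or> y$2 = - sg \<and> y$1 = - x$1 - sg - 1"
    using assms(1,2) unfolding twist_iff by auto
  then show ?thesis using b x1 sg_bounds by (elim disjE conjE) simp_all
qed

lemma twist_upper_cases:
  assumes "twist x y" "1 < x$2"
  shows "y$2 = x$2 \<and> y$1 = - x$1 + 2 * (sg * x$2) - 2 * sg
        \<or> y$2 = x$2 - sg - 1 \<and> y$1 = - x$1 + 2 * (sg * x$2) - 3 * sg - 1
        \<or> y$2 = x$2 \<and> y$1 = - x$1 + 2 * (sg * x$2) - 4 * sg - 2"
  using assms unfolding twist_iff by auto

lemma twist_lower_cases:
  assumes "twist x y" "x$2 < -1"
  shows "y$2 = x$2 \<and> y$1 = - x$1 + 2 * (sg * x$2) + 2 * sg
        \<or> y$2 = x$2 + sg + 1 \<and> y$1 = - x$1 + 2 * (sg * x$2) + 3 * sg + 1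
        \<or> y$2 = x$2 \<and> y$1 = - x$1 + 2 * (sg * x$2) + 4 * sg + 2"
  using assms unfolding twist_iff by auto

lemma twist_same_eqv:
  assumes "twist x y" "twist x y'" shows "eqv y y'"
proof -
  have upper: "eqv y y'" if t: "twist x y" "twist x y'" and pos: "x$2 \<ge> 0" and nV: "x \<notin> Verts" for x y y'
  proof -
    have O: "y \<in> Oct" "y' \<in> Oct" using t by (auto simp: twist_iff)
    have b: "- sg \<le> y$1" "y$1 \<le> sg" "- sg \<le> y'$1" "y'$1 \<le> sg" using O unfolding mem_Oct' by simp_all
    consider "x$2 < 1" | "x$2 = 1" | "x$2 > 1" by linarith
    then show ?thesis
    proof cases
      case 1 then show ?thesis using twist_rect_eqv[OF t] pos by simp
    next
      case 2
      then show ?thesis using twist_edge[OF t(1)] twist_edge[OF t(2)] nV by (simp add: eqv_diffI(1)[OF O])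
    next
      case 3
      note e = eqv_diffI[OF O]
      have s0: "0 < sg" using sg_bounds by simp
      let ?b = "- x$1 + 2 * (sg * x$2) - 2 * sg"
      have "y$2 = x$2 \<and> y$1 = ?b \<or> y$2 = x$2 - sg - 1 \<and> y$1 = ?b - sg - 1 \<or> y$2 = x$2 \<and> y$1 = ?b - 2 * sg - 2"
        "y'$2 = x$2 \<and> y'$1 = ?b \<or> y'$2 = x$2 - sg - 1 \<and> y'$1 = ?b - sg - 1 \<or> y'$2 = x$2 \<and> y'$1 = ?b - 2 * sg - 2"
        using twist_upper_cases[OF t(1) 3] twist_upper_cases[OF t(2) 3] by auto
      from shift_arith(2)[OF s0 b this] show ?thesis using e by blast
    qed
  qed
  show ?thesis
  proof (cases "x \<in> Verts")
    case True then show ?thesis using twist_Verts assms by (auto simp: eqv_def)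
  next
    case False
    show ?thesis
    proof (cases "x$2 \<ge> 0")
      case True then show ?thesis using upper assms False by blast
    next
      case neg: False
      have "eqv (- y) (- y')" using upper[OF twist_uminus[OF assms(1)] twist_uminus[OF assms(2)]] neg False
        by (simp add: Verts_uminus)
      from eqv_uminus[OF this] show ?thesis by simp
    qed
  qed
qed

lemma twist_glued_eqv:
  assumes t: "twist x y" "twist x' y'" and x: "x \<in> Side j" "x \<notin> Verts" "x' = x + glue_vec j" and j: "j < 4"
  shows "eqv y y'"
proof -
  have O: "y \<in> Oct" "y' \<in> Oct" using t by (auto simp: twist_iff)
  note e = eqv_diffI[OF O]
  have b: "- sg \<le> y$1" "y$1 \<le> sg" "- sg \<le> y'$1" "y'$1 \<le> sg" using O unfolding mem_Oct' by simp_all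
  note op = mem_open_Side[OF x(2)]
  consider "j = 0" | "j = 1" | "j = 2" | "j = 3" using j by linarith
  then show ?thesis
  proof cases
    case 1
    then have xx: "x$2 = sg" "-1 < x$1" "x$1 < 1" "x'$1 = x$1" "x'$2 = - sg" using x(1,3) op by (simp_all add: glue_vec_simps)
    then have s: "sg * x$2 = 2 * sg + 1" "sg * x'$2 = - 2 * sg - 1" using sg_sq by simp_all
    have gt: "x$2 > 1" "x'$2 < -1" using xx sg_bounds by simp_all
    have "y$2 = sg \<and> y$1 = - x$1" using twist_upper_cases[OF t(1) gt(1)] b xx s sg_bounds by (elim disjE conjE) simp_all
    moreover have "y'$2 = -sg \<and> y'$1 = - x$1" using twist_lower_cases[OF t(2) gt(2)] b xx s sg_bounds by (elim disjE conjE) simp_all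
    ultimately show ?thesis by (intro e(2)) simp_all
  next
    case 3
    then have xx: "x$1 = sg" "-1 < x$2" "x$2 < 1" "x'$2 = x$2" "x'$1 = - sg" using x(1,3) op by (simp_all add: glue_vec_simps)
    then show ?thesis using twist_rect_eqv[OF t] by simp
  next
    case 2
    then have xx: "x$1 = sg + 1 - x$2" "1 < x$2" "x$2 < sg" "x'$1 = x$1 - sg - 1" "x'$2 = x$2 - sg - 1"
      using x(1,3) op by (simp_all add: glue_vec_simps)
    have "sg * (x$2 - sg - 1) = sg * x$2 - 3 * sg - 1" using sg_sq by (simp add: algebra_simps)
    then have s: "sg * x'$2 = sg * x$2 - 3 * sg - 1" by (simp only: xx(5))
    have lt: "x'$2 < -1" using xx by simp
    have s0: "0 < sg" using sg_bounds by simp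
    let ?b = "- x$1 + 2 * (sg * x$2) - 2 * sg"
    have 1: "y$2 = x$2 \<and> y$1 = ?b \<or> y$2 = x$2 - sg - 1 \<and> y$1 = ?b - sg - 1 \<or> y$2 = x$2 \<and> y$1 = ?b - 2 * sg - 2"
      using twist_upper_cases[OF t(1) xx(2)] by auto
    have 2: "y'$2 = x$2 - sg - 1 \<and> y'$1 = ?b - sg - 1 \<or> y'$2 = x$2 \<and> y'$1 = ?b \<or> y'$2 = x$2 - sg - 1 \<and> y'$1 = ?b + sg + 1"
      using twist_lower_cases[OF t(2) lt] unfolding s unfolding xx(4,5) by auto
    show ?thesis using shift_arith(3)[OF s0 b 1 2] e by blast
  next
    case 4
    then have xx: "x$1 = sg + 1 + x$2" "- sg < x$2" "x$2 < -1" "x'$1 = x$1 - sg - 1" "x'$2 = x$2 + sg + 1"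
      using x(1,3) op by (simp_all add: glue_vec_simps)
    have "sg * (x$2 + sg + 1) = sg * x$2 + 3 * sg + 1" using sg_sq by (simp add: algebra_simps)
    then have s: "sg * x'$2 = sg * x$2 + 3 * sg + 1" by (simp only: xx(5))
    have gt: "x'$2 > 1" using xx by simp
    have s0: "0 < sg" using sg_bounds by simp
    let ?b = "- x$1 + 2 * (sg * x$2) + 2 * sg"
    have 1: "y$2 = x$2 \<and> y$1 = ?b \<or> y$2 = x$2 + sg + 1 \<and> y$1 = ?b + sg + 1 \<or> y$2 = x$2 \<and> y$1 = ?b + 2 * sg + 2"
      using twist_lower_cases[OF t(1) xx(3)] by auto
    have 2: "y'$2 = x$2 + sg + 1 \<and> y'$1 = ?b + 3 * sg + 3 \<or> y'$2 = x$2 \<and> y'$1 = ?b + 2 * sg + 2 \<or> y'$2 = x$2 + sg + 1 \<and> y'$1 = ?b + sg + 1"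
      using twist_upper_cases[OF t(2) gt] unfolding s unfolding xx(4,5) by auto
    show ?thesis using shift_arith(4)[OF s0 b 1 2] e by blast
  qed
qed

lemma eqv_lower_side:
  assumes "eqv x x'" "x \<notin> Verts" "x \<noteq> x'"
  shows "\<exists>j<4. (x \<in> Side j \<and> x' = x + glue_vec j) \<or> (x' \<in> Side j \<and> x = x' + glue_vec j)"
proof -
  obtain j where "x \<in> Side j" "x' = x + glue_vec j" using assms unfolding eqv_def by blast
  then obtain j where j: "j < 8" "x \<in> Side j" "x' = x + glue_vec j"
    using Side_mod[of j] glue_vec_mod[of j] mod8_less by metis
  show ?thesis
  proof (cases "j < 4")
    case True then show ?thesis using j by blast
  next
    case False
    then have "j = (j - 4) + 4" by simp
    then have "glue_vec j = - glue_vec (j - 4)" by (metis glue_vec_add4)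
    moreover have "x' \<in> Side (j - 4)"
    proof -
      have "x' \<in> Side (j + 4)" using Side_glue_vec4 j by simp
      moreover have "(j + 4) mod 8 = (j - 4) mod 8" using False mod_add_self2[of "j - 4" 8] by (simp add: add.commute)
      ultimately show ?thesis using Side_mod by metis
    qed
    ultimately show ?thesis using j False by (intro exI[of _ "j - 4"]) simp
  qed
qed

lemma twist_eqv:
  assumes "twist x y" "twist x' y'" "eqv x x'" shows "eqv y y'"
proof (cases "x \<in> Verts")
  case True then show ?thesis using twist_Verts eqv_Verts assms by (metis eqv_def)
next
  case False
  show ?thesis
  proof (cases "x = x'")
    case True then show ?thesis using twist_same_eqv assms by blast
  next
    case neq: False
    have "x' \<notin> Verts" using False eqv_Verts assms(3) by blast
    then show ?thesis using eqv_lower_side[OF assms(3) False neq] twist_glued_eqv assms(1,2) False eqv_sym by metis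
  qed
qed

lemma gamma_gamma: "gamma ** gamma = mat 1"
  by (simp add: mat2_eq gamma_nth mat_def)

lemma closed_gamma_piece: "closed (gamma_piece i)"
proof -
  define R where "R = {x::real^2. if i < 3 then -1 \<le> x$2 \<and> x$2 \<le> 1 else if i < 6 then 1 \<le> x$2 else x$2 \<le> -1}"
  have "closed {x::real^2. -1 \<le> x$2 \<and> x$2 \<le> 1}" "closed {x::real^2. 1 \<le> x$2}" "closed {x::real^2. x$2 \<le> -1}"
    by (intro closed_Collect_conj closed_Collect_le continuous_intros)+
  then have "closed R" unfolding R_def by (cases "i < 3"; cases "i < 6") simp_all
  moreover have "closed ((\<lambda>u. gamma *v u + gamma_offset i) -` Oct)"
    by (rule closed_vimage[OF closed_Oct]) (intro continuous_intros linear_continuous_on matrix_vector_mul_bounded_linear)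
  moreover have "gamma_piece i = Oct \<inter> R \<inter> (\<lambda>u. gamma *v u + gamma_offset i) -` Oct"
    unfolding gamma_piece_def R_def by auto
  ultimately show ?thesis using closed_Oct by (metis closed_Int)
qed

context octagonal_surface
begin

lemma gamma_automorphism_exists:
  "\<exists>f. affine_automorphism V gamma f \<and> (\<forall>p\<in>cls ` Oct. f (f p) = p) \<and> (\<forall>x y. twist x y \<longrightarrow> f (cls x) = cls y)"
proof -
  have tw: "twist x (gamma *v x + gamma_offset i)" if "i < 9" "x \<in> gamma_piece i" for i x
    using that unfolding twist_def by blast
  have "(\<Union>i\<in>{..<9}. gamma_piece i) = Oct"
  proof
    show "(\<Union>i\<in>{..<9}. gamma_piece i) \<subseteq> Oct" by (auto simp: gamma_piece_def)
    show "Oct \<subseteq> (\<Union>i\<in>{..<9}. gamma_piece i)" using twist_ex unfolding twist_def by blast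
  qed
  moreover have "gamma *v x + gamma_offset i \<in> Oct" if "x \<in> gamma_piece i" for i x
    using that by (simp add: gamma_piece_def del: mult_vec2_nth)
  ultimately obtain f where f: "piecewise_affine {..<9} gamma_piece gamma_offset gamma f"
    using piecewise_affine_exists[of "{..<9}" gamma_piece gamma gamma_offset, OF finite_lessThan _ closed_gamma_piece]
      twist_eqv[OF tw tw] by (auto simp del: mult_vec2_nth)
  have fx: "f (cls x) = cls y" if "twist x y" for x y
    using that f unfolding twist_def piecewise_affine_def by auto
  have ff: "f (f p) = p" if p: "p \<in> cls ` Oct" for p
  proof -
    obtain x where x: "p = cls x" "x \<in> Oct" using p by (rule imageE)
    obtain y where y: "twist x y" using twist_ex[OF x(2)] by blast
    show ?thesis unfolding x(1) fx[OF y] fx[OF twist_sym[OF y]] ..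
  qed
  have fV: "f ` cls ` Verts = cls ` Verts"
  proof -
    have "f p \<in> cls ` Verts" if "p \<in> cls ` Verts" for p
    proof -
      obtain x where x: "p = cls x" "x \<in> Verts" using \<open>p \<in> cls ` Verts\<close> by (rule imageE)
      obtain y where y: "twist x y" using twist_ex x(2) Verts_subset by blast
      show ?thesis unfolding x(1) fx[OF y] using twist_Verts[OF y x(2)] by (rule imageI)
    qed
    moreover have "cls ` Verts \<subseteq> cls ` Oct" using Verts_subset by (rule image_mono)
    moreover have "p \<in> f ` cls ` Verts" if "p \<in> cls ` Verts" for p
      using calculation ff that by (metis imageI subsetD)
    ultimately show ?thesis by (intro equalityI subsetI) (auto simp del: image_image)
  qed
  have "affine_automorphism V gamma f"
    using affine_automorphismI[OF f f ff ff fV] gamma_gamma unfolding invertible_def by blast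
  then show ?thesis using ff fx by blast
qed

end

section \<open>An automorphism with derivative 1 fixes the sides\<close>

context octagonal_surface
begin

text \<open>Used for the top side, to compare its image under an automorphism with straight paths.\<close>

lemma straight_traj_on:
  assumes "\<And>t. t \<in> I \<Longrightarrow> m + t *\<^sub>R a \<in> Oct - Verts"
  shows "traj_on I a (\<lambda>t. cls (m + t *\<^sub>R a))"
  unfolding traj_on_def
proof (intro ballI conjI)
  fix t assume t: "t \<in> I"
  show "cls (m + t *\<^sub>R a) \<in> surface V - singular V" using assms[OF t] surface_regular by blast
  show "\<exists>\<epsilon>>0. \<forall>s. \<bar>s\<bar> < \<epsilon> \<and> t + s \<in> I \<longrightarrow> shifted V (cls (m + t *\<^sub>R a)) (\<rho> *\<^sub>R (s *\<^sub>R a)) (cls (m + (t + s) *\<^sub>R a))"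
  proof (intro exI[of _ 1] conjI allI impI)
    fix s :: real assume s: "\<bar>s\<bar> < 1 \<and> t + s \<in> I"
    have e: "m + (t + s) *\<^sub>R a = m + t *\<^sub>R a + s *\<^sub>R a" by (simp add: algebra_simps)
    show "shifted V (cls (m + t *\<^sub>R a)) (\<rho> *\<^sub>R (s *\<^sub>R a)) (cls (m + (t + s) *\<^sub>R a))"
      unfolding e using assms[OF t] assms[of "t + s"] s e by (subst shifted_eq) auto
  qed simp
qed

lemma cls_Verts: "u \<in> Verts \<Longrightarrow> v \<in> Verts \<Longrightarrow> cls u = cls v"
  using Verts_subset by (intro iffD2[OF cls_eq_iff]) (auto simp: eqv_def)

text \<open>A compact set without vertices has a closed image in the surface: gluing adds only translates of its
intersections with the sides.\<close>

lemma closed_saturation: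
  assumes K: "closed K" "K \<subseteq> Oct" "K \<inter> Verts = {}"
  shows "closed {u \<in> Oct. cls u \<in> cls ` K}"
proof -
  have "{u \<in> Oct. cls u \<in> cls ` K} = K \<union> (\<Union>j\<in>{..<8}. (\<lambda>u. glue_vec j + u) ` (K \<inter> Side j))"
  proof (intro equalityI subsetI)
    fix u assume "u \<in> {u \<in> Oct. cls u \<in> cls ` K}"
    then obtain k where k: "u \<in> Oct" "k \<in> K" "cls k = cls u" by force
    then have "eqv k u" using K(2) cls_eq_iff by blast
    then consider "u = k" | j where "k \<in> Side j" "u = k + glue_vec j" using k(2) K(3) unfolding eqv_def by blast
    then show "u \<in> K \<union> (\<Union>j\<in>{..<8}. (\<lambda>u. glue_vec j + u) ` (K \<inter> Side j))"
    proof cases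
      case (2 j)
      then have "k \<in> Side (j mod 8)" "u = glue_vec (j mod 8) + k" using Side_mod[of j] glue_vec_mod[of j] by (simp_all add: add.commute)
      then show ?thesis using k(2) mod8_less[of j] by auto
    qed (use k in blast)
  next
    fix u assume u: "u \<in> K \<union> (\<Union>j\<in>{..<8}. (\<lambda>u. glue_vec j + u) ` (K \<inter> Side j))"
    have "\<exists>k\<in>K. eqv k u" using u by (auto simp: eqv_def add.commute)
    then obtain k where "k \<in> K" "eqv k u" by blast
    then have "u \<in> Oct" "cls k = cls u" using K(2) eqv_Oct cls_eq_iff by blast+
    then show "u \<in> {u \<in> Oct. cls u \<in> cls ` K}" using imageI[OF \<open>k \<in> K\<close>, of cls] by simp
  qed
  then show ?thesis using K closed_Side by (auto intro!: closed_Un closed_UN closed_translation closed_Int)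
qed

text \<open>An automorphism maps the singular point to itself and is continuous there, so points close to a
vertex have images close to the singular point. These stay away from the image of a compact set
without vertices.\<close>

lemma no_singular_limit:
  assumes h: "affine_automorphism V M h" and v: "v \<in> Verts"
    and K: "closed K" "K \<subseteq> Oct" "K \<inter> Verts = {}"
    and near: "\<And>\<epsilon>. \<epsilon> > 0 \<Longrightarrow> \<exists>u\<in>Oct. dist u v < \<epsilon> \<and> h (cls u) \<in> cls ` K"
  shows False
proof -
  note hs = affine_automorphism_surface[OF h]
  define U where "U = cls ` Oct - cls ` K"
  have "Oct - {u \<in> Oct. cls u \<in> cls ` K} = {u \<in> Oct. cls u \<in> U}" by (auto simp: U_def)
  moreover have "openin (top_of_set Oct) (Oct - {u \<in> Oct. cls u \<in> cls ` K})"
    using closed_saturation[OF K] openin_closedin_eq[of "top_of_set Oct"] closedin_closed_subset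
    by (intro openin_diff) (auto intro: closed_subset)
  ultimately have "openin (surface_topology V) U" unfolding openin_surface by (auto simp: U_def)
  then have "openin (surface_topology V) {p \<in> cls ` Oct. h p \<in> U}"
    using hs(4) unfolding continuous_map_def by simp
  then have op: "openin (top_of_set Oct) {u \<in> Oct. h (cls u) \<in> U}"
    unfolding openin_surface by (simp cong: conj_cong)
  have "h (cls v) \<in> h ` cls ` Verts" using v by blast
  then have "h (cls v) \<in> cls ` Verts" using hs(3) by simp
  then obtain v' where v': "h (cls v) = cls v'" "v' \<in> Verts" by (rule imageE)
  have "cls v' \<notin> cls ` K"
  proof
    assume "cls v' \<in> cls ` K"
    then obtain k where "cls v' = cls k" "k \<in> K" by (rule imageE)
    then show False using K v'(2) Verts_subset cls_eq_iff eqv_Verts by (metis IntI empty_iff subsetD)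
  qed
  then have "h (cls v) \<in> U" using v' Verts_subset unfolding U_def by auto
  then have "v \<in> {u \<in> Oct. h (cls u) \<in> U}" using v Verts_subset by blast
  then obtain \<epsilon> where "\<epsilon> > 0" "\<And>u. u \<in> Oct \<Longrightarrow> dist u v < \<epsilon> \<Longrightarrow> h (cls u) \<in> U"
    using op unfolding openin_euclidean_subtopology_iff by blast
  then show False using near[of \<epsilon>] by (auto simp: U_def)
qed

text \<open>The image of the open top side is a horizontal path of length 2 which tends to the singular point at
both ends. Let \<open>z\<close> be the image of the midpoint. If \<open>z\<close> is not on a horizontal side, then one can
move by 1 from \<open>z\<close>, towards the vertical axis, without meeting a vertex, contrary to the behaviour
at the end. So \<open>z\<close> may be taken on the top side, and if it were not the midpoint then the path would
meet a vertex too early.\<close>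

lemma identity_derivative_top:
  assumes h: "affine_automorphism V (mat 1) h" and x: "x \<in> Side 0"
  shows "h (cls x) = cls x"
proof (cases "x \<in> Verts")
  case True
  have "h (cls x) \<in> h ` cls ` Verts" using True by blast
  then have "h (cls x) \<in> cls ` Verts" using affine_automorphism_surface(3)[OF h] by simp
  then obtain v where "h (cls x) = cls v" "v \<in> Verts" by (rule imageE)
  then show ?thesis using cls_Verts[OF _ True] by simp
next
  case False
  define m :: "real^2" where "m = vector [0, sg]"
  define e :: "real^2" where "e = vector [1, 0]"
  let ?I = "{-1<..<1::real}"
  have sb: "sg > 2" using sg_bounds by simp
  have inside: "m + t *\<^sub>R e \<in> Oct - Verts" if "t \<in> ?I" for t
  proof -
    have "\<bar>t\<bar> \<noteq> 1" using that by auto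
    then show ?thesis using that sb by (simp add: m_def e_def mem_Oct' mem_Verts)
  qed
  have ends: "m + d *\<^sub>R e \<in> Verts" if "d = 1 \<or> d = -1" for d
    using that sb by (auto simp: m_def e_def mem_Verts)
  have tr: "traj_on ?I e (h \<circ> (\<lambda>t. cls (m + t *\<^sub>R e)))"
    using traj_on_automorphism[OF straight_traj_on[of ?I m e] h] inside by simp
  then obtain z where z: "z \<in> Oct - Verts" "h (cls (m + 0 *\<^sub>R e)) = cls z"
    using traj_on_regular[OF tr, of 0] by auto
  have straight: "h (cls (m + t *\<^sub>R e)) = cls (z' + t *\<^sub>R e)"
    if "z' \<in> Oct" "h (cls (m + 0 *\<^sub>R e)) = cls z'" "t \<in> ?I" "z' + t *\<^sub>R e \<in> Oct" for t z'
    using traj_straight[OF tr _ _ that(3), of 0 z' t] that by (simp add: convex_real_interval)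
  \<comment> \<open>the image of the midpoint cannot be followed by a full half side that avoids the vertices\<close>
  have avoid: False if d: "d = 1 \<or> d = -1" and seg: "\<And>s. 0 \<le> s \<Longrightarrow> s \<le> 1 \<Longrightarrow> z + (s * d) *\<^sub>R e \<in> Oct - Verts" for d
  proof (rule no_singular_limit[OF h ends[OF d], where K = "closed_segment z (z + d *\<^sub>R e)"])
    have sub: "closed_segment z (z + d *\<^sub>R e) = (\<lambda>s. z + (s * d) *\<^sub>R e) ` {0..1}"
      unfolding closed_segment_def by (auto simp: algebra_simps image_iff)
    show "closed (closed_segment z (z + d *\<^sub>R e))" by simp
    show "closed_segment z (z + d *\<^sub>R e) \<subseteq> Oct" unfolding sub using seg by auto
    show "closed_segment z (z + d *\<^sub>R e) \<inter> Verts = {}" unfolding sub using seg by auto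
    fix \<epsilon> :: real assume eps: "0 < \<epsilon>"
    define s where "s = 1 - min (1/2) (\<epsilon> / 2)"
    have s: "0 \<le> s" "s < 1" "1 - s < \<epsilon>" using eps by (auto simp: s_def min_def)
    have sd: "s * d \<in> ?I" using s d by auto
    have "dist (m + (s * d) *\<^sub>R e) (m + d *\<^sub>R e) = \<bar>s * d - d\<bar> * norm e"
      by (simp add: dist_norm scaleR_left_diff_distrib[symmetric])
    also have "norm e = 1" unfolding e_def by (simp add: norm_eq_sqrt_inner inner2)
    also have "\<bar>s * d - d\<bar> * 1 < \<epsilon>" using s d by auto
    finally have "dist (m + (s * d) *\<^sub>R e) (m + d *\<^sub>R e) < \<epsilon>" .
    moreover have "h (cls (m + (s * d) *\<^sub>R e)) = cls (z + (s * d) *\<^sub>R e)"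
      using straight[of z "s * d"] z sd seg[of s] s by simp
    moreover have "cls (z + (s * d) *\<^sub>R e) \<in> cls ` (\<lambda>s. z + (s * d) *\<^sub>R e) ` {0..1}"
      using s by (intro imageI) simp
    ultimately show "\<exists>u\<in>Oct. dist u (m + d *\<^sub>R e) < \<epsilon> \<and> h (cls u) \<in> cls ` closed_segment z (z + d *\<^sub>R e)"
      using inside[OF sd] s unfolding sub by (intro bexI[of _ "m + (s * d) *\<^sub>R e"]) auto
  qed
  have zO: "z \<in> Oct" "z \<notin> Verts" using z by auto
  note b = zO(1)[unfolded mem_Oct']
  have zs: "z$2 = sg \<or> z$2 = -sg"
  proof (rule ccontr)
    assume n: "\<not> (z$2 = sg \<or> z$2 = -sg)"
    have z2: "\<bar>z$2\<bar> < sg" using n b by linarith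
    \<comment> \<open>towards the vertical axis\<close>
    define d :: real where "d = (if z$1 \<le> 0 then 1 else -1)"
    show False
    proof (rule avoid[of d])
      show "d = 1 \<or> d = -1" by (simp add: d_def)
      fix s :: real assume s: "0 \<le> s" "s \<le> 1"
      have O: "z + (s * d) *\<^sub>R e \<in> Oct"
        using b s z2 sb unfolding mem_Oct' by (simp add: e_def d_def)
      have "z + (s * d) *\<^sub>R e \<notin> Verts"
      proof
        assume V: "z + (s * d) *\<^sub>R e \<in> Verts"
        then have V': "\<bar>z$1 + s * d\<bar> = sg" "\<bar>z$2\<bar> = 1" using z2 sb by (auto simp: mem_Verts e_def)
        have "s = 0" using V' s b sb unfolding d_def by (auto split: if_splits)
        then show False using V zO by simp
      qed
      then show "z + (s * d) *\<^sub>R e \<in> Oct - Verts" using O by blast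
    qed
  qed
  obtain z' where z': "z' \<in> Oct" "z' \<notin> Verts" "cls z' = cls z" "z'$2 = sg"
  proof (cases "z$2 = sg")
    case True then show ?thesis using that[of z] zO by simp
  next
    case F: False
    then have "z \<in> Side 4" using zs zO(1) unfolding Side_def by (simp add: side_normal_inner_eq)
    then have eq: "eqv z (z + glue_vec 4)" by (auto simp: eqv_def)
    have "(z + glue_vec 4)$2 = sg" using zs F by (simp add: glue_vec_simps)
    then show ?thesis using that[of "z + glue_vec 4"] eq zO eqv_Oct eqv_Verts cls_eq_iff by metis
  qed
  have z'1: "\<bar>z'$1\<bar> < 1" using z'(1,2,4) sb VertsI[of z'] unfolding mem_Oct' by (cases "\<bar>z'$1\<bar> = 1") (auto simp: abs_if split: if_splits)
  have hz': "h (cls (m + 0 *\<^sub>R e)) = cls z'" using z z' by simp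
  have z'0: "z'$1 = 0"
  proof (rule ccontr)
    assume n: "z'$1 \<noteq> 0"
    \<comment> \<open>the time at which the nearer end of the top side would be reached\<close>
    define t where "t = (if z'$1 > 0 then 1 - z'$1 else -1 - z'$1)"
    have t: "t \<in> ?I" using n z'1 by (auto simp: t_def)
    have V: "z' + t *\<^sub>R e \<in> Verts" using z'(4) sb by (auto simp: t_def e_def mem_Verts)
    then have "h (cls (m + t *\<^sub>R e)) = cls (z' + t *\<^sub>R e)"
      using straight[OF z'(1) hz' t] Verts_subset by blast
    moreover obtain u where "u \<in> Oct - Verts" "h (cls (m + t *\<^sub>R e)) = cls u"
      using traj_on_regular[OF tr t] by auto
    ultimately show False using V Verts_subset cls_eq_iff eqv_Verts by (metis DiffE subsetD)
  qed
  have z'm: "z' = m" using z'0 z'(4) by (simp add: vec2_eq m_def)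
  have "x = m + x$1 *\<^sub>R e" "x$1 \<in> ?I" using mem_open_Side[OF False] x by (auto simp: vec2_eq m_def e_def)
  then show ?thesis using straight[OF z'(1) hz', of "x$1"] z'm inside by (metis DiffD1)
qed

text \<open>Conjugation by the rotation that takes one side to the next reduces every side to the top side.\<close>

lemma identity_derivative_sides:
  assumes "affine_automorphism V (mat 1) h" and "x \<in> Side j"
  shows "h (cls x) = cls x"
  using assms
proof (induction j arbitrary: h x)
  case 0 then show ?case by (rule identity_derivative_top)
next
  case (Suc j)
  obtain f g \<pi> where fg: "symmetry_pair rot f rot_inv g \<pi>" "\<And>x. x \<in> Oct \<Longrightarrow> f (cls x) = cls (rot *v x)"
    using rot_symmetry by blast
  note sp = fg(1)[unfolded symmetry_pair_def]
  have af: "affine_automorphism V rot f" "affine_automorphism V rot_inv g" using sp by simp_all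
  have inv: "f (g p) = p" if "p \<in> cls ` Oct" for p using sp that by metis
  have "affine_automorphism V (rot_inv ** (mat 1 ** rot)) (g \<circ> (h \<circ> f))"
    using af Suc.prems(1) by (intro affine_automorphism_compose)
  moreover have "rot_inv ** (mat 1 ** rot) = mat 1" using sp by simp
  ultimately have h': "affine_automorphism V (mat 1) (g \<circ> (h \<circ> f))" by (simp only:)
  define y where "y = rot_inv *v x"
  have rr: "rot *v y = x" unfolding y_def using sp by (simp add: matrix_vector_mul_assoc del: mult_vec2_nth)
  have y: "y \<in> Side j"
  proof -
    have in1: "side_normal k \<bullet> y = side_normal (Suc k) \<bullet> x" for k
      unfolding y_def rot_side_normal(1)[symmetric] by (simp add: inner2 rot_nth algebra_simps)
    have "x \<in> Oct" using Suc.prems(2) Side_subset by blast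
    then have "y \<in> Oct" unfolding Oct_def mem_Collect_eq in1 by simp
    then show ?thesis using Suc.prems(2) in1[of j] unfolding Side_def by simp
  qed
  have yO: "y \<in> Oct" using y Side_subset by blast
  have "g (h (f (cls y))) = cls y" using Suc.IH[OF h' y] by simp
  then have "f (g (h (cls x))) = f (cls y)" using fg(2)[OF yO] rr by simp
  moreover have "h (cls x) \<in> cls ` Oct"
  proof -
    have "cls x \<in> cls ` Oct" using Suc.prems(2) Side_subset by blast
    then show ?thesis using affine_automorphism_surface(2)[OF Suc.prems(1)] by blast
  qed
  ultimately show ?case using inv fg(2)[OF yO] rr by simp
qed

lemma identity_derivative_label_side:
  assumes "affine_automorphism V (mat 1) h" shows "h ` label_side L = label_side L"
proof -
  have "h p = p" if p: "p \<in> label_side L" for p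
  proof -
    obtain j x where "x \<in> Side j" "p = cls x" using p unfolding label_side_def by blast
    then show ?thesis using identity_derivative_sides[OF assms] by simp
  qed
  then show ?thesis by simp
qed

end

section \<open>The images of the sides under the automorphism with derivative gamma\<close>

text \<open>Linear equations of the images of the sides. For \<open>L\<close> one of B, C, D the line runs from the vertex
\<open>vertex 7\<close>, \<open>vertex 6\<close>, \<open>vertex 5\<close>, respectively, to the midpoint of the side 1, 2, 3 labelled \<open>L\<close>. The image of
the side labelled \<open>L\<close> is this segment continued beyond the midpoint in the glued copy of the octagon,
where the half turn about the centre gives the equation \<open>gamma_line L (- u) = 0\<close>. As side A is mapped
to itself, its line is a dummy, chosen without zeros.\<close>

fun gamma_line :: "letter \<Rightarrow> real^2 \<Rightarrow> real" where
  "gamma_line LA u = 1"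
| "gamma_line LB u = (2 * sg + 1) * (u$2 - 1) - (u$1 + sg)"
| "gamma_line LC u = 2 * sg * u$2 - u$1 + sg"
| "gamma_line LD u = (2 * sg - 1) * (u$2 + sg) - (u$1 + 1)"

definition on_gamma_side :: "letter \<Rightarrow> real^2 \<Rightarrow> bool" where
  "on_gamma_side L u \<longleftrightarrow> (if L = LA then u \<in> Side 0 \<or> u \<in> Side 4 else gamma_line L u = 0 \<or> gamma_line L (- u) = 0)"

text \<open>The part of the line in the octagon lies in the domain of a single branch of the automorphism, which
takes it to half of a side.\<close>

lemma gamma_line_twist:
  assumes u: "u \<in> Oct" "gamma_line L u = 0"
  shows "\<exists>x j. twist u x \<and> x \<in> Side j \<and> side_label j = L"
proof -
  note b = u(1)[unfolded mem_Oct']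
  have sb: "sg > 2" using sg_bounds by simp
  show ?thesis
  proof (cases L)
    case LA then show ?thesis using u by simp
  next
    case LB
    then have u1: "u$1 = 2 * (sg * u$2) + u$2 - 3 * sg - 1" using u(2) by (simp add: algebra_simps)
    have "(2 * sg + 1) * (u$2 - 1) \<ge> 0" using u1 b by (simp add: algebra_simps)
    then have u2: "1 \<le> u$2" using sb by (simp add: zero_le_mult_iff)
    define x :: "real^2" where "x = vector [sg + 1 - u$2, u$2]"
    have x: "x \<in> Side 1" using u2 b by (simp add: mem_Side x_def)
    have "twist u x" by (rule twistI(4)) (use u u2 x Side_subset u1 in \<open>auto simp: x_def\<close>)
    then show ?thesis using x LB side_label_simps by blast
  next
    case LC
    then have u1: "u$1 = 2 * (sg * u$2) + sg" using u(2) by simp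
    have "2 * sg * (u$2 + 1) \<ge> 0" "2 * sg * u$2 \<le> 0" using u1 b by (simp_all add: algebra_simps)
    then have u2: "-1 \<le> u$2" "u$2 \<le> 0" using sb by (simp_all add: zero_le_mult_iff mult_le_0_iff)
    define x :: "real^2" where "x = vector [- sg, u$2]"
    have x: "x \<in> Side 6" using u2 by (simp add: mem_Side x_def)
    have "twist u x" by (rule twistI(2)) (use u u2 x Side_subset u1 in \<open>auto simp: x_def\<close>)
    then show ?thesis using x LC side_label_simps by blast
  next
    case LD
    then have u1: "u$1 = 2 * (sg * u$2) - u$2 + 3 * sg + 1" using u(2) sg_sq by (simp add: algebra_simps)
    have "(2 * sg - 2) * (u$2 + sg) \<le> (sg - 1) * sg"
      using u1 b sg_sq by (simp add: algebra_simps)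
    then have "(sg - 1) * (2 * (u$2 + sg)) \<le> (sg - 1) * sg" by (simp add: algebra_simps)
    then have "2 * (u$2 + sg) \<le> sg" using sb by (simp only: mult_le_cancel_left_pos diff_gt_0_iff_gt)
    then have "2 * u$2 \<le> - sg" by (simp add: distrib_left)
    then have u2: "u$2 \<le> -1" using sb by simp
    define x :: "real^2" where "x = vector [u$2, u$2 + sg + 1]"
    have x: "x \<in> Side 7" using u2 b \<open>2 * (u$2 + sg) \<le> sg\<close> by (simp add: mem_Side x_def)
    have "twist u x" by (rule twistI(8)) (use u u2 x Side_subset u1 in \<open>auto simp: x_def\<close>)
    then show ?thesis using x LD side_label_simps by blast
  qed
qed

lemma side_label_cases: "side_label j = LA \<longleftrightarrow> j mod 4 = 0" "side_label j = LB \<longleftrightarrow> j mod 4 = 1"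
  "side_label j = LC \<longleftrightarrow> j mod 4 = 2" "side_label j = LD \<longleftrightarrow> j mod 4 = 3"
proof -
  have "j mod 4 = 0 \<or> j mod 4 = 1 \<or> j mod 4 = 2 \<or> j mod 4 = 3" by linarith
  then show "side_label j = LA \<longleftrightarrow> j mod 4 = 0" "side_label j = LB \<longleftrightarrow> j mod 4 = 1"
    "side_label j = LC \<longleftrightarrow> j mod 4 = 2" "side_label j = LD \<longleftrightarrow> j mod 4 = 3"
    by (auto simp: side_label_def)
qed

lemma label_side_index:
  assumes "side_label j = L" "x \<in> Side j"
  shows "\<exists>k\<in>{case L of LA \<Rightarrow> 0 | LB \<Rightarrow> 1 | LC \<Rightarrow> 2 | LD \<Rightarrow> 3}. x \<in> Side k \<or> - x \<in> Side k"
proof -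
  let ?k = "case L of LA \<Rightarrow> 0 | LB \<Rightarrow> 1 | LC \<Rightarrow> 2 | LD \<Rightarrow> (3::nat)"
  have k: "j mod 4 = ?k" using assms(1) side_label_cases[of j] by (cases L) auto
  have "j mod 8 = j mod 4 \<or> j mod 8 = j mod 4 + 4"
    using mod8_cases[of j] mod_mod_cancel[of 4 8 j] by auto
  then show ?thesis
  proof
    assume "j mod 8 = j mod 4"
    then show ?thesis using assms(2) Side_mod[of j] k by simp
  next
    assume e: "j mod 8 = j mod 4 + 4"
    have "x \<in> Side (?k + 4)" using assms(2) unfolding Side_mod[of j] e k .
    then have "side_normal (?k + 4) \<bullet> x = sg" "x \<in> Oct" by (simp_all add: Side_def)
    then have "- x \<in> Side ?k" by (simp add: Side_def side_normal_add4 Oct_uminus)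
    then show ?thesis by simp
  qed
qed

lemma gamma_line_side:
  assumes t: "twist x y" and x: "x \<in> Side (case L of LA \<Rightarrow> 0 | LB \<Rightarrow> 1 | LC \<Rightarrow> 2 | LD \<Rightarrow> 3)" "x \<notin> Verts"
  shows "on_gamma_side L y"
proof -
  have O: "y \<in> Oct" using t by (auto simp: twist_iff)
  note b = O[unfolded mem_Oct']
  have sb: "sg > 2" using sg_bounds by simp
  note op = mem_open_Side[OF x(2)]
  show ?thesis
  proof (cases L)
    case LA
    then have xx: "x$2 = sg" "-1 < x$1" "x$1 < 1" using x(1) op by simp_all
    then have s: "sg * x$2 = 2 * sg + 1" using sg_sq by simp
    have gt: "x$2 > 1" using xx sb by simp
    have "y$2 = sg" using twist_upper_cases[OF t gt] b xx s sb by (elim disjE conjE) simp_all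
    then have "y \<in> Side 0" using O by (simp add: Side_def side_normal_inner_eq)
    then show ?thesis using LA by (simp add: on_gamma_side_def)
  next
    case LB
    then have xx: "x$1 = sg + 1 - x$2" "1 < x$2" "x$2 < sg" using x(1) op by simp_all
    have lt: "sg * x$2 < 2 * sg + 1" using mult_strict_left_mono[OF xx(3), of sg] sb sg_sq by simp
    from twist_upper_cases[OF t xx(2)] show ?thesis
    proof (elim disjE conjE)
      assume y: "y$2 = x$2" "y$1 = - x$1 + 2 * (sg * x$2) - 2 * sg"
      have "gamma_line LB y = 0" unfolding gamma_line.simps y xx(1) by (simp add: algebra_simps)
      then show ?thesis using LB by (simp add: on_gamma_side_def)
    next
      assume y: "y$2 = x$2 - sg - 1" "y$1 = - x$1 + 2 * (sg * x$2) - 3 * sg - 1"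
      have "gamma_line LB (- y) = 0" unfolding gamma_line.simps vector_uminus_component y xx(1)
        using sg_sq by (simp add: algebra_simps)
      then show ?thesis using LB by (simp add: on_gamma_side_def)
    next
      assume "y$2 = x$2" "y$1 = - x$1 + 2 * (sg * x$2) - 4 * sg - 2"
      then show ?thesis using lt b xx by simp
    qed
  next
    case LC
    then have xx: "x$1 = sg" "-1 < x$2" "x$2 < 1" using x(1) op by simp_all
    have lt: "sg * x$2 < sg" using mult_strict_left_mono[OF xx(3), of sg] sb by simp
    have y2: "y$2 = x$2" and y1: "y$1 = - x$1 + 2 * (sg * x$2) + 2 * sg \<or> y$1 = - x$1 + 2 * (sg * x$2) \<or> y$1 = - x$1 + 2 * (sg * x$2) - 2 * sg"
      using t xx unfolding twist_iff by auto
    from y1 show ?thesis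
    proof (elim disjE)
      assume y1: "y$1 = - x$1 + 2 * (sg * x$2) + 2 * sg"
      have "gamma_line LC y = 0" unfolding gamma_line.simps y1 y2 xx(1) by (simp add: algebra_simps)
      then show ?thesis using LC by (simp add: on_gamma_side_def)
    next
      assume y1: "y$1 = - x$1 + 2 * (sg * x$2)"
      have "gamma_line LC (- y) = 0" unfolding gamma_line.simps vector_uminus_component y1 y2 xx(1) by (simp add: algebra_simps)
      then show ?thesis using LC by (simp add: on_gamma_side_def)
    next
      assume "y$1 = - x$1 + 2 * (sg * x$2) - 2 * sg"
      then show ?thesis using lt b xx by simp
    qed
  next
    case LD
    then have xx: "x$1 = sg + 1 + x$2" "-sg < x$2" "x$2 < -1" using x(1) op by simp_all
    have lt: "sg * x$2 < - sg" using mult_strict_left_mono[OF xx(3), of sg] sb by simp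
    from twist_lower_cases[OF t xx(3)] show ?thesis
    proof (elim disjE conjE)
      assume "y$2 = x$2" "y$1 = - x$1 + 2 * (sg * x$2) + 2 * sg"
      then show ?thesis using lt b xx by simp
    next
      assume y: "y$2 = x$2 + sg + 1" "y$1 = - x$1 + 2 * (sg * x$2) + 3 * sg + 1"
      have "gamma_line LD (- y) = 0" unfolding gamma_line.simps vector_uminus_component y xx(1)
        using sg_sq by (simp add: algebra_simps)
      then show ?thesis using LD by (simp add: on_gamma_side_def)
    next
      assume y: "y$2 = x$2" "y$1 = - x$1 + 2 * (sg * x$2) + 4 * sg + 2"
      have "gamma_line LD y = 0" unfolding gamma_line.simps y xx(1)
        using sg_sq by (simp add: algebra_simps)
      then show ?thesis using LD by (simp add: on_gamma_side_def)
    qed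
  qed
qed

lemma on_gamma_side_uminus: "on_gamma_side L (- u) \<longleftrightarrow> on_gamma_side L u"
proof -
  have "- u \<in> Side 0 \<longleftrightarrow> u \<in> Side 4" "- u \<in> Side 4 \<longleftrightarrow> u \<in> Side 0"
    by (auto simp: Side_def Oct_uminus side_normal_inner_eq)
  then show ?thesis unfolding on_gamma_side_def by auto
qed

lemma vertex_on_gamma_side: "\<exists>v\<in>Verts. on_gamma_side L v"
proof (cases L)
  case LA then show ?thesis using vertex_in_Side(1)[of 0] by (intro bexI[of _ "vertex 0"]) (simp_all add: on_gamma_side_def Verts_def)
next
  case LB then show ?thesis by (intro bexI[of _ "vertex 7"]) (use sg_bounds in \<open>simp_all add: on_gamma_side_def vertex_simps mem_Verts\<close>)
next
  case LC then show ?thesis by (intro bexI[of _ "vertex 6"]) (use sg_bounds in \<open>simp_all add: on_gamma_side_def vertex_simps mem_Verts\<close>)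
next
  case LD then show ?thesis by (intro bexI[of _ "vertex 5"]) (use sg_bounds in \<open>simp_all add: on_gamma_side_def vertex_simps mem_Verts\<close>)
qed

context octagonal_surface
begin

text \<open>One inclusion follows from the other computation because the automorphism is an involution: a point
is in the image of a side if and only if its image is on the side.\<close>

lemma gamma_label_side:
  assumes f: "\<And>x y. twist x y \<Longrightarrow> f (cls x) = cls y" and ff: "\<And>p. p \<in> cls ` Oct \<Longrightarrow> f (f p) = p"
  shows "p \<in> f ` label_side L \<longleftrightarrow> (\<exists>u\<in>Oct. p = cls u \<and> on_gamma_side L u)"
proof
  assume "p \<in> f ` label_side L"
  then obtain j x where x: "side_label j = L" "x \<in> Side j" "p = f (cls x)" unfolding label_side_def by auto
  then have xO: "x \<in> Oct" using Side_subset by blast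
  obtain y where y: "twist x y" using twist_ex[OF xO] by blast
  have yO: "y \<in> Oct" using y by (simp add: twist_iff)
  show "\<exists>u\<in>Oct. p = cls u \<and> on_gamma_side L u"
  proof (cases "x \<in> Verts")
    case True
    then have "y \<in> Verts" using twist_Verts[OF y] by blast
    then show ?thesis using vertex_on_gamma_side[of L] x(3) f[OF y] cls_Verts Verts_subset by (metis subsetD)
  next
    case False
    have "on_gamma_side L y"
      using label_side_index[OF x(1,2)] gamma_line_side[OF y _ False] gamma_line_side[OF twist_uminus[OF y]] False
      by (auto simp: Verts_uminus on_gamma_side_uminus)
    then show ?thesis using yO x(3) f[OF y] by metis
  qed
next
  assume "\<exists>u\<in>Oct. p = cls u \<and> on_gamma_side L u"
  then obtain u where u: "u \<in> Oct" "p = cls u" "on_gamma_side L u" by blast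
  have "f p \<in> label_side L"
  proof (cases "L = LA")
    case False
    then consider "gamma_line L u = 0" | "gamma_line L (- u) = 0" using u(3) by (auto simp: on_gamma_side_def)
    then obtain x j where x: "twist u x" "x \<in> Side j" "side_label j = L"
    proof cases
      case 1 then show ?thesis using gamma_line_twist u(1) that by blast
    next
      case 2
      then obtain x j where x: "twist (- u) x" "x \<in> Side j" "side_label j = L"
        using gamma_line_twist[of "-u"] u(1) Oct_uminus by blast
      have "twist u (- x)" using twist_uminus[OF x(1)] by simp
      moreover have "- x \<in> Side (j + 4)" using x(2) by (auto simp: Side_def Oct_uminus side_normal_add4)
      moreover have "side_label (j + 4) = L" using x(3) by (simp add: side_label_def)
      ultimately show ?thesis using that by blast
    qed
    then show ?thesis using f[OF x(1)] u(2) unfolding label_side_def by auto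
  next
    case True
    obtain x where x: "twist u x" using twist_ex[OF u(1)] by blast
    have fp: "f p = cls x" using f[OF x] u(2) by simp
    show ?thesis
    proof (cases "u \<in> Verts")
      case V: True
      have "cls x = cls (vertex 0)" using cls_Verts[OF twist_Verts[OF x V], of "vertex 0"] by (simp add: Verts_def)
      moreover have "side_label 0 = L" using True by (simp add: side_label_def)
      ultimately show ?thesis using vertex_in_Side(1)[of 0] fp unfolding label_side_def by blast
    next
      case V: False
      have "u \<in> Side 0 \<or> - u \<in> Side 0" using u(3) True
        by (auto simp: on_gamma_side_def Side_def Oct_uminus side_normal_inner_eq)
      then have "on_gamma_side LA x"
        using gamma_line_side[OF x, of LA] gamma_line_side[OF twist_uminus[OF x], of LA] V
        by (auto simp: Verts_uminus on_gamma_side_uminus)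
      then have "x \<in> Side 0 \<or> x \<in> Side 4" by (simp add: on_gamma_side_def)
      moreover have "side_label 0 = L" "side_label 4 = L" using True by (simp_all add: side_label_def)
      ultimately show ?thesis using fp unfolding label_side_def by blast
    qed
  qed
  moreover have "f (f p) = p" using ff u(1,2) by blast
  ultimately show "p \<in> f ` label_side L" by (metis imageI)
qed

end

section \<open>Chords of the octagon in the first sector\<close>

text \<open>All products by \<open>sg\<close> that occur below are of the form \<open>sg * p\<close> with \<open>p\<close> a coordinate of a boundary
point. With these bounds they can be treated as new variables in linear arithmetic.\<close>

lemma sg_mult_bounds:
  assumes "q = sg * p"
  shows "p < 1 \<longrightarrow> q < sg" "1 < p \<longrightarrow> sg < q" "-1 < p \<longrightarrow> - sg < q" "p < -1 \<longrightarrow> q < - sg"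
    "p < sg \<longrightarrow> q < 2 * sg + 1" "- sg < p \<longrightarrow> - 2 * sg - 1 < q"
    "p = sg \<longrightarrow> q = 2 * sg + 1" "p = - sg \<longrightarrow> q = - 2 * sg - 1"
proof -
  have s: "0 < sg" using sg_bounds by simp
  note m = mult_strict_left_mono[OF _ s]
  show "p < 1 \<longrightarrow> q < sg" "1 < p \<longrightarrow> sg < q" using m[of p 1] m[of 1 p] unfolding assms mult_1_right by blast+
  show "-1 < p \<longrightarrow> - sg < q" "p < -1 \<longrightarrow> q < - sg" using m[of "-1" p] m[of p "-1"] unfolding assms mult_minus1_right by blast+
  show "p < sg \<longrightarrow> q < 2 * sg + 1" "- sg < p \<longrightarrow> - 2 * sg - 1 < q"
    using m[of p sg] m[of "-sg" p] sg_sq by (simp_all add: assms)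
  show "p = sg \<longrightarrow> q = 2 * sg + 1" "p = - sg \<longrightarrow> q = - 2 * sg - 1" using sg_sq by (simp_all add: assms)
qed

text \<open>The first sector, since \<open>sg\<close> is the cotangent of \<open>pi / 8\<close>.\<close>

definition cone :: "real^2 \<Rightarrow> bool" where
  "cone a \<longleftrightarrow> 0 < a$2 \<and> sg * a$2 < a$1"

lemma cone_side_normal:
  assumes "cone a" shows "0 < side_normal j \<bullet> a \<longleftrightarrow> j mod 8 < 4" "side_normal j \<bullet> a \<noteq> 0"
proof -
  have "1 * a$2 < sg * a$2" using assms sg_bounds unfolding cone_def by (intro mult_strict_right_mono) auto
  then have a: "0 < a$2" "a$2 < a$1" using assms unfolding cone_def by linarith+
  have "j < 8 \<Longrightarrow> (0 < side_normal j \<bullet> a \<longleftrightarrow> j < 4) \<and> side_normal j \<bullet> a \<noteq> 0" for j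
    unfolding less8 using a by (elim disjE) (simp_all add: side_normal_inner zero_less_mult_iff side_normal_inner[unfolded One_nat_def])
  from this[of "j mod 8"] show "0 < side_normal j \<bullet> a \<longleftrightarrow> j mod 8 < 4" "side_normal j \<bullet> a \<noteq> 0" using side_normal_mod[of j] by simp_all
qed

lemma chord_interior:
  assumes a: "cone a" and x: "x \<in> Oct" and y: "x + S *\<^sub>R a \<in> Oct" and s: "0 < s" "s < S"
  shows "x + s *\<^sub>R a \<in> Oct" "x + s *\<^sub>R a \<notin> Side i"
proof -
  have le: "side_normal k \<bullet> x \<le> sg" "side_normal k \<bullet> x + S * (side_normal k \<bullet> a) \<le> sg" for k
    using x y by (auto simp: Oct_def inner_add_right)
  have lt: "side_normal k \<bullet> x + s * (side_normal k \<bullet> a) < sg" for k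
  proof (cases "0 < side_normal k \<bullet> a")
    case True
    then have "s * (side_normal k \<bullet> a) < S * (side_normal k \<bullet> a)" using s by simp
    then show ?thesis using le(2)[of k] by linarith
  next
    case False
    then have "side_normal k \<bullet> a < 0" using cone_side_normal(2)[OF a, of k] by linarith
    then have "s * (side_normal k \<bullet> a) < 0" using s by (simp add: mult_pos_neg)
    then show ?thesis using le(1)[of k] by linarith
  qed
  then show "x + s *\<^sub>R a \<in> Oct" by (auto simp: Oct_def inner_add_right less_imp_le)
  show "x + s *\<^sub>R a \<notin> Side i" using lt[of i] by (auto simp: Side_def inner_add_right)
qed

lemma chord_exit:
  assumes a: "cone a" and x: "x \<in> Side j" "x \<notin> Verts" "4 \<le> j" "j < 8"
  shows "\<exists>S>0. \<exists>k<4. x + S *\<^sub>R a \<in> Side k"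
proof -
  have "a \<noteq> 0" using a by (auto simp: cone_def)
  then obtain S k where S: "0 \<le> S" "x + S *\<^sub>R a \<in> Side k" "0 < side_normal k \<bullet> a"
    using exit_side[of x a] x(1) Side_subset by blast
  have k: "k mod 8 < 4" using S(3) cone_side_normal(1)[OF a] by blast
  have "S \<noteq> 0" using Side_inter[of x j k] x S(2) k by auto
  then show ?thesis using S k Side_mod[of k] by (intro exI[of _ S]) auto
qed

text \<open>The kinds of chords in the first sector: entry sides are 4 to 7, exit sides are 0 to 3.\<close>

definition transition :: "nat \<Rightarrow> nat \<Rightarrow> bool" where
  "transition j k \<longleftrightarrow> (j, k) \<in> {(4, 3), (5, 3), (5, 2), (6, 2), (6, 1), (7, 1), (7, 0)}"

text \<open>The slope of a chord is strictly between 0 and \<open>1 / sg\<close>. Of the sixteen pairs of an entry and an exit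
side, six would need a slope of at least \<open>1 / sg\<close>, and three a slope of at most 0.\<close>

lemma chord_transition:
  assumes a: "cone a" and x: "x \<in> Side j" "x \<notin> Verts" "4 \<le> j" "j < 8"
    and y: "x + S *\<^sub>R a \<in> Side k" "x + S *\<^sub>R a \<notin> Verts" "k < 4" and S: "0 < S"
  shows "transition j k"
proof -
  define z where "z = x + S *\<^sub>R a"
  have d2: "x$2 < z$2" and d1: "sg * z$2 - sg * x$2 < z$1 - x$1"
  proof -
    show "x$2 < z$2" using S a by (simp add: z_def cone_def)
    have "S * (sg * a$2) < S * a$1" using S a by (simp add: cone_def)
    then show "sg * z$2 - sg * x$2 < z$1 - x$1" by (simp add: z_def algebra_simps)
  qed
  have sb: "sg > 2" using sg_bounds by simp
  define p where "p = sg * x$2"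
  define q where "q = sg * z$2"
  note bp = sg_mult_bounds[OF p_def] and bq = sg_mult_bounds[OF q_def]
  note d1 = d1[folded p_def q_def]
  note ox = mem_open_Side[OF x(2)]
  note oz = mem_open_Side[OF y(2)[folded z_def]]
  have zk: "z \<in> Side k" using y(1) z_def by simp
  have "j = 4 \<or> j = 5 \<or> j = 6 \<or> j = 7" "k = 0 \<or> k = 1 \<or> k = 2 \<or> k = 3" using x(3,4) y(3) by linarith+
  moreover have "False" if "x \<in> Side 4" "z \<in> Side 0"
    using that[unfolded ox oz] d1 bp bq sb by simp
  moreover have "False" if "x \<in> Side 4" "z \<in> Side 1"
    using that[unfolded ox oz] d1 bp bq sb by simp
  moreover have "False" if "x \<in> Side 4" "z \<in> Side 2"
    using that[unfolded ox oz] d1 bp bq sb by simp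
  moreover have "False" if "x \<in> Side 5" "z \<in> Side 0"
    using that[unfolded ox oz] d1 bp bq sb by simp
  moreover have "False" if "x \<in> Side 5" "z \<in> Side 1"
    using that[unfolded ox oz] d1 bp bq sb by simp
  moreover have "False" if "x \<in> Side 6" "z \<in> Side 0"
    using that[unfolded ox oz] d1 bp bq sb by simp
  moreover have "False" if "x \<in> Side 6" "z \<in> Side 3"
    using that[unfolded ox oz] d2 by simp
  moreover have "False" if "x \<in> Side 7" "z \<in> Side 2"
    using that[unfolded ox oz] d2 by simp
  moreover have "False" if "x \<in> Side 7" "z \<in> Side 3"
    using that[unfolded ox oz] d2 by simp
  ultimately show ?thesis using x(1) zk unfolding transition_def by auto
qed

lemma gamma_line_sign:
  assumes "u \<notin> Verts"
  shows "u \<in> Side 0 \<Longrightarrow> 0 < gamma_line LB u" "u \<in> Side 7 \<Longrightarrow> 0 < gamma_line LB u"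
    "u \<in> Side 2 \<Longrightarrow> gamma_line LB u < 0" "u \<in> Side 3 \<Longrightarrow> gamma_line LB u < 0" "u \<in> Side 4 \<Longrightarrow> gamma_line LB u < 0"
    "u \<in> Side 5 \<Longrightarrow> gamma_line LB u < 0" "u \<in> Side 6 \<Longrightarrow> gamma_line LB u < 0"
    "u \<in> Side 0 \<Longrightarrow> 0 < gamma_line LC u" "u \<in> Side 1 \<Longrightarrow> 0 < gamma_line LC u" "u \<in> Side 6 \<Longrightarrow> 0 < gamma_line LC u"
    "u \<in> Side 7 \<Longrightarrow> 0 < gamma_line LC u" "u \<in> Side 3 \<Longrightarrow> gamma_line LC u < 0"
    "u \<in> Side 4 \<Longrightarrow> gamma_line LC u < 0" "u \<in> Side 5 \<Longrightarrow> gamma_line LC u < 0"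
    "u \<in> Side 0 \<Longrightarrow> 0 < gamma_line LD u" "u \<in> Side 1 \<Longrightarrow> 0 < gamma_line LD u" "u \<in> Side 2 \<Longrightarrow> 0 < gamma_line LD u"
    "u \<in> Side 5 \<Longrightarrow> 0 < gamma_line LD u" "u \<in> Side 6 \<Longrightarrow> 0 < gamma_line LD u" "u \<in> Side 7 \<Longrightarrow> 0 < gamma_line LD u"
    "u \<in> Side 4 \<Longrightarrow> gamma_line LD u < 0"
proof -
  have sb: "sg > 2" using sg_bounds by simp
  have e: "gamma_line LB u = 2 * (sg * u$2) + u$2 - 3 * sg - 1 - u$1" "gamma_line LC u = 2 * (sg * u$2) - u$1 + sg"
    "gamma_line LD u = 2 * (sg * u$2) - u$2 + 3 * sg + 1 - u$1"
    using sg_sq by (simp_all add: algebra_simps)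
  note o = mem_open_Side[OF assms]
  define q where "q = sg * u$2"
  note f = sb sg_mult_bounds[OF q_def]
  show "u \<in> Side 0 \<Longrightarrow> 0 < gamma_line LB u" "u \<in> Side 7 \<Longrightarrow> 0 < gamma_line LB u"
    "u \<in> Side 2 \<Longrightarrow> gamma_line LB u < 0" "u \<in> Side 3 \<Longrightarrow> gamma_line LB u < 0" "u \<in> Side 4 \<Longrightarrow> gamma_line LB u < 0"
    "u \<in> Side 5 \<Longrightarrow> gamma_line LB u < 0" "u \<in> Side 6 \<Longrightarrow> gamma_line LB u < 0"
    "u \<in> Side 0 \<Longrightarrow> 0 < gamma_line LC u" "u \<in> Side 1 \<Longrightarrow> 0 < gamma_line LC u" "u \<in> Side 6 \<Longrightarrow> 0 < gamma_line LC u"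
    "u \<in> Side 7 \<Longrightarrow> 0 < gamma_line LC u" "u \<in> Side 3 \<Longrightarrow> gamma_line LC u < 0"
    "u \<in> Side 4 \<Longrightarrow> gamma_line LC u < 0" "u \<in> Side 5 \<Longrightarrow> gamma_line LC u < 0"
    "u \<in> Side 0 \<Longrightarrow> 0 < gamma_line LD u" "u \<in> Side 1 \<Longrightarrow> 0 < gamma_line LD u" "u \<in> Side 2 \<Longrightarrow> 0 < gamma_line LD u"
    "u \<in> Side 5 \<Longrightarrow> 0 < gamma_line LD u" "u \<in> Side 6 \<Longrightarrow> 0 < gamma_line LD u" "u \<in> Side 7 \<Longrightarrow> 0 < gamma_line LD u"
    "u \<in> Side 4 \<Longrightarrow> gamma_line LD u < 0"
    unfolding e q_def[symmetric] using f by (simp_all add: o)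
qed

text \<open>The sides that lie, apart from vertices, where \<open>gamma_line\<close> is positive or where it is negative. The
side labelled \<open>L\<close> whose midpoint is on the line belongs to neither set.\<close>

fun pos_sides :: "letter \<Rightarrow> nat set" where
  "pos_sides LA = {}" | "pos_sides LB = {0, 7}" | "pos_sides LC = {0, 1, 6, 7}" | "pos_sides LD = {0, 1, 2, 5, 6, 7}"

fun neg_sides :: "letter \<Rightarrow> nat set" where
  "neg_sides LA = {}" | "neg_sides LB = {2, 3, 4, 5, 6}" | "neg_sides LC = {3, 4, 5}" | "neg_sides LD = {4}"

lemma gamma_line_pos_neg:
  assumes "u \<notin> Verts" "u \<in> Side i"
  shows "i \<in> pos_sides L \<Longrightarrow> 0 < gamma_line L u" "i \<in> neg_sides L \<Longrightarrow> gamma_line L u < 0"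
proof -
  note sg = gamma_line_sign[OF assms(1)]
  show "0 < gamma_line L u" if "i \<in> pos_sides L"
  proof (cases L)
    case LB then have "i = 0 \<or> i = 7" using that by simp
    then show ?thesis using assms(2) sg(1,2) LB by blast
  next
    case LC then have "i = 0 \<or> i = 1 \<or> i = 6 \<or> i = 7" using that by simp
    then show ?thesis using assms(2) sg(8-11) LC by blast
  next
    case LD then have "i = 0 \<or> i = 1 \<or> i = 2 \<or> i = 5 \<or> i = 6 \<or> i = 7" using that by simp
    then show ?thesis using assms(2) sg(15-20) LD by blast
  qed (use that in simp)
  show "gamma_line L u < 0" if "i \<in> neg_sides L"
  proof (cases L)
    case LB then have "i = 2 \<or> i = 3 \<or> i = 4 \<or> i = 5 \<or> i = 6" using that by simp
    then show ?thesis using assms(2) sg(3-7) LB by blast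
  next
    case LC then have "i = 3 \<or> i = 4 \<or> i = 5" using that by simp
    then show ?thesis using assms(2) sg(12-14) LC by blast
  next
    case LD then have "i = 4" using that by simp
    then show ?thesis using assms(2) sg(21) LD by blast
  qed (use that in simp)
qed

text \<open>A chord has both ends on the same side of the line of \<open>L\<close> unless it leaves through the side labelled
\<open>L\<close>.\<close>

lemma transition_signs:
  assumes "transition j k" "L \<noteq> LA"
  shows "side_label k \<noteq> L \<Longrightarrow> j \<in> pos_sides L \<and> k \<in> pos_sides L \<or> j \<in> neg_sides L \<and> k \<in> neg_sides L"
    "side_label k = L \<Longrightarrow> j \<in> pos_sides L \<or> j \<in> neg_sides L"
proof -
  have jk: "(j, k) \<in> {(4, 3), (5, 3), (5, 2), (6, 2), (6, 1), (7, 1), (7, 0)}" using assms(1) unfolding transition_def .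
  show "j \<in> pos_sides L \<and> k \<in> pos_sides L \<or> j \<in> neg_sides L \<and> k \<in> neg_sides L" if "side_label k \<noteq> L"
    using jk that assms(2) unfolding insert_iff by (cases L; elim disjE) (simp_all add: side_label_simps)
  show "j \<in> pos_sides L \<or> j \<in> neg_sides L" if "side_label k = L"
    using jk that assms(2) unfolding insert_iff by (cases L; elim disjE) (simp_all add: side_label_simps)
qed

text \<open>The heart of the matter, a finite check: two chords glued along a side labelled \<open>L\<close> begin and end on
sides with definite signs with respect to the line of \<open>L\<close>, and the signs with respect to the first
and the second copy tell whether the labels agree.\<close>

lemma transition_sandwich:
  assumes "transition j k" "transition (k + 4) k'" "side_label k \<noteq> LA"
  shows "side_label j = side_label k' \<and> (j \<in> pos_sides (side_label k) \<and> k' + 4 \<in> pos_sides (side_label k) \<or>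
       j \<in> neg_sides (side_label k) \<and> k' + 4 \<in> neg_sides (side_label k)) \<or>
     side_label j \<noteq> side_label k' \<and> (j \<in> pos_sides (side_label k) \<and> k' + 4 \<in> neg_sides (side_label k) \<or>
       j \<in> neg_sides (side_label k) \<and> k' + 4 \<in> pos_sides (side_label k))"
proof -
  consider "j = 4" "k = 3" | "j = 5" "k = 3" | "j = 5" "k = 2" | "j = 6" "k = 2" | "j = 6" "k = 1" | "j = 7" "k = 1"
    using assms(1,3) unfolding transition_def insert_iff by (elim disjE) (simp_all add: side_label_simps)
  moreover have "k = 3 \<Longrightarrow> k' = 1 \<or> k' = 0" "k = 2 \<Longrightarrow> k' = 2 \<or> k' = 1" "k = 1 \<Longrightarrow> k' = 3 \<or> k' = 2"
    using assms(2) unfolding transition_def insert_iff by (elim disjE; simp)+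
  ultimately show ?thesis by cases (auto simp: side_label_simps)
qed

lemma gamma_line_affine: "L \<noteq> LA \<Longrightarrow> gamma_line L ((1 - r) *\<^sub>R x + r *\<^sub>R y) = (1 - r) * gamma_line L x + r * gamma_line L y"
  by (cases L) (simp_all add: algebra_simps)

text \<open>The translation by \<open>- glue_vec k\<close> is the half turn about the centre followed by the half turn about the midpoint
of the side \<open>k\<close>, and the latter preserves the line, which runs through this midpoint.\<close>

lemma gamma_line_glue:
  assumes "k < 4" "side_label k = L" "L \<noteq> LA"
  shows "gamma_line L (z - glue_vec k) = - gamma_line L (- z)"
proof -
  have "k = 0 \<or> k = 1 \<or> k = 2 \<or> k = 3" using assms(1) by linarith
  then show ?thesis using assms(2,3) sg_sq
    by (elim disjE) (auto simp: side_label_simps glue_vec_simps algebra_simps)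
qed

lemma neg_Side: "- u \<in> Side (j + 4) \<longleftrightarrow> u \<in> Side j"
  by (auto simp: Side_def side_normal_add4 Oct_uminus)

lemma same_sign_segment:
  fixes p q r :: real
  assumes "0 < p \<and> 0 < q \<or> p < 0 \<and> q < 0" "0 \<le> r" "r \<le> 1"
  shows "(1 - r) * p + r * q \<noteq> 0"
proof -
  have "0 < (1 - r) * p + r * q" if "0 < p" "0 < q" for p q :: real
    using that assms(2,3) by (cases "r = 0") (auto intro: add_nonneg_pos)
  from this[of p q] this[of "-p" "-q"] assms(1) show ?thesis by (auto simp: algebra_simps)
qed

text \<open>The outgoing half of the image of a side is \<open>gamma_line L u = 0\<close>. By the table of signs, a chord that
leaves through another side has both ends strictly on the same side of this line.\<close>

lemma chord_outgoing:
  assumes tr: "transition j k" and x: "x \<in> Side j" "x \<notin> Verts" and y: "y \<in> Side k" "y \<notin> Verts"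
    and r: "0 \<le> r" "r \<le> 1" and L: "L \<noteq> LA" and z: "gamma_line L ((1 - r) *\<^sub>R x + r *\<^sub>R y) = 0"
  shows "side_label k = L \<and> 0 < r"
proof -
  note sx = gamma_line_pos_neg[OF x(2,1)] and sy = gamma_line_pos_neg[OF y(2,1)]
  have z': "(1 - r) * gamma_line L x + r * gamma_line L y = 0" using z gamma_line_affine[OF L] by simp
  have k: "side_label k = L"
  proof (rule ccontr)
    assume "side_label k \<noteq> L"
    then have "0 < gamma_line L x \<and> 0 < gamma_line L y \<or> gamma_line L x < 0 \<and> gamma_line L y < 0"
      using transition_signs(1)[OF tr L] sx sy by blast
    from same_sign_segment[OF this r] z' show False by simp
  qed
  have "gamma_line L x \<noteq> 0" using transition_signs(2)[OF tr L k] sx less_irrefl by metis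
  then have "r \<noteq> 0" using z' by auto
  then show ?thesis using k r by simp
qed

lemma transition_reverse: "transition j k \<Longrightarrow> transition (k + 4) (j - 4)"
  unfolding transition_def by auto

text \<open>The half turn about the centre, with time reversed, exchanges incoming and outgoing halves.\<close>

lemma chord_incoming:
  assumes tr: "transition j k" and x: "x \<in> Side j" "x \<notin> Verts" and y: "y \<in> Side k" "y \<notin> Verts"
    and r: "0 \<le> r" "r \<le> 1" and L: "L \<noteq> LA" and z: "gamma_line L (- ((1 - r) *\<^sub>R x + r *\<^sub>R y)) = 0"
  shows "side_label j = L \<and> r < 1"
proof -
  have j: "4 \<le> j" using tr by (auto simp: transition_def)
  have eq: "(1 - (1 - r)) *\<^sub>R (- y) + (1 - r) *\<^sub>R (- x) = - ((1 - r) *\<^sub>R x + r *\<^sub>R y)" by simp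
  have sides: "- y \<in> Side (k + 4)" "- x \<in> Side (j - 4)"
    using neg_Side[of y k] neg_Side[of "-x" "j - 4"] x y j by simp_all
  have "side_label (j - 4) = L \<and> 0 < 1 - r"
    using chord_outgoing[OF transition_reverse[OF tr] sides(1) _ sides(2), of "1 - r" L, unfolded eq Verts_uminus] x(2) y(2) r L z
    by linarith
  moreover have "side_label (j - 4) = side_label j" using tr by (auto simp: transition_def side_label_simps)
  ultimately show ?thesis by simp
qed

text \<open>With \<open>gamma_line_glue\<close>, the number \<open>gamma_line L (- y)\<close> is minus the value of the linear form at the
end \<open>y\<close> of the second chord, in the coordinates of the first copy. So the letter is sandwiched if and
only if the trajectory changes sides.\<close>

lemma sandwiched_sign:
  assumes tr: "transition j k" "transition (k + 4) k'" and L: "side_label k = L" "L \<noteq> LA"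
    and x: "x \<in> Side j" "x \<notin> Verts" and y: "y \<in> Side k'" "y \<notin> Verts"
  shows "gamma_line L x \<noteq> 0" "gamma_line L (- y) \<noteq> 0"
    "side_label j = side_label k' \<longleftrightarrow> 0 < gamma_line L x * gamma_line L (- y)"
proof -
  have ny: "- y \<notin> Verts" using y(2) Verts_uminus by blast
  have nys: "- y \<in> Side (k' + 4)" using y(1) neg_Side by blast
  note sx = gamma_line_pos_neg[OF x(2,1)] and sy = gamma_line_pos_neg[OF ny nys]
  have "(side_label j = side_label k' \<and> (0 < gamma_line L x \<and> 0 < gamma_line L (- y) \<or> gamma_line L x < 0 \<and> gamma_line L (- y) < 0))
    \<or> (side_label j \<noteq> side_label k' \<and> (0 < gamma_line L x \<and> gamma_line L (- y) < 0 \<or> gamma_line L x < 0 \<and> 0 < gamma_line L (- y)))"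
    using transition_sandwich[OF tr] L sx[of L] sy[of L] by auto
  then show "gamma_line L x \<noteq> 0" "gamma_line L (- y) \<noteq> 0"
    "side_label j = side_label k' \<longleftrightarrow> 0 < gamma_line L x * gamma_line L (- y)"
    by (auto simp: zero_less_mult_iff simp del: gamma_line.simps)
qed

text \<open>A chord may meet the incoming half for its entry side and the outgoing half for its exit side. The
two halves do not cross, so the point on the second half lies on the same side of the first line as
the end of the chord. This gives the order of the two crossings.\<close>

lemma gamma_lines_disjoint:
  assumes tr: "transition j k" and L: "side_label j = L" "side_label k = L'" "L \<noteq> LA" "L' \<noteq> LA"
    and y: "y \<in> Side k" "y \<notin> Verts" and z: "z \<in> Oct" "gamma_line L' z = 0"
  shows "0 < gamma_line L (- z) * gamma_line L (- y)"
proof -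
  have sb: "sg > 2" using sg_bounds by simp
  note b = z(1)[unfolded mem_Oct']
  have ny: "- y \<notin> Verts" using y(2) Verts_uminus by blast
  have nys: "- y \<in> Side (k + 4)" using y(1) neg_Side by blast
  note sy = gamma_line_pos_neg[OF ny nys]
  have eq: "gamma_line LB u = 2 * (sg * u$2) + u$2 - 3 * sg - 1 - u$1" "gamma_line LC u = 2 * (sg * u$2) - u$1 + sg"
    "gamma_line LD u = 2 * (sg * u$2) - u$2 + 3 * sg + 1 - u$1" for u
    using sg_sq by (simp_all add: algebra_simps)
  have m: "sg * p \<le> sg * q \<longleftrightarrow> p \<le> q" for p q using sb by simp
  have c: "sg * sg = 2 * sg + 1" "sg * - sg = - 2 * sg - 1" using sg_sq by simp_all
  have B: "1 \<le> z$2" if "gamma_line LB z = 0"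
  proof (rule ccontr)
    assume "\<not> 1 \<le> z$2"
    then have "sg * z$2 < sg" using sb by simp
    then show False using \<open>\<not> 1 \<le> z$2\<close> that b unfolding eq by simp
  qed
  have C: "z$2 \<le> 0 \<and> -1 \<le> z$2" if "gamma_line LC z = 0"
  proof -
    have "sg * z$2 \<le> 0" "- sg \<le> sg * z$2" using that b unfolding eq by linarith+
    then show ?thesis using sb m[of "-1" "z$2"] by (simp add: mult_le_0_iff)
  qed
  have D: "z$2 \<le> -1" if "gamma_line LD z = 0"
  proof (rule ccontr)
    assume n: "\<not> z$2 \<le> -1"
    then have "sg * z$2 > - sg" using m[of "z$2" "-1"] by simp
    then show False using n that b sb unfolding eq by simp
  qed
  have "0 < gamma_line L (- z) \<and> 0 < gamma_line L (- y) \<or> gamma_line L (- z) < 0 \<and> gamma_line L (- y) < 0"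
  proof -
    consider "j = 5" "k = 3" | "j = 5" "k = 2" | "j = 6" "k = 2" | "j = 6" "k = 1" | "j = 7" "k = 1"
      using tr L by (auto simp: transition_def side_label_simps)
    then show ?thesis
    proof cases
      case 1
      then have LL: "L = LB" "L' = LD" using L by (simp_all add: side_label_simps)
      have z0: "gamma_line LD z = 0" using z LL by simp
      have "0 < gamma_line LB (- z)" using z0 D[OF z0] sb unfolding eq by simp
      then show ?thesis using LL sy[of L] 1 by (simp del: gamma_line.simps)
    next
      case 2
      then have LL: "L = LB" "L' = LC" using L by (simp_all add: side_label_simps)
      have z0: "gamma_line LC z = 0" using z LL by simp
      have "gamma_line LB (- z) < 0" using z0 C[OF z0] sb unfolding eq by simp
      then show ?thesis using LL sy[of L] 2 by (simp del: gamma_line.simps)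
    next
      case 3
      then have LL: "L = LC" "L' = LC" using L by (simp_all add: side_label_simps)
      have z0: "gamma_line LC z = 0" using z LL by simp
      have "0 < gamma_line LC (- z)" using z0 C[OF z0] sb unfolding eq by simp
      then show ?thesis using LL sy[of L] 3 by (simp del: gamma_line.simps)
    next
      case 4
      then have LL: "L = LC" "L' = LB" using L by (simp_all add: side_label_simps)
      have z0: "gamma_line LB z = 0" using z LL by simp
      have "gamma_line LC (- z) < 0" using z0 B[OF z0] sb b unfolding eq by simp
      then show ?thesis using LL sy[of L] 4 by (simp del: gamma_line.simps)
    next
      case 5
      then have LL: "L = LD" "L' = LB" using L by (simp_all add: side_label_simps)
      have z0: "gamma_line LB z = 0" using z LL by simp
      have "0 < gamma_line LD (- z)" using z0 B[OF z0] sb b unfolding eq by simp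
      then show ?thesis using LL sy[of L] 5 by (simp del: gamma_line.simps)
    qed
  qed
  then show ?thesis by (auto simp: zero_less_mult_iff simp del: gamma_line.simps)
qed

section \<open>Derivation of a cutting sequence in the first sector\<close>

text \<open>Used to enumerate the sandwiched positions: the elements above and below a fixed one are enumerated
separately.\<close>

lemma int_subset_enumeration:
  fixes S :: "int set"
  assumes up: "\<And>N. \<exists>n\<in>S. N < n" and down: "\<And>N. \<exists>n\<in>S. n < N"
  shows "\<exists>f :: int \<Rightarrow> int. strict_mono f \<and> range f = S"
proof -
  obtain s0 where s0: "s0 \<in> S" using up by blast
  define A where "A = {n. s0 + int n \<in> S}"
  define B where "B = {n. s0 - int n \<in> S}"
  have A: "infinite A" unfolding infinite_nat_iff_unbounded
  proof
    fix m obtain n where "n \<in> S" "s0 + int m < n" using up by blast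
    then show "\<exists>n>m. n \<in> A" by (intro exI[of _ "nat (n - s0)"]) (auto simp: A_def)
  qed
  have B: "infinite B" unfolding infinite_nat_iff_unbounded
  proof
    fix m obtain n where "n \<in> S" "n < s0 - int m" using down by blast
    then show "\<exists>n>m. n \<in> B" by (intro exI[of _ "nat (s0 - n)"]) (auto simp: B_def)
  qed
  have 0: "0 \<in> A" "0 \<in> B" using s0 by (auto simp: A_def B_def)
  have e0: "enumerate A 0 = 0" "enumerate B 0 = 0"
    using 0 by (auto simp: enumerate_0 intro: Least_equality)
  have mono: "enumerate A i < enumerate A j \<longleftrightarrow> i < j" "enumerate B i < enumerate B j \<longleftrightarrow> i < j" for i j
    using enumerate_mono_iff A B by blast+
  define f where "f k = (if 0 \<le> k then s0 + int (enumerate A (nat k)) else s0 - int (enumerate B (nat (- k))))" for k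
  have "f i < f j" if "i < j" for i j
  proof (cases "0 \<le> i")
    case True then show ?thesis using that mono(1)[of "nat i" "nat j"] by (simp add: f_def)
  next
    case F: False
    show ?thesis
    proof (cases "0 \<le> j")
      case True
      have "enumerate B 0 < enumerate B (nat (- i))" using F by (subst mono) simp
      then show ?thesis using F True e0 by (simp add: f_def)
    next
      case False
      then show ?thesis using F that mono(2)[of "nat (- j)" "nat (- i)"] by (simp add: f_def)
    qed
  qed
  then have "strict_mono f" by (simp add: strict_mono_def)
  moreover have "range f = S"
  proof (intro equalityI subsetI)
    fix x assume "x \<in> range f"
    then show "x \<in> S" using enumerate_in_set[OF A] enumerate_in_set[OF B] by (auto simp: f_def A_def B_def)
  next
    fix x assume x: "x \<in> S"
    show "x \<in> range f"
    proof (cases "s0 \<le> x")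
      case True
      then have "nat (x - s0) \<in> A" using x by (simp add: A_def)
      then obtain m where "enumerate A m = nat (x - s0)" using enumerate_Ex[OF A] by blast
      then have "f (int m) = x" using True by (simp add: f_def)
      then show ?thesis by blast
    next
      case False
      then have "nat (s0 - x) \<in> B" using x by (simp add: B_def)
      then obtain m where m: "enumerate B m = nat (s0 - x)" using enumerate_Ex[OF B] by blast
      then have "m \<noteq> 0" using False e0 by (intro notI) simp
      then have "f (- int m) = x" using m False by (simp add: f_def)
      then show ?thesis by blast
    qed
  qed
  ultimately show ?thesis by blast
qed

lemma affine_zero_sign:
  fixes \<alpha> \<beta> t t' p q :: real
  assumes "p < q" "(\<alpha> + \<beta> * p) * (\<alpha> + \<beta> * q) < 0" "\<alpha> + \<beta> * t = 0"
    "0 < (\<alpha> + \<beta> * t') * (\<alpha> + \<beta> * q)"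
  shows "p < t \<and> t < q \<and> t < t'"
proof -
  have e: "\<alpha> + \<beta> * r = \<beta> * (r - t)" for r using assms(3) by (simp add: algebra_simps)
  have "\<beta> \<noteq> 0" using assms(2) unfolding e by auto
  then have b: "\<beta> * \<beta> > 0" using not_real_square_gt_zero by blast
  have "\<beta> * \<beta> * ((p - t) * (q - t)) < 0" "0 < \<beta> * \<beta> * ((t' - t) * (q - t))"
    using assms(2,4) unfolding e by (simp_all add: mult_ac)
  then have "(p - t) * (q - t) < 0" "0 < (t' - t) * (q - t)"
    using b by (simp_all add: mult_less_0_iff zero_less_mult_iff)
  then show ?thesis using assms(1) by (auto simp: mult_less_0_iff zero_less_mult_iff)
qed

lemma affine_zero_exists:
  fixes \<alpha> \<beta> p q :: real
  assumes "p < q" "(\<alpha> + \<beta> * p) * (\<alpha> + \<beta> * q) < 0"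
  shows "\<exists>t. p < t \<and> t < q \<and> \<alpha> + \<beta> * t = 0"
proof -
  have b: "\<beta> \<noteq> 0" using assms(2) by (auto simp: not_real_square_gt_zero)
  define t where "t = - \<alpha> / \<beta>"
  have z: "\<alpha> + \<beta> * t = 0" using b by (simp add: t_def)
  have e: "\<alpha> + \<beta> * r = \<beta> * (r - t)" for r using z by (simp add: algebra_simps)
  have "(\<alpha> + \<beta> * q) \<noteq> 0" using assms(2) by auto
  then have "0 < (\<alpha> + \<beta> * q) * (\<alpha> + \<beta> * q)" using not_real_square_gt_zero by blast
  from affine_zero_sign[OF assms z this] show ?thesis using z by blast
qed

lemma affine_no_zero:
  fixes \<alpha> \<beta> p q t :: real
  assumes "0 < (\<alpha> + \<beta> * p) * (\<alpha> + \<beta> * q)" "p \<le> t" "t \<le> q"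
  shows "\<alpha> + \<beta> * t \<noteq> 0"
proof
  assume z: "\<alpha> + \<beta> * t = 0"
  have e: "\<alpha> + \<beta> * r = \<beta> * (r - t)" for r using z by (simp add: algebra_simps)
  have "(\<beta> * \<beta>) * ((t - p) * (q - t)) < 0" using assms(1) unfolding e by (simp add: algebra_simps)
  moreover have "0 \<le> (\<beta> * \<beta>) * ((t - p) * (q - t))" using assms(2,3) by simp
  ultimately show False by simp
qed

context octagonal_surface
begin

lemma label_unique:
  assumes "u \<in> Side i" "u' \<in> Side i'" "u \<notin> Verts" "eqv u u'"
  shows "side_label i = side_label i'"
proof -
  have "u' \<notin> Verts" using assms(3,4) eqv_Verts by blast
  from assms(3,4) consider "u = u'" | j where "u \<in> Side j" "u' = u + glue_vec j" unfolding eqv_def by blast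
  then show ?thesis
  proof cases
    case 1
    then have "i mod 8 = i' mod 8" using Side_inter assms(1-3) by blast
    then show ?thesis using side_label_mod by metis
  next
    case (2 j)
    then have "i mod 8 = j mod 8" "i' mod 8 = (j + 4) mod 8"
      using Side_inter assms(1-3) Side_glue_vec4 \<open>u' \<notin> Verts\<close> by blast+
    then have "side_label i = side_label j" "side_label i' = side_label (j + 4)" using side_label_mod by metis+
    then show ?thesis by (simp add: side_label_def)
  qed
qed

lemma label_side_iff:
  assumes "u \<in> Oct" "u \<notin> Verts"
  shows "cls u \<in> label_side L \<longleftrightarrow> (\<exists>j. u \<in> Side j \<and> side_label j = L)"
proof
  assume "cls u \<in> label_side L"
  then obtain i u' where i: "side_label i = L" "u' \<in> Side i" "cls u = cls u'" unfolding label_side_def by auto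
  then have e: "eqv u' u" using assms cls_eq_iff Side_subset by (metis subsetD)
  then have "u' \<notin> Verts" using eqv_Verts assms by blast
  with e consider "u' = u" | j where "u' \<in> Side j" "u = u' + glue_vec j" unfolding eqv_def by blast
  then show "\<exists>j. u \<in> Side j \<and> side_label j = L"
  proof cases
    case (2 j)
    then have "u \<in> Side (j + 4)" using Side_glue_vec4 by blast
    moreover have "side_label (j + 4) = L" using label_unique[OF i(2) \<open>u \<in> Side (j+4)\<close> \<open>u' \<notin> Verts\<close> e] i(1) by simp
    ultimately show ?thesis by blast
  qed (use i in blast)
qed (auto simp: label_side_def)

text \<open>A point inside a side has two representatives. In the first sector, the one on a side from 4 to 7 is
where the next chord begins.\<close>

lemma entry_point:
  assumes "p \<in> label_side L" "p \<in> surface V - singular V"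
  shows "\<exists>x j. p = cls x \<and> x \<in> Side j \<and> x \<notin> Verts \<and> 4 \<le> j \<and> j < 8 \<and> side_label j = L"
proof -
  obtain u where u: "u \<in> Oct" "u \<notin> Verts" "p = cls u" using assms(2) surface_regular by blast
  then obtain j where "u \<in> Side j" "side_label j = L" using assms(1) label_side_iff by blast
  then obtain j where j: "u \<in> Side j" "side_label j = L" "j < 8" using Side_mod[of j] side_label_mod[of j] mod8_less by metis
  show ?thesis
  proof (cases "4 \<le> j")
    case False
    have "eqv u (u + glue_vec j)" using j by (auto simp: eqv_def)
    then have "cls (u + glue_vec j) = p" "u + glue_vec j \<notin> Verts" using u eqv_Oct eqv_Verts cls_eq_iff by metis+
    moreover have "u + glue_vec j \<in> Side (j + 4)" using Side_glue_vec4 j by blast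
    moreover have "side_label (j + 4) = L" using j by (simp add: side_label_def)
    ultimately show ?thesis using False by (intro exI[of _ "u + glue_vec j"] exI[of _ "j + 4"]) simp
  qed (use u j in blast)
qed

lemma opposite_entry:
  assumes "u \<in> Side k" "u \<notin> Verts" "k < 4" "u' \<in> Side j" "4 \<le> j" "j < 8" "cls u = cls u'"
  shows "j = k + 4" "u' = u + glue_vec k"
proof -
  have e: "eqv u u'" using assms(1,4,7) cls_eq_iff Side_subset by blast
  have "u \<noteq> u'" using Side_inter[of u k j] assms by auto
  then obtain i where i: "u \<in> Side i" "u' = u + glue_vec i" using e assms(2) unfolding eqv_def by blast
  have "i mod 8 = k mod 8" using Side_inter i(1) assms(1,2) by blast
  then show u': "u' = u + glue_vec k" using i(2) glue_vec_mod by metis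
  have "u' \<notin> Verts" using e assms(2) eqv_Verts by blast
  then have "j mod 8 = (k + 4) mod 8" using Side_inter[of u' j "k + 4"] Side_glue_vec4[OF assms(1)] assms(4) u' by auto
  then show "j = k + 4" using assms by simp
qed

end

text \<open>A trajectory in the first sector with its cutting sequence, cut into chords: the \<open>n\<close>-th chord runs
from the entry point \<open>x n\<close> on side \<open>j n\<close> to the side \<open>k n\<close>, which is glued to the side on which the
next chord begins.\<close>

locale sector_trajectory = octagonal_surface +
  fixes a :: "real^2" and \<tau> :: "real \<Rightarrow> surface_point" and w :: "int \<Rightarrow> letter" and T :: "int \<Rightarrow> real"
    and x :: "int \<Rightarrow> real^2" and j k :: "int \<Rightarrow> nat"
  assumes cone: "cone a" and tr: "traj_on UNIV a \<tau>"
    and T_mono: "strict_mono T" and T_range: "range T = {t. \<exists>L. \<tau> t \<in> label_side L}"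
    and entry: "\<And>n. \<tau> (T n) = cls (x n) \<and> x n \<in> Side (j n) \<and> x n \<notin> Verts \<and> 4 \<le> j n \<and> j n < 8 \<and> side_label (j n) = w n"
    and exit: "\<And>n. x n + (T (n + 1) - T n) *\<^sub>R a \<in> Side (k n)" "\<And>n. k n < 4"
    and trans: "\<And>n. transition (j n) (k n)"
    and next_entry: "\<And>n. j (n + 1) = k n + 4" "\<And>n. x (n + 1) = x n + (T (n + 1) - T n) *\<^sub>R a + glue_vec (k n)"
begin

lemma T_less: "T m < T n \<longleftrightarrow> m < n" using T_mono by (rule strict_mono_less)
lemma T_le: "T m \<le> T n \<longleftrightarrow> m \<le> n" using T_mono by (rule strict_mono_less_eq)

lemma chord_point:
  assumes "T n \<le> t" "t \<le> T (n + 1)"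
  shows "x n + (t - T n) *\<^sub>R a \<in> Oct" "\<tau> t = cls (x n + (t - T n) *\<^sub>R a)"
    "x n + (t - T n) *\<^sub>R a \<notin> Verts"
proof -
  have "t \<in> closed_segment (T n) (T (n + 1))" using assms by (simp add: closed_segment_eq_real_ivl)
  then have 1: "x n + (t - T n) *\<^sub>R a \<in> Oct \<and> \<tau> t = cls (x n + (t - T n) *\<^sub>R a)"
    using traj_straight[OF tr convex_UNIV, of "T n" "T (n+1)" "x n" t] entry[of n] exit[of n] Side_subset by blast
  then show "x n + (t - T n) *\<^sub>R a \<in> Oct" "\<tau> t = cls (x n + (t - T n) *\<^sub>R a)" by auto
  show "x n + (t - T n) *\<^sub>R a \<notin> Verts"
    using 1 traj_on_regular[OF tr, of t] cls_eq_iff eqv_Verts by (metis DiffD1 DiffD2 UNIV_I)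
qed

definition y where "y n = x n + (T (n + 1) - T n) *\<^sub>R a"

lemma y_facts: "y n \<in> Side (k n)" "y n \<notin> Verts" "side_label (k n) = w (n + 1)" "x (n + 1) = y n + glue_vec (k n)"
proof -
  show 1: "y n \<in> Side (k n)" "x (n + 1) = y n + glue_vec (k n)" using exit next_entry by (simp_all add: y_def)
  show "y n \<notin> Verts" using chord_point(3)[of n "T (n + 1)"] T_le[of n "n + 1"] by (simp add: y_def)
  have "side_label (k n + 4) = w (n + 1)" using entry[of "n + 1"] next_entry(1)[of n] by simp
  then show "side_label (k n) = w (n + 1)" by (simp add: side_label_def)
qed

lemma no_interior_side:
  assumes "T n < t" "t < T (n + 1)" shows "x n + (t - T n) *\<^sub>R a \<notin> Side i"
  using chord_interior(2)[OF cone, of "x n" "T (n + 1) - T n" "t - T n" i] assms entry[of n] exit(1)[of n] Side_subset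
  by fastforce

lemma time_interval: "\<exists>n. T n \<le> t \<and> t < T (n + 1)"
proof -
  have "a \<noteq> 0" using cone by (auto simp: cone_def)
  have side: "\<exists>m. T m = t" if "\<tau> t \<in> cls ` Side i" for t i
  proof -
    have "\<tau> t \<in> label_side (side_label i)" using that unfolding label_side_def by blast
    then have "t \<in> range T" unfolding T_range by blast
    then show ?thesis by blast
  qed
  obtain m where m: "t + 1 \<le> T m" using traj_reaches_side(1)[OF tr \<open>a \<noteq> 0\<close>, of "t + 1"] side by metis
  obtain l where l: "T l \<le> t" using traj_reaches_side(2)[OF tr \<open>a \<noteq> 0\<close>, of t] side by metis
  have "l < m" using m l T_less[of l m] by linarith
  define N where "N = Max {i. l \<le> i \<and> i \<le> m \<and> T i \<le> t}"
  have fin: "finite {i. l \<le> i \<and> i \<le> m \<and> T i \<le> t}" by (rule finite_subset[of _ "{l..m}"]) auto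
  have "l \<in> {i. l \<le> i \<and> i \<le> m \<and> T i \<le> t}" using l \<open>l < m\<close> by simp
  then have N: "N \<in> {i. l \<le> i \<and> i \<le> m \<and> T i \<le> t}" unfolding N_def using Max_in[OF fin] by blast
  have "t < T (N + 1)"
  proof (rule ccontr)
    assume n: "\<not> t < T (N + 1)"
    then have "N + 1 \<le> m" using m T_less[of m "N + 1"] by linarith
    then have "N + 1 \<in> {i. l \<le> i \<and> i \<le> m \<and> T i \<le> t}" using N n by simp
    then have "N + 1 \<le> N" unfolding N_def using Max_ge[OF fin] by blast
    then show False by simp
  qed
  then show ?thesis using N by blast
qed

text \<open>A point on a side has two representatives, one at the end of a chord and one at the beginning of the
next one; hence \<open>t \<le> T (n + 1)\<close> instead of a strict inequality.\<close>

lemma representative: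
  assumes u: "u \<in> Oct" "\<tau> t = cls u"
  shows "\<exists>n. T n \<le> t \<and> t \<le> T (n + 1) \<and> u = x n + (t - T n) *\<^sub>R a"
proof -
  obtain n where n: "T n \<le> t" "t < T (n + 1)" using time_interval by blast
  define z where "z = x n + (t - T n) *\<^sub>R a"
  have z: "z \<in> Oct" "\<tau> t = cls z" "z \<notin> Verts" using chord_point[of n t] n by (simp_all add: z_def)
  have "eqv z u" using z u cls_eq_iff by metis
  then consider "z = u" | i where "z \<in> Side i" "u = z + glue_vec i" using z(3) unfolding eqv_def by blast
  then show ?thesis
  proof cases
    case 1 then show ?thesis using n z_def by auto
  next
    case (2 i)
    then have t: "t = T n" using no_interior_side[of n t i] n z_def by fastforce
    then have zx: "z = x n" by (simp add: z_def)
    define m where "m = n - 1"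
    have m: "n = m + 1" by (simp add: m_def)
    have "i mod 8 = j n mod 8" using Side_inter z(3) 2(1) entry[of n] zx by blast
    then have "glue_vec i = glue_vec (k m + 4)" using next_entry(1)[of m] glue_vec_mod m by metis
    then have "u = y m" using 2(2) zx y_facts(4)[of m] m by (simp add: glue_vec_add4)
    then show ?thesis using t m T_le[of m "m + 1"] by (intro exI[of _ m]) (simp add: y_def)
  qed
qed

text \<open>The equation of the image of the side crossed at time \<open>T n\<close>, along the trajectory. It is written in
the coordinates of the copy of the octagon that is left at time \<open>T n\<close>, but it is meaningful, and
affine in \<open>t\<close>, also during the next chord; there \<open>phi_after\<close> expresses it in the coordinates of the
next copy.\<close>

definition phi :: "int \<Rightarrow> real \<Rightarrow> real" where
  "phi n t = gamma_line (w n) (x (n - 1) + (t - T (n - 1)) *\<^sub>R a)"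

lemma phi_affine: assumes "w n \<noteq> LA" shows "\<exists>\<alpha> \<beta>. \<forall>t. phi n t = \<alpha> + \<beta> * t"
proof -
  let ?p = "x (n - 1) - T (n - 1) *\<^sub>R a"
  have "phi n t = gamma_line (w n) ?p + (gamma_line (w n) (?p + a) - gamma_line (w n) ?p) * t" for t
  proof -
    have "x (n - 1) + (t - T (n - 1)) *\<^sub>R a = (1 - t) *\<^sub>R ?p + t *\<^sub>R (?p + a)"
      by (simp add: algebra_simps)
    then show ?thesis unfolding phi_def by (simp only: gamma_line_affine[OF assms]) (simp add: algebra_simps del: gamma_line.simps)
  qed
  then show ?thesis by blast
qed

lemma phi_after: assumes "w n \<noteq> LA" shows "phi n t = - gamma_line (w n) (- (x n + (t - T n) *\<^sub>R a))"
proof -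
  define m where "m = n - 1"
  have m: "n = m + 1" by (simp add: m_def)
  have "x (n - 1) + (t - T (n - 1)) *\<^sub>R a = x n + (t - T n) *\<^sub>R a - glue_vec (k m)"
    unfolding m next_entry(2) by (simp add: algebra_simps)
  then show ?thesis unfolding phi_def
    using gamma_line_glue[of "k m" "w n" "x n + (t - T n) *\<^sub>R a"] exit(2)[of m] y_facts(3)[of m] assms m by simp
qed

text \<open>At time \<open>t\<close> the trajectory crosses the image of a side, and this crossing belongs to the letter with
index \<open>n\<close>.\<close>

definition cross :: "int \<Rightarrow> real \<Rightarrow> bool" where
  "cross n t \<longleftrightarrow> (if w n = LA then t = T n else T (n - 1) < t \<and> t < T (n + 1) \<and> phi n t = 0)"

lemma cross_iff: "(\<exists>u\<in>Oct. \<tau> t = cls u \<and> on_gamma_side L u) \<longleftrightarrow> (\<exists>n. w n = L \<and> cross n t)"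
proof
  assume "\<exists>u\<in>Oct. \<tau> t = cls u \<and> on_gamma_side L u"
  then obtain u where u: "u \<in> Oct" "\<tau> t = cls u" "on_gamma_side L u" by blast
  obtain n where n: "T n \<le> t" "t \<le> T (n + 1)" "u = x n + (t - T n) *\<^sub>R a" using representative[OF u(1,2)] by blast
  have uV: "u \<notin> Verts" using chord_point(3) n by blast
  show "\<exists>n. w n = L \<and> cross n t"
  proof (cases "L = LA")
    case True
    have "\<exists>i. u \<in> Side i \<and> side_label i = LA" using u(3) True side_label_simps by (auto simp: on_gamma_side_def)
    then obtain i where i: "u \<in> Side i" "side_label i = LA" by blast
    then have "\<tau> t \<in> label_side LA" using u(2) unfolding label_side_def by blast
    then have "t \<in> range T" unfolding T_range by blast
    then obtain m where m: "t = T m" by blast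
    have "eqv u (x m)" using u(1,2) m entry[of m] cls_eq_iff Side_subset by (metis subsetD)
    then have "w m = LA" using label_unique[OF i(1) _ uV] entry[of m] i(2) by metis
    then show ?thesis using m True by (auto simp: cross_def)
  next
    case False
    define r where "r = (t - T n) / (T (n + 1) - T n)"
    have d: "T (n + 1) - T n > 0" using T_less[of n "n + 1"] by simp
    have r: "0 \<le> r" "r \<le> 1" "0 < r \<longleftrightarrow> T n < t" "r < 1 \<longleftrightarrow> t < T (n + 1)" using n d by (auto simp: r_def field_simps)
    have ur: "u = (1 - r) *\<^sub>R x n + r *\<^sub>R y n"
    proof -
      have "r *\<^sub>R ((T (n + 1) - T n) *\<^sub>R a) = (t - T n) *\<^sub>R a" using d by (simp add: r_def)
      then show ?thesis unfolding n(3) y_def by (simp add: algebra_simps)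
    qed
    consider "gamma_line L u = 0" | "gamma_line L (- u) = 0" using u(3) False by (auto simp: on_gamma_side_def)
    then show ?thesis
    proof cases
      case 1
      then have "side_label (k n) = L \<and> 0 < r"
        using chord_outgoing[OF trans[of n], of "x n" "y n" r L] entry[of n] y_facts[of n] r False ur by metis
      then have "w (n + 1) = L" "T n < t" using y_facts(3) r by auto
      moreover have "t < T (n + 1 + 1)" using n(2) T_less[of "n + 1" "n + 1 + 1"] by simp
      ultimately show ?thesis using 1 n(3) False by (intro exI[of _ "n + 1"]) (simp add: cross_def phi_def)
    next
      case 2
      then have "side_label (j n) = L \<and> r < 1"
        using chord_incoming[OF trans[of n], of "x n" "y n" r L] entry[of n] y_facts[of n] r False ur by metis
      then have L: "w n = L" "t < T (n + 1)" using entry r by auto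
      moreover have "T (n - 1) < t" using n(1) T_less[of "n - 1" n] by simp
      ultimately show ?thesis using 2 n(3) False phi_after[of n t] by (intro exI[of _ n]) (simp add: cross_def)
    qed
  qed
next
  assume "\<exists>n. w n = L \<and> cross n t"
  then obtain n where n: "w n = L" "cross n t" by blast
  show "\<exists>u\<in>Oct. \<tau> t = cls u \<and> on_gamma_side L u"
  proof (cases "L = LA")
    case True
    have "j n = 4 \<or> j n = 5 \<or> j n = 6 \<or> j n = 7" using entry[of n] by linarith
    then have "j n = 4" using entry[of n] n(1) True by (auto simp: side_label_simps)
    then have "x n \<in> Side 4" using entry[of n] by simp
    then show ?thesis using n True entry[of n] Side_subset by (intro bexI[of _ "x n"]) (auto simp: cross_def on_gamma_side_def)
  next
    case False
    then have c: "T (n - 1) < t" "t < T (n + 1)" "phi n t = 0" using n by (auto simp: cross_def)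
    show ?thesis
    proof (cases "t \<le> T n")
      case True
      then show ?thesis using chord_point[of "n - 1" t] c n False
        by (intro bexI[of _ "x (n - 1) + (t - T (n - 1)) *\<^sub>R a"]) (simp_all add: on_gamma_side_def phi_def)
    next
      case F: False
      then show ?thesis using chord_point[of n t] c n False phi_after[of n t]
        by (intro bexI[of _ "x n + (t - T n) *\<^sub>R a"]) (simp_all add: on_gamma_side_def)
    qed
  qed
qed

text \<open>A letter A is always sandwiched, between letters D. For other letters the image of the side is crossed
if and only if \<open>phi n\<close> changes sign between \<open>T (n - 1)\<close> and \<open>T (n + 1)\<close>.\<close>

lemma sandwich_cases:
  "w n = LA \<Longrightarrow> sandwiched w n"
  "w n \<noteq> LA \<Longrightarrow> sandwiched w n \<Longrightarrow> phi n (T (n - 1)) * phi n (T (n + 1)) < 0"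
  "w n \<noteq> LA \<Longrightarrow> \<not> sandwiched w n \<Longrightarrow> 0 < phi n (T (n - 1)) * phi n (T (n + 1))"
proof -
  define m where "m = n - 1"
  have m: "n = m + 1" "n - 1 = m" by (simp_all add: m_def)
  have jk: "j n = k m + 4" using next_entry(1)[of m] unfolding m(1)[symmetric] .
  have lab: "side_label (j m) = w m" "side_label (k n) = w (n + 1)" "side_label (k m) = w n"
    using entry[of m] y_facts(3)[of n] y_facts(3)[of m, folded m(1)] by simp_all
  show "sandwiched w n" if "w n = LA"
  proof -
    have "k m = 0" using trans[of m] lab that by (auto simp: transition_def side_label_simps)
    then have "j m = 7" "k n = 3" using trans[of m] trans[of n] jk by (auto simp: transition_def)
    then show ?thesis using lab m(2) by (simp add: sandwiched_def side_label_simps)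
  qed
  assume L: "w n \<noteq> LA"
  have p: "phi n (T (n - 1)) = gamma_line (w n) (x m)" "phi n (T (n + 1)) = - gamma_line (w n) (- y n)"
    using phi_after[OF L, of "T (n + 1)"] by (simp_all add: phi_def m(2) y_def)
  have ss: "gamma_line (w n) (x m) \<noteq> 0" "gamma_line (w n) (- y n) \<noteq> 0"
    "side_label (j m) = side_label (k n) \<longleftrightarrow> 0 < gamma_line (w n) (x m) * gamma_line (w n) (- y n)"
    using sandwiched_sign[OF trans[of m], of "k n" "w n" "x m" "y n"] trans[of n] jk lab L entry[of m] y_facts[of n] by simp_all
  have sw: "sandwiched w n \<longleftrightarrow> side_label (j m) = side_label (k n)" using lab m(2) by (simp add: sandwiched_def)
  show "phi n (T (n - 1)) * phi n (T (n + 1)) < 0" if "sandwiched w n"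
    using ss sw that unfolding p by simp
  show "0 < phi n (T (n - 1)) * phi n (T (n + 1))" if "\<not> sandwiched w n"
    using ss sw that unfolding p by (simp add: zero_less_mult_iff mult_less_0_iff) linarith
qed

lemma cross_sandwiched: assumes "cross n t" shows "sandwiched w n"
proof (rule ccontr)
  assume n: "\<not> sandwiched w n"
  then have L: "w n \<noteq> LA" using sandwich_cases(1) by blast
  obtain \<alpha> \<beta> where ab: "\<And>t. phi n t = \<alpha> + \<beta> * t" using phi_affine[OF L] by blast
  show False using affine_no_zero[OF sandwich_cases(3)[OF L n, unfolded ab], of t] assms L by (auto simp: cross_def ab)
qed

lemma cross_exists: assumes "sandwiched w n" shows "\<exists>t. cross n t"
proof (cases "w n = LA")
  case False
  obtain \<alpha> \<beta> where ab: "\<And>t. phi n t = \<alpha> + \<beta> * t" using phi_affine[OF False] by blast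
  show ?thesis using affine_zero_exists[OF _ sandwich_cases(2)[OF False assms, unfolded ab]] False T_less by (auto simp: cross_def ab)
qed (simp add: cross_def)

lemma cross_bounds: assumes "cross n t" shows "T (n - 1) < t" "t < T (n + 1)"
  using assms T_less by (auto simp: cross_def split: if_splits)

text \<open>Only successive letters need an argument, as a crossing lies between the times of the neighbouring
letters. If both crossings occur during the chord between these letters, then the value of \<open>phi n\<close>
at the second crossing has the sign that it has at the end of the chord, so its zero comes earlier.\<close>

lemma cross_less:
  assumes c: "cross n t" "cross m t'" and nm: "n < m"
  shows "t < t'"
proof (cases "m = n + 1")
  case False
  then have "T (n + 1) \<le> T (m - 1)" using nm T_le by simp
  then show ?thesis using cross_bounds[OF c(1)] cross_bounds[OF c(2)] by linarith
next
  case m: True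
  show ?thesis
  proof (cases "w n = LA \<or> w m = LA \<or> t \<le> T n \<or> T m \<le> t'")
    case True
    then show ?thesis using c cross_bounds[OF c(1)] cross_bounds[OF c(2)] m T_less[of n m] by (auto simp: cross_def)
  next
    case False
    then have L: "w n \<noteq> LA" "w m \<noteq> LA" and tt: "T n < t" "t' < T m" by auto
    have z: "phi n t = 0" "phi m t' = 0" using c L by (auto simp: cross_def)
    have t': "T n < t'" using cross_bounds[OF c(2)] m by simp
    define z' where "z' = x n + (t' - T n) *\<^sub>R a"
    have zO: "z' \<in> Oct" using chord_point(1)[of n t'] t' tt m by (simp add: z'_def)
    have "gamma_line (w m) z' = 0" using z(2) m by (simp add: phi_def z'_def)
    then have "0 < gamma_line (w n) (- z') * gamma_line (w n) (- y n)"
      using gamma_lines_disjoint[OF trans[of n], of "w n" "w m" "y n" z'] entry[of n] y_facts[of n] L zO m by simp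
    then have "0 < phi n t' * phi n (T (n + 1))"
      unfolding phi_after[OF L(1)] z'_def y_def by simp
    moreover obtain \<alpha> \<beta> where ab: "\<And>t. phi n t = \<alpha> + \<beta> * t" using phi_affine[OF L(1)] by blast
    ultimately show ?thesis
      using affine_zero_sign[OF _ sandwich_cases(2)[OF L(1) cross_sandwiched[OF c(1)], unfolded ab], of t t'] z(1) T_less[of "n - 1" "n + 1"]
      by (simp add: ab)
  qed
qed

lemma cross_unique: assumes "cross n t" "cross n t'" shows "t = t'"
proof (cases "w n = LA")
  case False
  obtain \<alpha> \<beta> where ab: "\<And>t. phi n t = \<alpha> + \<beta> * t" using phi_affine[OF False] by blast
  have z: "\<alpha> + \<beta> * t = 0" "\<alpha> + \<beta> * t' = 0" using assms False by (auto simp: cross_def ab)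
  have "\<beta> \<noteq> 0" using z(1) sandwich_cases(2)[OF False cross_sandwiched[OF assms(1)]] unfolding ab by auto
  then show ?thesis using z by (metis add_left_cancel mult_cancel_left)
qed (use assms in \<open>simp add: cross_def\<close>)

text \<open>The derived sequence is indexed by all integers because the image of the trajectory under the
automorphism is again a trajectory; hence it crosses sides at arbitrarily early and late times.\<close>

lemma derived_crossings:
  assumes f: "affine_automorphism V gamma f" "\<And>p. p \<in> cls ` Oct \<Longrightarrow> f (f p) = p"
      "\<And>x y. twist x y \<Longrightarrow> f (cls x) = cls y"
  shows "\<exists>w'. derived w w'" "derived w w' \<Longrightarrow> cutting_sequence V f \<tau> w'"
proof -
  have cr: "crosses V f \<tau> t L \<longleftrightarrow> (\<exists>n. w n = L \<and> cross n t)" for t L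
    using gamma_label_side[OF f(3,2), of "\<tau> t" L] cross_iff[of t L] unfolding crosses_eq by blast
  define \<sigma> where "\<sigma> n = (SOME t. cross n t)" for n
  have \<sigma>: "cross n (\<sigma> n)" if "sandwiched w n" for n
    unfolding \<sigma>_def using someI_ex[OF cross_exists[OF that]] .
  have \<sigma>_eq: "t = \<sigma> n" if "cross n t" for n t
    using cross_unique[OF that \<sigma>[OF cross_sandwiched[OF that]]] .
  show "cutting_sequence V f \<tau> w'" if d: "derived w w'" for w'
  proof -
    obtain g where g: "strict_mono g" "range g = {n. sandwiched w n}" "w' = w \<circ> g"
      using d unfolding derived_def by blast
    have sw: "sandwiched w (g n)" for n using g(2) by blast
    have "strict_mono (\<sigma> \<circ> g)"
      unfolding strict_mono_def comp_def using cross_less[OF \<sigma>[OF sw] \<sigma>[OF sw]] g(1) by (simp add: strict_mono_def)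
    moreover have "range (\<sigma> \<circ> g) = {t. \<exists>L. crosses V f \<tau> t L}"
    proof (intro equalityI subsetI)
      fix t assume "t \<in> range (\<sigma> \<circ> g)"
      then obtain n where "t = \<sigma> (g n)" by auto
      then show "t \<in> {t. \<exists>L. crosses V f \<tau> t L}" using \<sigma>[OF sw[of n]] cr by blast
    next
      fix t assume "t \<in> {t. \<exists>L. crosses V f \<tau> t L}"
      then obtain n where n: "cross n t" using cr by blast
      then have "n \<in> range g" using g(2) cross_sandwiched by blast
      then show "t \<in> range (\<sigma> \<circ> g)" using \<sigma>_eq[OF n] by auto
    qed
    moreover have "crosses V f \<tau> ((\<sigma> \<circ> g) n) (w' n)" for n
      unfolding cr using \<sigma>[OF sw[of n]] g(3) by auto
    ultimately show ?thesis unfolding cutting_sequence_def by blast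
  qed
  have "gamma *v a \<noteq> 0"
  proof
    assume "gamma *v a = 0"
    then have "(gamma *v a) $ 2 = 0" by simp
    then show False using cone by (simp add: gamma_nth cone_def)
  qed
  note reach = traj_reaches_side[OF traj_on_automorphism[OF tr f(1)] this]
  have crossed: "\<exists>n. cross n t" if side: "(f \<circ> \<tau>) t \<in> cls ` Side i" for t i
  proof -
    have "\<tau> t \<in> cls ` Oct" using tr unfolding traj_on_def surface_eq by blast
    then have "\<tau> t = f (f (\<tau> t))" using f(2) by simp
    moreover have "f (\<tau> t) \<in> label_side (side_label i)" using side unfolding label_side_def by auto
    ultimately have "\<tau> t \<in> f ` label_side (side_label i)" by (metis imageI)
    then show ?thesis using cr unfolding crosses_eq by blast
  qed
  have "\<exists>n\<in>{n. sandwiched w n}. N < n" for N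
  proof -
    obtain t where t: "T (N + 1) \<le> t" "\<exists>i. (f \<circ> \<tau>) t \<in> cls ` Side i" using reach(1) by blast
    then obtain n where n: "cross n t" using crossed by blast
    have "T (N + 1) < T (n + 1)" using cross_bounds(2)[OF n] t(1) by simp
    then show ?thesis using cross_sandwiched[OF n] T_less by (intro bexI[of _ n]) auto
  qed
  moreover have "\<exists>n\<in>{n. sandwiched w n}. n < N" for N
  proof -
    obtain t where t: "t \<le> T (N - 1)" "\<exists>i. (f \<circ> \<tau>) t \<in> cls ` Side i" using reach(2) by blast
    then obtain n where n: "cross n t" using crossed by blast
    have "T (n - 1) < T (N - 1)" using cross_bounds(1)[OF n] t(1) by simp
    then show ?thesis using cross_sandwiched[OF n] T_less by (intro bexI[of _ n]) auto
  qed
  ultimately obtain g :: "int \<Rightarrow> int" where "strict_mono g" "range g = {n. sandwiched w n}"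
    using int_subset_enumeration by metis
  then show "\<exists>w'. derived w w'" unfolding derived_def by blast
qed

end

context octagonal_surface
begin

text \<open>The end of a chord is the next point of the cutting sequence, since a chord has no inner points on
sides.\<close>

lemma sector_trajectory_exists:
  assumes tr: "traj_on UNIV a \<tau>" and a: "cone a" and cs: "cutting_sequence V id \<tau> w"
  shows "\<exists>T x j k. sector_trajectory V c \<rho> a \<tau> w T x j k"
proof -
  obtain T where T: "strict_mono T" "range T = {t. \<exists>L. \<tau> t \<in> label_side L}" "\<And>n. \<tau> (T n) \<in> label_side (w n)"
    using cs unfolding cutting_sequence_def crosses_eq by auto
  have reg: "\<tau> t \<in> surface V - singular V" for t using tr unfolding traj_on_def by blast
  have "\<forall>n. \<exists>x j. \<tau> (T n) = cls x \<and> x \<in> Side j \<and> x \<notin> Verts \<and> 4 \<le> j \<and> j < 8 \<and> side_label j = w n"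
    using entry_point[OF T(3) reg] by blast
  then obtain x j where e: "\<And>n. \<tau> (T n) = cls (x n) \<and> x n \<in> Side (j n) \<and> x n \<notin> Verts \<and> 4 \<le> j n \<and> j n < 8 \<and> side_label (j n) = w n"
    by metis
  have xO: "x n \<in> Oct" for n using e[of n] Side_subset by blast
  have ex: "\<exists>k<4. x n + (T (n + 1) - T n) *\<^sub>R a \<in> Side k" for n
  proof -
    obtain S k where S: "0 < S" "k < 4" "x n + S *\<^sub>R a \<in> Side k" using chord_exit[OF a] e[of n] by metis
    have SO: "x n + S *\<^sub>R a \<in> Oct" using S(3) Side_subset by blast
    have along: "\<tau> (T n + s) = cls (x n + s *\<^sub>R a)" if "0 \<le> s" "s \<le> S" for s
      using traj_straight[OF tr convex_UNIV, of "T n" "T n + S" "x n" "T n + s"] xO e SO that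
      by (simp add: closed_segment_eq_real_ivl)
    have "\<tau> (T n + S) \<in> label_side (side_label k)"
      using along[of S] S unfolding label_side_def by auto
    then have "T n + S \<in> range T" unfolding T(2) by blast
    then obtain m where m: "T m = T n + S" by (metis rangeE)
    have nm: "n < m" using S(1) m strict_mono_less[OF T(1), of n m] by simp
    have "\<not> n + 1 < m"
    proof
      assume "n + 1 < m"
      then have lt: "T n < T (n + 1)" "T (n + 1) < T m" using T(1) by (auto simp: strict_mono_def)
      define s where "s = T (n + 1) - T n"
      have s: "0 < s" "s < S" "T n + s = T (n + 1)" using lt m by (auto simp: s_def)
      have u: "x n + s *\<^sub>R a \<in> Oct" "\<And>i. x n + s *\<^sub>R a \<notin> Side i"
        using chord_interior[OF a xO SO s(1,2)] by auto
      have tu: "\<tau> (T (n + 1)) = cls (x n + s *\<^sub>R a)" using along[of s] s by simp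
      have "x n + s *\<^sub>R a \<notin> Verts" using u(2) vertex_in_Side(1) unfolding Verts_def by force
      then show False using T(3)[of "n + 1"] label_side_iff[OF u(1)] u(2) tu by simp
    qed
    then have "m = n + 1" using nm by simp
    then have "T (n + 1) - T n = S" using m by simp
    then show ?thesis using S by auto
  qed
  then obtain k where k: "\<And>n. k n < 4 \<and> x n + (T (n + 1) - T n) *\<^sub>R a \<in> Side (k n)" by metis
  define y where "y n = x n + (T (n + 1) - T n) *\<^sub>R a" for n
  have lt: "T n < T (n + 1)" for n using T(1) by (simp add: strict_mono_def)
  have y: "y n \<in> Side (k n)" "cls (y n) = cls (x (n + 1))" "y n \<notin> Verts" for n
  proof -
    show 1: "y n \<in> Side (k n)" using k by (simp add: y_def)
    have yO: "y n \<in> Oct" using 1 Side_subset by blast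
    have "\<tau> (T (n + 1)) = cls (y n)"
      using traj_straight[OF tr convex_UNIV, of "T n" "T (n + 1)" "x n" "T (n + 1)"] xO e yO by (simp add: y_def)
    then show 2: "cls (y n) = cls (x (n + 1))" using e[of "n + 1"] by simp
    then show "y n \<notin> Verts" using cls_eq_iff[OF yO xO] eqv_Verts e by blast
  qed
  have "sector_trajectory V c \<rho> a \<tau> w T x j k"
  proof
    show "cone a" "traj_on UNIV a \<tau>" "strict_mono T" "range T = {t. \<exists>L. \<tau> t \<in> label_side L}" by fact+
    show "x n + (T (n + 1) - T n) *\<^sub>R a \<in> Side (k n)" "k n < 4" for n using k by auto
    show "\<tau> (T n) = cls (x n) \<and> x n \<in> Side (j n) \<and> x n \<notin> Verts \<and> 4 \<le> j n \<and> j n < 8 \<and> side_label (j n) = w n" for n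
      by (rule e)
    show "transition (j n) (k n)" for n
      using chord_transition[OF a, of "x n" "j n" "T (n + 1) - T n" "k n"] e[of n] y[of n] k[of n] lt[of n] by (simp add: y_def)
    show "j (n + 1) = k n + 4" "x (n + 1) = x n + (T (n + 1) - T n) *\<^sub>R a + glue_vec (k n)" for n
      using opposite_entry[OF y(1) y(3), of n "x (n + 1)" "j (n + 1)"] y(2)[of n] e[of "n + 1"] k[of n] by (simp_all add: y_def)
  qed
  then show ?thesis by blast
qed

end

section \<open>The right action on the upper half-plane\<close>

text \<open>Orientation-reversing matrices are included, as \<open>gamma\<close> and half of the matrices \<open>nu i\<close> have
determinant \<open>-1\<close>.\<close>

definition unimodular :: "real^2^2 \<Rightarrow> bool" where "unimodular M \<longleftrightarrow> det M = 1 \<or> det M = -1"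

definition moeb :: "complex \<Rightarrow> real^2^2 \<Rightarrow> complex" where
  "moeb u M = (of_real (M$1$1) * u + of_real (M$2$1)) / (of_real (M$1$2) * u + of_real (M$2$2))"

lemma act_moeb: "act z M = moeb (if det M = 1 then z else cnj z) M"
  by (simp add: act_def moeb_def Let_def)

lemma moeb_denominator:
  assumes "Im u \<noteq> 0" "unimodular M" shows "of_real (M$1$2) * u + of_real (M$2$2) \<noteq> (0::complex)"
proof
  assume "of_real (M$1$2) * u + of_real (M$2$2) = (0::complex)"
  then have "M$1$2 * Im u = 0" "M$1$2 * Re u + M$2$2 = 0" by (simp_all add: complex_eq_iff)
  then have "M$1$2 = 0" "M$2$2 = 0" using assms(1) by auto
  then show False using assms(2) by (simp add: unimodular_def det_2)
qed

lemma moeb_im: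
  assumes "Im u \<noteq> 0" "unimodular M"
  shows "Im (moeb u M) = det M * Im u / (cmod (of_real (M$1$2) * u + of_real (M$2$2)))\<^sup>2"
  unfolding moeb_def by (simp add: Im_divide' cmod_power2 det_2 algebra_simps)

lemma moeb_moeb:
  assumes "Im u \<noteq> 0" "unimodular M" "unimodular N"
  shows "moeb (moeb u M) N = moeb u (M ** N)"
proof -
  have D: "of_real (M$1$2) * u + of_real (M$2$2) \<noteq> (0::complex)" using moeb_denominator assms by blast
  have "det M \<noteq> 0" using assms(2) by (auto simp: unimodular_def)
  then have "Im (moeb u M) \<noteq> 0" using moeb_im[OF assms(1,2)] D assms(1) by simp
  then have D2: "of_real (N$1$2) * moeb u M + of_real (N$2$2) \<noteq> (0::complex)" using moeb_denominator assms(3) by blast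
  have e: "of_real p * moeb u M + of_real q = (of_real p * (of_real (M$1$1) * u + of_real (M$2$1)) + of_real q * (of_real (M$1$2) * u + of_real (M$2$2))) / (of_real (M$1$2) * u + of_real (M$2$2))" for p q
  proof -
    have "P * (A / W) + Q = (P * A + Q * W) / W" if "W \<noteq> 0" for P Q A W :: complex
      using that by (simp add: field_simps)
    from this[OF D] show ?thesis unfolding moeb_def .
  qed
  have "moeb (moeb u M) N = (of_real (N$1$1) * moeb u M + of_real (N$2$1)) / (of_real (N$1$2) * moeb u M + of_real (N$2$2))"
    by (simp only: moeb_def[of "moeb u M"])
  also have "\<dots> = (of_real (N$1$1) * (of_real (M$1$1) * u + of_real (M$2$1)) + of_real (N$2$1) * (of_real (M$1$2) * u + of_real (M$2$2))) /
      (of_real (N$1$2) * (of_real (M$1$1) * u + of_real (M$2$1)) + of_real (N$2$2) * (of_real (M$1$2) * u + of_real (M$2$2)))"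
    unfolding e using D by simp
  also have "\<dots> = moeb u (M ** N)" unfolding moeb_def[of u "M ** N"] by (simp add: algebra_simps)
  finally show ?thesis .
qed

lemma cnj_moeb: "cnj (moeb u M) = moeb (cnj u) M" by (simp add: moeb_def)

lemma unimodular_mult: "unimodular M \<Longrightarrow> unimodular N \<Longrightarrow> unimodular (M ** N)"
  by (auto simp: unimodular_def det_mul)

lemma act_im: assumes "0 < Im z" "unimodular M" shows "0 < Im (act z M)"
proof -
  have "0 < (cmod (of_real (M$1$2) * u + of_real (M$2$2)))\<^sup>2" if "Im u \<noteq> 0" for u
    using moeb_denominator[OF that assms(2)] by simp
  then show ?thesis using assms moeb_im[OF _ assms(2), of z] moeb_im[OF _ assms(2), of "cnj z"]
    by (auto simp: act_moeb unimodular_def)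
qed

lemma act_act:
  assumes "0 < Im z" "unimodular M" "unimodular N" shows "act (act z M) N = act z (M ** N)"
  using assms moeb_moeb[of z M N] moeb_moeb[of "cnj z" M N]
  by (auto simp: act_moeb unimodular_def det_mul cnj_moeb)

lemma act_one: "act z (mat 1) = z"
proof -
  have "(mat 1 :: real^2^2)$1$1 = 1" "(mat 1 :: real^2^2)$1$2 = 0" "(mat 1 :: real^2^2)$2$1 = 0" "(mat 1 :: real^2^2)$2$2 = 1"
    by (simp_all add: mat_def)
  then show ?thesis by (simp add: act_moeb moeb_def)
qed

text \<open>The quadratic form that vanishes on the boundary points \<open>u / v\<close> equal to 0 and \<open>1 - r2\<close>, the endpoints
of \<open>E 0\<close>.\<close>

definition row_form :: "real \<Rightarrow> real \<Rightarrow> real" where "row_form u v = u * (u + (r2 - 1) * v)"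

text \<open>The function on the upper half-plane that vanishes on \<open>E 0\<close>, is positive on the side of \<open>E 0\<close>
containing \<open>\<i>\<close>, and changes its sign under the reflection \<open>gamma\<close>.\<close>

definition side_form :: "complex \<Rightarrow> real" where "side_form z = ((cmod z)\<^sup>2 + (r2 - 1) * Re z) / Im z"

lemma side_form_act:
  assumes "0 < Im z" "unimodular M"
  shows "side_form (act z M) = (row_form (M$1$1) (M$1$2) * (cmod z)\<^sup>2
     + (2 * M$1$1 * M$2$1 + (r2 - 1) * (M$1$1 * M$2$2 + M$1$2 * M$2$1)) * Re z + row_form (M$2$1) (M$2$2)) / Im z"
proof -
  define u where "u = (if det M = 1 then z else cnj z)"
  have u: "Im u = det M * Im z" "Re u = Re z" "(cmod u)\<^sup>2 = (cmod z)\<^sup>2" "Im u \<noteq> 0"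
    using assms by (auto simp: u_def unimodular_def)
  define D where "D = (cmod (of_real (M$1$2) * u + of_real (M$2$2)))\<^sup>2"
  have D: "0 < D" using moeb_denominator[OF u(4) assms(2)] by (simp add: D_def)
  have dd: "det M * det M = 1" using assms(2) by (auto simp: unimodular_def)
  have i: "Im (moeb u M) = Im z / D" using moeb_im[OF u(4) assms(2)] dd unfolding u(1) D_def[symmetric] by (simp add: mult.assoc[symmetric])
  have n: "(cmod (moeb u M))\<^sup>2 = ((M$1$1)\<^sup>2 * (cmod z)\<^sup>2 + 2 * M$1$1 * M$2$1 * Re z + (M$2$1)\<^sup>2) / D"
  proof -
    have "(cmod (of_real p * u + of_real q))\<^sup>2 = p\<^sup>2 * (cmod u)\<^sup>2 + 2 * p * q * Re u + q\<^sup>2" for p q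
      unfolding cmod_power2 by (simp add: power2_eq_square algebra_simps)
    then show ?thesis unfolding moeb_def norm_divide power_divide D_def[symmetric] u(2,3) by simp
  qed
  have r: "Re (moeb u M) = (M$1$1 * M$1$2 * (cmod z)\<^sup>2 + (M$1$1 * M$2$2 + M$1$2 * M$2$1) * Re z + M$2$1 * M$2$2) / D"
  proof -
    have "Re ((of_real p * u + of_real q) * cnj (of_real p' * u + of_real q')) = p * p' * (cmod u)\<^sup>2 + (p * q' + p' * q) * Re u + q * q'" for p q p' q'
      unfolding cmod_power2 by (simp add: power2_eq_square algebra_simps)
    then show ?thesis unfolding moeb_def complex_div_cnj[of "_ + _"] D_def u(2,3)
      by (simp add: u(2,3) del: complex_cnj_add)
  qed
  have "side_form (moeb u M) = ((M$1$1)\<^sup>2 * (cmod z)\<^sup>2 + 2 * M$1$1 * M$2$1 * Re z + (M$2$1)\<^sup>2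
      + (r2 - 1) * (M$1$1 * M$1$2 * (cmod z)\<^sup>2 + (M$1$1 * M$2$2 + M$1$2 * M$2$1) * Re z + M$2$1 * M$2$2)) / Im z"
    unfolding side_form_def i n r using D assms(1) by (simp add: field_simps)
  then show ?thesis unfolding act_moeb u_def[symmetric] row_form_def by (simp add: algebra_simps power2_eq_square)
qed

lemma nu_nth_cases:
  assumes "i < 8"
  shows "transpose (nu i) ** nu i = mat 1" "nu i ** transpose (nu i) = mat 1" "unimodular (nu i)" "unimodular (transpose (nu i))"
proof -
  have h: "1 / r2 = r2 / 2" "-1 / r2 = -(r2 / 2)" by (simp_all add: field_simps)
  have "transpose (nu i) ** nu i = mat 1 \<and> nu i ** transpose (nu i) = mat 1 \<and> unimodular (nu i)"
    using assms unfolding less8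
    by (elim disjE; simp only:) (simp_all add: nu_def mat2_eq transpose_def mat_def unimodular_def det_2 h)
  then show "transpose (nu i) ** nu i = mat 1" "nu i ** transpose (nu i) = mat 1" "unimodular (nu i)" "unimodular (transpose (nu i))"
    by (auto simp: unimodular_def det_transpose)
qed

lemma matrix_inv_eqI:
  fixes M N :: "real^2^2"
  assumes "M ** N = mat 1" "N ** M = mat 1" shows "matrix_inv M = N"
proof -
  have "M ** matrix_inv M = mat 1 \<and> matrix_inv M ** M = mat 1"
    unfolding matrix_inv_def by (rule someI[of _ N]) (use assms in simp)
  moreover have "matrix_inv M ** (M ** N) = (matrix_inv M ** M) ** N" by (rule matrix_mul_assoc)
  ultimately show ?thesis using assms by simp
qed

lemma gamma_i_eq: assumes "i < 8" shows "gamma_i i = transpose (nu i) ** gamma ** nu i"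
proof -
  have "matrix_inv (nu i) = transpose (nu i)"
    by (rule matrix_inv_eqI) (use nu_nth_cases[OF assms] in simp_all)
  then show ?thesis by (simp add: gamma_i_def)
qed

lemma unimodular_gamma: "unimodular gamma" by (simp add: unimodular_def det_2 gamma_nth)

lemma gamma_i_facts:
  assumes "i < 8"
  shows "unimodular (gamma_i i)" "gamma_i i ** gamma_i i = mat 1" "gamma_i i ** transpose (nu i) = transpose (nu i) ** gamma"
    "nu i ** gamma_i i = gamma ** nu i"
proof -
  note n = nu_nth_cases[OF assms]
  show "unimodular (gamma_i i)" unfolding gamma_i_eq[OF assms] using n unimodular_gamma by (intro unimodular_mult)
  have "gamma_i i ** transpose (nu i) = transpose (nu i) ** gamma ** (nu i ** transpose (nu i))"
    unfolding gamma_i_eq[OF assms] by (simp only: matrix_mul_assoc)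
  then show 1: "gamma_i i ** transpose (nu i) = transpose (nu i) ** gamma" using n by simp
  have "nu i ** gamma_i i = (nu i ** transpose (nu i)) ** gamma ** nu i"
    unfolding gamma_i_eq[OF assms] by (simp only: matrix_mul_assoc)
  then show "nu i ** gamma_i i = gamma ** nu i" using n by simp
  have "gamma_i i ** gamma_i i = (gamma_i i ** transpose (nu i)) ** gamma ** nu i"
    unfolding gamma_i_eq[OF assms] by (simp only: matrix_mul_assoc)
  also have "\<dots> = transpose (nu i) ** (gamma ** gamma) ** nu i" unfolding 1 by (simp only: matrix_mul_assoc)
  finally show "gamma_i i ** gamma_i i = mat 1" using n gamma_gamma by simp
qed

text \<open>Positive on the side of \<open>E i\<close> containing \<open>\<i>\<close>. The ideal octagon is where all eight functions are
nonnegative.\<close>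

definition half :: "nat \<Rightarrow> complex \<Rightarrow> real" where "half i z = side_form (act z (transpose (nu i)))"

lemma row_form_gamma: "row_form (- u) (2 * sg * u + v) = - row_form u v"
proof -
  have "(r2 - 1) * (2 * sg) = 2" unfolding sg_def by (simp add: algebra_simps)
  moreover have "(r2 - 1) * (2 * sg * u + v) = (r2 - 1) * (2 * sg) * u + (r2 - 1) * v" by (simp add: distrib_left mult.assoc)
  ultimately have "(r2 - 1) * (2 * sg * u + v) = 2 * u + (r2 - 1) * v" by (simp only:)
  then show ?thesis unfolding row_form_def by (simp add: algebra_simps)
qed

lemma side_form_gamma: assumes "0 < Im z" shows "side_form (act z gamma) = - side_form z"
proof -
  have e: "(r2 - 1) * (2 * sg) = 2" unfolding sg_def by (simp add: algebra_simps)
  have "row_form (-1) (2 * sg) = - 1" unfolding row_form_def e by simp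
  then have "row_form (gamma$1$1) (gamma$1$2) * (cmod z)\<^sup>2 + (2 * gamma$1$1 * gamma$2$1 + (r2 - 1) * (gamma$1$1 * gamma$2$2 + gamma$1$2 * gamma$2$1)) * Re z
      + row_form (gamma$2$1) (gamma$2$2) = - ((cmod z)\<^sup>2 + (r2 - 1) * Re z)"
    by (simp add: gamma_nth row_form_def[of 0] algebra_simps)
  then have "side_form (act z gamma) = - ((cmod z)\<^sup>2 + (r2 - 1) * Re z) / Im z"
    unfolding side_form_act[OF assms unimodular_gamma] by (simp only:)
  then show ?thesis unfolding side_form_def[of z] by (simp only: minus_divide_left)
qed

lemma half_gamma: assumes "0 < Im z" "i < 8" shows "half i (act z (gamma_i i)) = - half i z"
proof -
  note n = nu_nth_cases[OF assms(2)] and g = gamma_i_facts[OF assms(2)]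
  have "act (act z (gamma_i i)) (transpose (nu i)) = act (act z (transpose (nu i))) gamma"
    using act_act assms(1) n g unimodular_gamma by metis
  then show ?thesis unfolding half_def using side_form_gamma act_im assms(1) n by simp
qed

text \<open>Coordinates of the side normals in the hyperboloid model, in which a point \<open>z\<close> has the coordinates
\<open>p = (1 + (cmod z)\<^sup>2) / (2 * Im z)\<close>, \<open>q = ((cmod z)\<^sup>2 - 1) / (2 * Im z)\<close> and \<open>r = Re z / Im z\<close>, with
\<open>p\<^sup>2 - q\<^sup>2 - r\<^sup>2 = 1\<close>. By \<open>half_eq\<close>, the function \<open>half i\<close> is \<open>p + coef_q i * q + coef_r i * r\<close>.\<close>

definition coef_q :: "nat \<Rightarrow> real" where "coef_q i = [1, r2 - 1, 1 - r2, -1, -1, 1 - r2, r2 - 1, 1] ! i"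
definition coef_r :: "nat \<Rightarrow> real" where "coef_r i = [r2 - 1, 1, 1, r2 - 1, 1 - r2, -1, -1, 1 - r2] ! i"

lemma coef_q_coef_r:
  "coef_q 0 = 1" "coef_q 1 = r2 - 1" "coef_q 2 = 1 - r2" "coef_q 3 = -1" "coef_q 4 = -1" "coef_q 5 = 1 - r2" "coef_q 6 = r2 - 1" "coef_q 7 = 1"
  "coef_r 0 = r2 - 1" "coef_r 1 = 1" "coef_r 2 = 1" "coef_r 3 = r2 - 1" "coef_r 4 = 1 - r2" "coef_r 5 = -1" "coef_r 6 = -1" "coef_r 7 = 1 - r2"
  by (simp_all add: coef_q_def coef_r_def)

lemma nu_entries:
  "nu 0 = mat2 1 0 0 1" "nu 1 = mat2 (r2/2) (r2/2) (r2/2) (- (r2/2))" "nu 2 = mat2 (r2/2) (r2/2) (- (r2/2)) (r2/2)"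
  "nu 3 = mat2 0 1 1 0" "nu 4 = mat2 0 1 (-1) 0" "nu 5 = mat2 (- (r2/2)) (r2/2) (r2/2) (r2/2)"
  "nu 6 = mat2 (- (r2/2)) (r2/2) (- (r2/2)) (- (r2/2))" "nu 7 = mat2 (-1) 0 0 1"
proof -
  have h: "1 / r2 = r2 / 2" "-1 / r2 = -(r2 / 2)" by (simp_all add: field_simps)
  show "nu 0 = mat2 1 0 0 1" "nu 1 = mat2 (r2/2) (r2/2) (r2/2) (- (r2/2))" "nu 2 = mat2 (r2/2) (r2/2) (- (r2/2)) (r2/2)"
    "nu 3 = mat2 0 1 1 0" "nu 4 = mat2 0 1 (-1) 0" "nu 5 = mat2 (- (r2/2)) (r2/2) (r2/2) (r2/2)"
    "nu 6 = mat2 (- (r2/2)) (r2/2) (- (r2/2)) (- (r2/2))" "nu 7 = mat2 (-1) 0 0 1"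
    by (simp_all add: nu_def mat2_eq h)
qed

lemma half_coefficients:
  assumes "i < 8"
  shows "row_form (nu i $1$1) (nu i $2$1) = (1 + coef_q i) / 2"
    "2 * nu i $1$1 * nu i $1$2 + (r2 - 1) * (nu i $1$1 * nu i $2$2 + nu i $2$1 * nu i $1$2) = coef_r i"
    "row_form (nu i $1$2) (nu i $2$2) = (1 - coef_q i) / 2"
proof -
  have q: "row_form (r2/2) (r2/2) = r2 / 2" "row_form (r2/2) (- (r2/2)) = 1 - r2 / 2" "row_form (- (r2/2)) (r2/2) = 1 - r2 / 2"
    "row_form (- (r2/2)) (- (r2/2)) = r2 / 2" "row_form 1 0 = 1" "row_form 0 1 = 0" "row_form 0 (-1) = 0" "row_form (-1) 0 = 1"
    by (simp_all add: row_form_def algebra_simps diff_divide_distrib add_divide_distrib)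
  note i = assms[unfolded less8]
  show "row_form (nu i $1$1) (nu i $2$1) = (1 + coef_q i) / 2"
    using i by (elim disjE; simp only: nu_entries mat2_nth q coef_q_coef_r; simp add: field_simps)
  show "row_form (nu i $1$2) (nu i $2$2) = (1 - coef_q i) / 2"
    using i by (elim disjE; simp only: nu_entries mat2_nth q coef_q_coef_r; simp add: field_simps)
  show "2 * nu i $1$1 * nu i $1$2 + (r2 - 1) * (nu i $1$1 * nu i $2$2 + nu i $2$1 * nu i $1$2) = coef_r i"
    using i by (elim disjE; simp only: nu_entries mat2_nth coef_q_coef_r; simp add: algebra_simps diff_divide_distrib add_divide_distrib)
qed

lemma half_eq:
  assumes "0 < Im z" "i < 8"
  shows "half i z = ((1 + (cmod z)\<^sup>2) / 2 + coef_q i * (((cmod z)\<^sup>2 - 1) / 2) + coef_r i * Re z) / Im z"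
proof -
  have "half i z = (row_form (nu i $1$1) (nu i $2$1) * (cmod z)\<^sup>2
     + (2 * nu i $1$1 * nu i $1$2 + (r2 - 1) * (nu i $1$1 * nu i $2$2 + nu i $2$1 * nu i $1$2)) * Re z + row_form (nu i $1$2) (nu i $2$2)) / Im z"
    unfolding half_def side_form_act[OF assms(1) nu_nth_cases(4)[OF assms(2)]] by (simp add: transpose_def)
  also have "\<dots> = ((1 + (cmod z)\<^sup>2) / 2 + coef_q i * (((cmod z)\<^sup>2 - 1) / 2) + coef_r i * Re z) / Im z"
    unfolding half_coefficients[OF assms(2)] by (simp add: field_simps)
  finally show ?thesis .
qed

lemma coeff_bound:
  assumes "i < 8" "j < 8" "i \<noteq> j" shows "(coef_q i + coef_q j)\<^sup>2 + (coef_r i + coef_r j)\<^sup>2 \<le> 4"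
proof -
  have b: "1.4 < r2" "r2 < 1.5" by (rule r2_bounds)+
  have sq: "(r2 - 1) * (r2 - 1) = 3 - 2 * r2" "(1 - r2) * (1 - r2) = 3 - 2 * r2" "(r2 - 1) * (1 - r2) = 2 * r2 - 3"
    "(1 - r2) * (r2 - 1) = 2 * r2 - 3" by (simp_all add: algebra_simps)
  have n: "coef_q i * coef_q i + coef_r i * coef_r i = 4 - 2 * r2" if "i < 8" for i
    using that unfolding less8 by (elim disjE; simp only: coef_q_coef_r sq; simp)
  have "coef_q i * coef_q j + coef_r i * coef_r j \<le> 2 * r2 - 2"
    using assms(3) assms(1,2)[unfolded less8] b
    by (elim disjE; simp only: coef_q_coef_r sq; simp)
  moreover have "(coef_q i + coef_q j)\<^sup>2 + (coef_r i + coef_r j)\<^sup>2 = (coef_q i * coef_q i + coef_r i * coef_r i) + (coef_q j * coef_q j + coef_r j * coef_r j) + 2 * (coef_q i * coef_q j) + 2 * (coef_r i * coef_r j)"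
    by (simp add: power2_eq_square algebra_simps)
  ultimately show ?thesis using n[OF assms(1)] n[OF assms(2)] by linarith
qed

text \<open>In the hyperboloid model \<open>q\<^sup>2 + r\<^sup>2 < p\<^sup>2\<close>. If two of the functions were nonpositive, then so would be
their sum, and by the Cauchy-Schwarz inequality the sum of the two vectors of coefficients would have
to be longer than 2. For neighbouring sides, which meet at infinity, the length is exactly 2.\<close>

lemma half_disjoint:
  assumes z: "0 < Im z" and ij: "i < 8" "j < 8" "i \<noteq> j" and neg: "half i z \<le> 0" shows "0 < half j z"
proof (rule ccontr)
  assume "\<not> 0 < half j z"
  define p where "p = (1 + (cmod z)\<^sup>2) / 2"
  define q where "q = ((cmod z)\<^sup>2 - 1) / 2"
  define r where "r = Re z"
  have pq: "q\<^sup>2 + r\<^sup>2 < p\<^sup>2"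
  proof -
    have "p\<^sup>2 - q\<^sup>2 - r\<^sup>2 = (Im z)\<^sup>2"
      unfolding p_def q_def r_def cmod_power2 by (simp add: power2_eq_square field_simps)
    then show ?thesis using z by (smt (verit) zero_less_power)
  qed
  have p0: "0 < p" unfolding p_def by (simp add: add_pos_nonneg)
  have "p + coef_q i * q + coef_r i * r \<le> 0" "p + coef_q j * q + coef_r j * r \<le> 0"
    using neg \<open>\<not> 0 < half j z\<close> z unfolding half_eq[OF z ij(1)] half_eq[OF z ij(2)] p_def q_def r_def
    by (simp_all add: divide_le_0_iff zero_less_divide_iff not_less)
  then have "2 * p \<le> - ((coef_q i + coef_q j) * q + (coef_r i + coef_r j) * r)" by (simp add: algebra_simps)
  then have "(2 * p)\<^sup>2 \<le> ((coef_q i + coef_q j) * q + (coef_r i + coef_r j) * r)\<^sup>2"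
    using p0 by (subst power2_minus[symmetric]) (rule power_mono, simp_all)
  also have "\<dots> \<le> ((coef_q i + coef_q j)\<^sup>2 + (coef_r i + coef_r j)\<^sup>2) * (q\<^sup>2 + r\<^sup>2)"
  proof -
    have "((coef_q i + coef_q j)\<^sup>2 + (coef_r i + coef_r j)\<^sup>2) * (q\<^sup>2 + r\<^sup>2) - ((coef_q i + coef_q j) * q + (coef_r i + coef_r j) * r)\<^sup>2
       = ((coef_q i + coef_q j) * r - (coef_r i + coef_r j) * q)\<^sup>2" by (simp add: power2_eq_square algebra_simps)
    then show ?thesis by (smt (verit) zero_le_power2)
  qed
  also have "\<dots> \<le> 4 * (q\<^sup>2 + r\<^sup>2)" using coeff_bound[OF ij] by (intro mult_right_mono) auto
  also have "\<dots> < 4 * p\<^sup>2" using pq by simp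
  finally show False by (simp add: power_mult_distrib)
qed

lemma E_iff: assumes "i < 8" shows "z \<in> E i \<longleftrightarrow> 0 < Im z \<and> half i z = 0"
proof -
  note n = nu_nth_cases[OF assms]
  have geo: "w \<in> geodesic 0 (1 - r2) \<longleftrightarrow> 0 < Im w \<and> side_form w = 0" for w
  proof (cases "0 < Im w")
    case True
    have "w \<in> geodesic 0 (1 - r2) \<longleftrightarrow> cmod (w - of_real ((1 - r2) / 2)) = (r2 - 1) / 2"
      using True r2_bounds by (simp add: geodesic_def)
    also have "\<dots> \<longleftrightarrow> (cmod (w - of_real ((1 - r2) / 2)))\<^sup>2 = ((r2 - 1) / 2)\<^sup>2"
      using r2_bounds by (subst power2_eq_iff_nonneg) auto
    also have "\<dots> \<longleftrightarrow> (cmod w)\<^sup>2 + (r2 - 1) * Re w = 0"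
    proof -
      have "(cmod (w - of_real ((1 - r2) / 2)))\<^sup>2 - ((r2 - 1) / 2)\<^sup>2 = (cmod w)\<^sup>2 + (r2 - 1) * Re w"
        unfolding cmod_power2 by (simp add: power2_eq_square field_simps)
      then show ?thesis by linarith
    qed
    also have "\<dots> \<longleftrightarrow> side_form w = 0" using True by (simp add: side_form_def)
    finally show ?thesis using True by simp
  qed (simp add: geodesic_def)
  show ?thesis
  proof
    assume "z \<in> E i"
    then obtain w where w: "w \<in> geodesic 0 (1 - r2)" "z = act w (nu i)" unfolding E_def by auto
    then have "0 < Im w" "side_form w = 0" using geo by auto
    then show "0 < Im z \<and> half i z = 0" unfolding half_def w(2) using act_im act_act n act_one by metis
  next
    assume z: "0 < Im z \<and> half i z = 0"
    then have "act z (transpose (nu i)) \<in> geodesic 0 (1 - r2)" unfolding geo half_def using act_im n by blast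
    moreover have "act (act z (transpose (nu i))) (nu i) = z" using z act_act n act_one by metis
    ultimately show "z \<in> E i" unfolding E_def by (metis imageI)
  qed
qed

section \<open>Sides of the tessellation do not enter the octagon\<close>

text \<open>Elements of the group as words in the generating reflections; the leftmost reflection is applied first,
as the action is from the right.\<close>

primrec reflections :: "nat list \<Rightarrow> real^2^2" where
  "reflections [] = mat 1"
| "reflections (m # ms) = gamma_i m ** reflections ms"

lemma unimodular_reflections: "set ms \<subseteq> {..<8} \<Longrightarrow> unimodular (reflections ms)"
proof (induction ms)
  case Nil then show ?case by (simp add: unimodular_def)
next
  case (Cons m ms) then show ?case using gamma_i_facts(1)[of m] by (simp add: unimodular_mult)
qed

lemma reflections_append: "reflections (ms @ ns) = reflections ms ** reflections ns"
  by (induction ms) (simp_all add: matrix_mul_assoc)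

lemma reflections_rev: "set ms \<subseteq> {..<8} \<Longrightarrow> reflections ms ** reflections (rev ms) = mat 1"
proof (induction ms)
  case (Cons m ms)
  have "reflections (m # ms) ** reflections (rev (m # ms)) = gamma_i m ** (reflections ms ** reflections (rev ms)) ** gamma_i m"
    by (simp add: reflections_append matrix_mul_assoc)
  then show ?case using Cons gamma_i_facts(2)[of m] by simp
qed simp

lemma V_oct_reflections: "g \<in> V_oct \<Longrightarrow> \<exists>ms. set ms \<subseteq> {..<8} \<and> g = reflections ms"
proof (induction rule: V_oct.induct)
  case (gen i) then show ?case by (intro exI[of _ "[i]"]) simp
next
  case one then show ?case by (intro exI[of _ "[]"]) simp
next
  case (mult g h)
  then obtain ms ns where "set ms \<subseteq> {..<8}" "g = reflections ms" "set ns \<subseteq> {..<8}" "h = reflections ns" by blast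
  then show ?case by (intro exI[of _ "ms @ ns"]) (simp add: reflections_append)
next
  case (inv g)
  then obtain ms where ms: "set ms \<subseteq> {..<8}" "g = reflections ms" by blast
  then have "reflections ms ** reflections (rev ms) = mat 1" "reflections (rev ms) ** reflections ms = mat 1"
    using reflections_rev[of ms] reflections_rev[of "rev ms"] by simp_all
  then have "matrix_inv g = reflections (rev ms)" unfolding ms(2) by (intro matrix_inv_eqI)
  then show ?case using ms(1) by (intro exI[of _ "rev ms"]) simp
qed

lemma unimodular_V_oct: "g \<in> V_oct \<Longrightarrow> unimodular g"
  using V_oct_reflections unimodular_reflections by blast

lemma reduced_reflections:
  "set ms \<subseteq> {..<8} \<Longrightarrow> \<exists>ns. set ns \<subseteq> {..<8} \<and> distinct_adj ns \<and> reflections ns = reflections ms"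
proof (induction ms)
  case Nil then show ?case by (intro exI[of _ "[]"]) simp
next
  case (Cons m ms)
  then obtain ns where ns: "set ns \<subseteq> {..<8}" "distinct_adj ns" "reflections ns = reflections ms" by auto
  show ?case
  proof (cases "ns \<noteq> [] \<and> hd ns = m")
    case True
    then obtain r where r: "ns = m # r" by (cases ns) auto
    have "reflections (m # ms) = (gamma_i m ** gamma_i m) ** reflections r"
      using r by (simp add: matrix_mul_assoc ns(3)[symmetric])
    then have "reflections r = reflections (m # ms)" using gamma_i_facts(2)[of m] Cons.prems by simp
    moreover have "distinct_adj r" using ns(2) r by (cases r) auto
    ultimately show ?thesis using ns(1) r by (intro exI[of _ r]) simp
  next
    case False
    then have "distinct_adj (m # ns)" using ns(2) by (cases ns) auto
    then show ?thesis using ns Cons.prems by (intro exI[of _ "m # ns"]) simp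
  qed
qed

text \<open>Each reflection \<open>m\<close> moves the region in front of side \<open>m\<close> behind it, and the region behind \<open>m\<close> is in
front of every other side.\<close>

lemma ping_pong:
  "set (m # ms) \<subseteq> {..<8} \<Longrightarrow> distinct_adj (m # ms) \<Longrightarrow> 0 < Im z \<Longrightarrow> 0 < half m z \<Longrightarrow>
   \<exists>j<8. half j (act z (reflections (m # ms))) < 0"
proof (induction ms arbitrary: m z)
  case Nil
  then show ?case using half_gamma[of z m] by (intro exI[of _ m]) simp
next
  case (Cons m' ms)
  define z' where "z' = act z (gamma_i m)"
  have m: "m < 8" "m' < 8" "m \<noteq> m'" "set ms \<subseteq> {..<8}" using Cons.prems by auto
  have z': "0 < Im z'" using act_im Cons.prems(3) gamma_i_facts(1)[OF m(1)] by (simp add: z'_def)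
  have "half m z' < 0" using half_gamma[OF Cons.prems(3) m(1)] Cons.prems(4) by (simp add: z'_def)
  then have "0 < half m' z'" using half_disjoint[OF z' m(1,2,3)] by simp
  then have "\<exists>j<8. half j (act z' (reflections (m' # ms))) < 0"
    using Cons.IH[of m' z'] Cons.prems z' by auto
  moreover have "act z' (reflections (m' # ms)) = act z (reflections (m # m' # ms))"
    using act_act[OF Cons.prems(3) gamma_i_facts(1)[OF m(1)], of "reflections (m' # ms)"] unimodular_reflections[of "m' # ms"] m
    by (simp add: z'_def)
  ultimately show ?case by simp
qed

lemma tess_side_in_octagon:
  assumes z: "\<And>j. j < 8 \<Longrightarrow> 0 \<le> half j z" and g: "g \<in> V_oct" "i < 8" "z \<in> tess_side g i"
  shows "half i z = 0"
proof -
  obtain z' where z': "z' \<in> E i" "z = act z' g" using g(3) unfolding tess_side_def by auto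
  obtain ms where ms: "set ms \<subseteq> {..<8}" "distinct_adj ms" "g = reflections ms"
    using V_oct_reflections[OF g(1)] reduced_reflections by metis
  have zz: "0 < Im z'" "half i z' = 0" using z'(1) E_iff[OF g(2)] by auto
  \<comment> \<open>a word starting with \<open>i\<close> may be shortened, since the reflection \<open>i\<close> preserves side \<open>i\<close>\<close>
  obtain z'' ns where n: "set ns \<subseteq> {..<8}" "distinct_adj ns" "ns = [] \<or> hd ns \<noteq> i" "0 < Im z''" "half i z'' = 0"
    "z = act z'' (reflections ns)"
  proof (cases "ms \<noteq> [] \<and> hd ms = i")
    case True
    then obtain r where r: "ms = i # r" by (cases ms) auto
    have "z = act (act z' (gamma_i i)) (reflections r)"
      using act_act[OF zz(1) gamma_i_facts(1)[OF g(2)], of "reflections r"] unimodular_reflections[of r] ms r z'(2) by simp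
    moreover have "0 < Im (act z' (gamma_i i))" "half i (act z' (gamma_i i)) = 0"
      using act_im[OF zz(1) gamma_i_facts(1)[OF g(2)]] half_gamma[OF zz(1) g(2)] zz(2) by simp_all
    moreover have "distinct_adj r \<and> (r = [] \<or> hd r \<noteq> i)" using ms(2) r by (cases r) auto
    ultimately show ?thesis using that[of r "act z' (gamma_i i)"] ms(1) r by simp
  next
    case False then show ?thesis using that[of ms z'] ms zz z'(2) by blast
  qed
  show ?thesis
  proof (cases ns)
    case Nil then show ?thesis using n by (simp add: act_one)
  next
    case (Cons m r)
    then have "m < 8" "m \<noteq> i" using n by auto
    then have "0 < half m z''" using half_disjoint[OF n(4) g(2), of m] n(5) by simp
    then have "\<exists>j<8. half j z < 0" using ping_pong[of m r z''] n Cons by simp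
    then show ?thesis using z by force
  qed
qed

section \<open>The Teichmueller cutting sequence and the sectors\<close>

text \<open>Along the geodesic from \<open>\<i>\<close> to 0 moved by \<open>N\<close>, the sign of \<open>half i\<close> is that of an affine function of
the square of the parameter with these coefficients (\<open>half_on_geodesic\<close>). Hence \<open>lower_row N i\<close> is
negative if and only if the endpoint of the geodesic lies strictly behind side \<open>i\<close>.\<close>

definition upper_row :: "real^2^2 \<Rightarrow> nat \<Rightarrow> real" where
  "upper_row N i = row_form ((N ** transpose (nu i))$1$1) ((N ** transpose (nu i))$1$2)"

definition lower_row :: "real^2^2 \<Rightarrow> nat \<Rightarrow> real" where
  "lower_row N i = row_form ((N ** transpose (nu i))$2$1) ((N ** transpose (nu i))$2$2)"

lemma half_on_geodesic:
  assumes "unimodular N" "i < 8" "0 < r"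
  shows "half i (act (of_real r * \<i>) N) = (r\<^sup>2 * upper_row N i + lower_row N i) / r"
proof -
  have z: "0 < Im (of_real r * \<i>)" using assms by simp
  have "half i (act (of_real r * \<i>) N) = side_form (act (of_real r * \<i>) (N ** transpose (nu i)))"
    unfolding half_def using act_act[OF z assms(1) nu_nth_cases(4)[OF assms(2)]] by simp
  also have "\<dots> = (r\<^sup>2 * upper_row N i + lower_row N i) / r"
    unfolding side_form_act[OF z unimodular_mult[OF assms(1) nu_nth_cases(4)[OF assms(2)]]] upper_row_def lower_row_def
    using assms(3) by (simp add: norm_mult mult.commute del: mult2_nth)
  finally show ?thesis .
qed

lemma rows_reflected:
  assumes "i < 8"
  shows "upper_row (N ** gamma_i i) i = - upper_row N i" "lower_row (N ** gamma_i i) i = - lower_row N i"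
proof -
  have "N ** gamma_i i ** transpose (nu i) = N ** transpose (nu i) ** gamma"
    using gamma_i_facts(3)[OF assms] by (simp add: matrix_mul_assoc[symmetric])
  moreover have "row_form ((K ** gamma)$l$1) ((K ** gamma)$l$2) = - row_form (K$l$1) (K$l$2)" for K :: "real^2^2" and l
    using row_form_gamma[of "K$l$1" "K$l$2"] by (simp add: gamma_nth mult.commute)
  ultimately show "upper_row (N ** gamma_i i) i = - upper_row N i" "lower_row (N ** gamma_i i) i = - lower_row N i"
    unfolding upper_row_def lower_row_def by (simp_all only:)
qed

lemma tess_side_shift:
  assumes "unimodular h" "g \<in> V_oct" "i < 8" "z \<in> tess_side g i"
  shows "act z h \<in> tess_side (g ** h) i"
proof -
  obtain e where e: "e \<in> E i" "z = act e g" using assms(4) unfolding tess_side_def by auto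
  have "0 < Im e" using e(1) E_iff[OF assms(3)] by blast
  then have "act z h = act e (g ** h)" unfolding e(2) using act_act unimodular_V_oct[OF assms(2)] assms(1) by blast
  then show ?thesis unfolding tess_side_def using e(1) by blast
qed

lemma gamma_word_V_oct: "(\<And>j. j < n \<Longrightarrow> s j < 8) \<Longrightarrow> gamma_word s n \<in> V_oct"
  by (induction n) (auto intro: V_oct.intros)

lemma E_tess_side: "i < 8 \<Longrightarrow> z \<in> E i \<Longrightarrow> z \<in> tess_side (mat 1) i"
  unfolding tess_side_def by (simp add: act_one)

definition ray_matrix :: "real \<Rightarrow> real^2^2" where
  "ray_matrix \<theta> = mat2 (cos \<theta>) (sin \<theta>) (- sin \<theta>) (cos \<theta>)"

lemma unimodular_ray_matrix: "unimodular (ray_matrix \<theta>)"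
  using sin_cos_squared_add[of \<theta>]
  by (simp add: unimodular_def det_2 ray_matrix_def power2_eq_square algebra_simps)

text \<open>The hypothesis at \<open>Y\<close> says that the function is positive at \<open>Y\<close> or that it vanishes there and is
positive at 0, hence positive just below \<open>Y\<close>.\<close>

lemma affine_between_zero:
  fixes A B Y Z :: real
  assumes "0 \<le> A * Y + B" "A * Y + B = 0 \<longrightarrow> 0 < B" "A * Z + B < 0" "0 < Z" "Z < Y"
  shows "\<exists>X. Z < X \<and> X < Y \<and> A * X + B = 0"
proof -
  have ne: "A * Y + B \<noteq> 0"
  proof
    assume e: "A * Y + B = 0"
    then have "A * Y < 0" using assms(2) by linarith
    then have "A < 0" using assms(4,5) by (simp add: mult_less_0_iff)
    then have "A * Y < A * Z" using assms(5) by simp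
    then show False using e assms(3) by linarith
  qed
  \<comment> \<open>the zero, as the function is increasing\<close>
  define X where "X = - B / A"
  have "A * Z < A * Y" using assms(1,3) by linarith
  then have "0 < A" using assms(5) by (simp add: mult_less_cancel_left)
  then have "Z < X" "X < Y" "A * X + B = 0" using assms(1,3) ne unfolding X_def by (auto simp: field_simps)
  then show ?thesis by blast
qed

text \<open>The induction follows the ray after reflection in the sides crossed before, which is the geodesic
moved by \<open>ray_matrix \<theta> ** gamma_word s n\<close>. The second part of the statement says that at the time \<open>t\<close>
of the last crossing this reflected ray is in the ideal octagon, and that, if it is then on a side,
its endpoint is in front of this side, so that it goes inwards. The ray stays in the octagon until the
next crossing, because a side of the octagon would be crossed otherwise; and as no other side of
the tessellation enters the octagon, the next crossing is with side \<open>s n\<close> of the octagon. As the sign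
changes only once along the ray, the endpoint lies behind this side. The inequality \<open>A * Y + B\<close> has
the variable \<open>Y = exp (- 2 * t)\<close>, decreasing to 0 along the ray.\<close>

lemma teich_entries_sectors:
  assumes e: "\<And>j. j < k \<Longrightarrow> teich_entry \<theta> j (s j)"
  shows "n \<le> k \<Longrightarrow> (\<forall>j<n. s j < 8 \<and> lower_row (ray_matrix \<theta> ** gamma_word s j) (s j) < 0) \<and>
    (\<exists>t\<ge>0. finite {u \<in> teich_crossing_times \<theta>. u \<le> t} \<and> card {u \<in> teich_crossing_times \<theta>. u \<le> t} = n \<and>
      (\<forall>i<8. let A = upper_row (ray_matrix \<theta> ** gamma_word s n) i; B = lower_row (ray_matrix \<theta> ** gamma_word s n) i; Y = (exp (- t))\<^sup>2 in
        0 \<le> A * Y + B \<and> (A * Y + B = 0 \<longrightarrow> 0 < B)))"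
proof (induction n)
  case 0
  let ?N = "ray_matrix \<theta>"
  have uni: "unimodular ?N" by (rule unimodular_ray_matrix)
  have pos: "0 < half i \<i>" if "i < 8" for i using half_eq[OF _ that, of \<i>] by simp
  have start: "act (of_real 1 * \<i>) ?N = \<i>" using teich_ray_0[of \<theta>] by (simp add: teich_ray_def ray_matrix_def)
  \<comment> \<open>at time 0 the ray is at the centre of the ideal octagon\<close>
  have AB: "0 < upper_row ?N i * 1 + lower_row ?N i" if "i < 8" for i
    using half_on_geodesic[OF uni that, of 1] pos[OF that] start by simp
  have "\<not> (\<exists>g\<in>V_oct. \<exists>i<8. teich_ray \<theta> 0 \<in> tess_side g i)"
    unfolding teich_ray_0 using tess_side_in_octagon[of \<i>] pos by (metis less_imp_le less_irrefl)
  then have empty: "{u \<in> teich_crossing_times \<theta>. u \<le> 0} = {}" by (force simp: teich_crossing_times_def)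
  have "0 \<le> upper_row ?N i * (exp (- 0))\<^sup>2 + lower_row ?N i \<and>
      (upper_row ?N i * (exp (- 0))\<^sup>2 + lower_row ?N i = 0 \<longrightarrow> 0 < lower_row ?N i)" if "i < 8" for i
    using AB[OF that] by simp
  then show ?case unfolding Let_def
    by (intro conjI exI[of _ 0]) (simp_all only: empty, simp_all)
next
  case (Suc n)
  let ?C = "teich_crossing_times \<theta>"
  define N where "N = ray_matrix \<theta> ** gamma_word s n"
  from Suc obtain t0 where IH: "\<And>j. j < n \<Longrightarrow> s j < 8 \<and> lower_row (ray_matrix \<theta> ** gamma_word s j) (s j) < 0"
    and t0: "0 \<le> t0" "finite {u \<in> ?C. u \<le> t0}" "card {u \<in> ?C. u \<le> t0} = n"
    and AB: "\<And>i. i < 8 \<Longrightarrow> 0 \<le> upper_row N i * (exp (- t0))\<^sup>2 + lower_row N i \<and>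
      (upper_row N i * (exp (- t0))\<^sup>2 + lower_row N i = 0 \<longrightarrow> 0 < lower_row N i)"
    unfolding N_def Let_def by auto
  have gw: "gamma_word s n \<in> V_oct" using gamma_word_V_oct IH by blast
  have uni: "unimodular N" unfolding N_def using unimodular_mult unimodular_ray_matrix unimodular_V_oct[OF gw] by blast
  define z where "z t = act (of_real (exp (- t)) * \<i>) N" for t
  have zt: "z t = act (teich_ray \<theta> t) (gamma_word s n)" for t
    unfolding z_def N_def teich_ray_def ray_matrix_def[symmetric]
    using act_act[OF _ unimodular_ray_matrix unimodular_V_oct[OF gw]] by simp
  have z_im: "0 < Im (z t)" for t unfolding z_def using uni by (intro act_im) simp_all
  have half_z: "half i (z t) = (upper_row N i * (exp (- t))\<^sup>2 + lower_row N i) / exp (- t)" if "i < 8" for i t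
    unfolding z_def using half_on_geodesic[OF uni that, of "exp (- t)"] by (simp add: mult.commute)
  have half_z_iff: "0 \<le> half i (z t) \<longleftrightarrow> 0 \<le> upper_row N i * (exp (- t))\<^sup>2 + lower_row N i"
     "half i (z t) = 0 \<longleftrightarrow> upper_row N i * (exp (- t))\<^sup>2 + lower_row N i = 0"
     "0 < half i (z t) \<longleftrightarrow> 0 < upper_row N i * (exp (- t))\<^sup>2 + lower_row N i" if "i < 8" for i t
    unfolding half_z[OF that] by (simp_all add: zero_le_divide_iff zero_less_divide_iff)
  \<comment> \<open>passing to \<open>z\<close> does not change the crossing times\<close>
  have cross: "t \<in> ?C" if "0 \<le> t" "i < 8" "half i (z t) = 0" for t i
  proof -
    have "z t \<in> E i" using that z_im E_iff by blast
    then have 1: "z t \<in> tess_side (mat 1) i" using E_tess_side that(2) by blast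
    define h where "h = matrix_inv (gamma_word s n)"
    have h: "h \<in> V_oct" unfolding h_def using gw V_oct.inv by blast
    obtain ms where ms: "set ms \<subseteq> {..<8}" "gamma_word s n = reflections ms" using V_oct_reflections[OF gw] by blast
    have inv: "gamma_word s n ** h = mat 1"
    proof -
      have r: "reflections ms ** reflections (rev ms) = mat 1" "reflections (rev ms) ** reflections ms = mat 1"
        using reflections_rev[of ms] reflections_rev[of "rev ms"] ms(1) by simp_all
      then have "h = reflections (rev ms)" unfolding h_def ms(2) by (rule matrix_inv_eqI)
      then show ?thesis using r ms(2) by simp
    qed
    have ti: "0 < Im (teich_ray \<theta> t)" unfolding teich_ray_def ray_matrix_def[symmetric]
      using unimodular_ray_matrix by (intro act_im) simp_all
    have "act (z t) h = teich_ray \<theta> t"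
      unfolding zt using act_act[OF ti unimodular_V_oct[OF gw] unimodular_V_oct[OF h]] inv by (simp add: act_one)
    then have "teich_ray \<theta> t \<in> tess_side (mat 1 ** h) i"
      using tess_side_shift[OF unimodular_V_oct[OF h] V_oct.one that(2) 1] by simp
    then show ?thesis using h that unfolding teich_crossing_times_def by auto
  qed
  have "teich_entry \<theta> n (s n)" using e Suc.prems by simp
  then obtain t where sn: "s n < 8" and t: "t \<in> ?C" "finite {u \<in> ?C. u < t}" "card {u \<in> ?C. u < t} = n"
    and "\<exists>g\<in>V_oct. teich_ray \<theta> t \<in> tess_side g (s n)" unfolding teich_entry_def by blast
  then obtain g where g: "g \<in> V_oct" "teich_ray \<theta> t \<in> tess_side g (s n)" by blast
  have t_ge: "0 \<le> t" using t(1) by (simp add: teich_crossing_times_def)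
  have lt: "t0 < t"
  proof (rule ccontr)
    assume "\<not> t0 < t"
    then have "insert t {u \<in> ?C. u < t} \<subseteq> {u \<in> ?C. u \<le> t0}" using t(1) by auto
    from card_mono[OF t0(2) this] show False using t(2,3) t0(3) by simp
  qed
  have exp_lt: "(exp (- t))\<^sup>2 < (exp (- t0))\<^sup>2" using lt by (intro power_strict_mono) simp_all
  \<comment> \<open>otherwise side \<open>i\<close> would have been crossed after the last crossing and before time \<open>t\<close>\<close>
  have inside: "0 \<le> half i (z t)" if i: "i < 8" for i
  proof (rule ccontr)
    assume "\<not> 0 \<le> half i (z t)"
    then have neg: "upper_row N i * (exp (- t))\<^sup>2 + lower_row N i < 0" using half_z_iff(1)[OF i] by simp
    obtain X where X: "(exp (- t))\<^sup>2 < X" "X < (exp (- t0))\<^sup>2" "upper_row N i * X + lower_row N i = 0"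
      using affine_between_zero[OF _ _ neg _ exp_lt] AB[OF i] by auto
    have X0: "0 < X" using X(1) by (smt (verit) zero_le_power2)
    define u where "u = - ln (sqrt X)"
    have Xu: "X = (exp (- u))\<^sup>2" using X0 by (simp add: u_def)
    have "exp (- t) < exp (- u)" "exp (- u) < exp (- t0)"
      using power_less_imp_less_base[of "exp (- t)" 2 "exp (- u)"] power_less_imp_less_base[of "exp (- u)" 2 "exp (- t0)"]
        X(1,2) unfolding Xu by simp_all
    then have u: "t0 < u" "u < t" by simp_all
    have "half i (z u) = 0" using half_z_iff(2)[OF i] X(3) Xu by simp
    then have "u \<in> ?C" using cross[of u i] i u t0(1) by simp
    then have "insert u {u \<in> ?C. u \<le> t0} \<subseteq> {u \<in> ?C. u < t}" using u by auto
    from card_mono[OF t(2) this] show False using t(3) t0(2,3) u(1) by simp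
  qed
  have zero: "half (s n) (z t) = 0"
  proof (rule tess_side_in_octagon[OF inside])
    show "g ** gamma_word s n \<in> V_oct" using g gw V_oct.mult by blast
    show "z t \<in> tess_side (g ** gamma_word s n) (s n)"
      unfolding zt using tess_side_shift[OF unimodular_V_oct[OF gw] g(1) sn g(2)] .
  qed (use sn in simp_all)
  then have ABt: "upper_row N (s n) * (exp (- t))\<^sup>2 + lower_row N (s n) = 0" using half_z_iff(2)[OF sn] by simp
  \<comment> \<open>an affine function of \<open>Y\<close> that is positive shortly after the last crossing and vanishes now is negative at 0\<close>
  have neg: "lower_row N (s n) < 0"
  proof (rule ccontr)
    assume n: "\<not> lower_row N (s n) < 0"
    have "0 < (exp (- t))\<^sup>2" by simp
    then have A: "upper_row N (s n) \<le> 0" using ABt n by (smt (verit) mult_pos_pos)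
    then have "upper_row N (s n) * (exp (- t0))\<^sup>2 \<le> upper_row N (s n) * (exp (- t))\<^sup>2"
      using mult_left_mono_neg[OF less_imp_le[OF exp_lt] A] by simp
    then have z0: "upper_row N (s n) * (exp (- t0))\<^sup>2 + lower_row N (s n) = 0" using AB[OF sn] ABt by linarith
    then have "upper_row N (s n) * ((exp (- t0))\<^sup>2 - (exp (- t))\<^sup>2) = 0"
      using ABt unfolding right_diff_distrib by linarith
    then have "upper_row N (s n) = 0" using lt by simp
    then show False using z0 AB[OF sn] by simp
  qed
  have N': "ray_matrix \<theta> ** gamma_word s (Suc n) = N ** gamma_i (s n)" by (simp add: N_def matrix_mul_assoc)
  have uni': "unimodular (N ** gamma_i (s n))" using unimodular_mult uni gamma_i_facts(1)[OF sn] by blast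
  have "0 \<le> upper_row (N ** gamma_i (s n)) i * (exp (- t))\<^sup>2 + lower_row (N ** gamma_i (s n)) i \<and>
     (upper_row (N ** gamma_i (s n)) i * (exp (- t))\<^sup>2 + lower_row (N ** gamma_i (s n)) i = 0 \<longrightarrow> 0 < lower_row (N ** gamma_i (s n)) i)"
    if i: "i < 8" for i
  proof (cases "i = s n")
    case True
    have "upper_row (N ** gamma_i i) i * (exp (- t))\<^sup>2 + lower_row (N ** gamma_i i) i = 0" "0 < lower_row (N ** gamma_i i) i"
      using ABt neg rows_reflected[OF i, of N] True by simp_all
    then show ?thesis using True by simp
  next
    case False
    let ?z = "act (z t) (gamma_i (s n))"
    have im: "0 < Im ?z" using act_im[OF z_im gamma_i_facts(1)[OF sn]] .
    have "half (s n) ?z = 0" using half_gamma[OF z_im sn] zero by simp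
    then have "0 < half i ?z" using half_disjoint[OF im sn i] False by simp
    moreover have "?z = act (of_real (exp (- t)) * \<i>) (N ** gamma_i (s n))"
      unfolding z_def using act_act[OF _ uni gamma_i_facts(1)[OF sn]] by simp
    ultimately have "0 < upper_row (N ** gamma_i (s n)) i * (exp (- t))\<^sup>2 + lower_row (N ** gamma_i (s n)) i"
      using half_on_geodesic[OF uni' i, of "exp (- t)"] by (simp add: zero_less_divide_iff mult.commute)
    then show ?thesis by simp
  qed
  then have next_AB: "\<forall>i<8. let A = upper_row (ray_matrix \<theta> ** gamma_word s (Suc n)) i; B = lower_row (ray_matrix \<theta> ** gamma_word s (Suc n)) i;
      Y = (exp (- t))\<^sup>2 in 0 \<le> A * Y + B \<and> (A * Y + B = 0 \<longrightarrow> 0 < B)"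
    unfolding N' Let_def by blast
  have "{u \<in> ?C. u \<le> t} = insert t {u \<in> ?C. u < t}" using t(1) by auto
  then have fin: "finite {u \<in> ?C. u \<le> t}" "card {u \<in> ?C. u \<le> t} = Suc n" using t(2,3) by simp_all
  have "\<forall>j<Suc n. s j < 8 \<and> lower_row (ray_matrix \<theta> ** gamma_word s j) (s j) < 0"
    using IH sn neg unfolding N_def by (simp add: less_Suc_eq)
  then show ?case using t_ge fin next_AB by blast
qed

section \<open>Directions along the Teichmueller cutting sequence\<close>

text \<open>The direction of the trajectory after the first \<open>j\<close> automorphisms have been applied to it.\<close>

primrec reflected_direction :: "(nat \<Rightarrow> nat) \<Rightarrow> real^2 \<Rightarrow> nat \<Rightarrow> real^2" where
  "reflected_direction s a 0 = a"
| "reflected_direction s a (Suc j) = gamma_i (s j) *v reflected_direction s a j"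

lemma reflected_direction_Suc:
  "reflected_direction s a (Suc j) = reflected_direction (\<lambda>j. s (Suc j)) (gamma_i (s 0) *v a) j"
  by (induction j) (simp_all del: mult_vec2_nth)

lemma reflected_direction_scale:
  "reflected_direction s (r *\<^sub>R a) j = r *\<^sub>R reflected_direction s a j"
  by (induction j) (simp_all add: matrix_vector_mult_scaleR del: mult_vec2_nth)

lemma inverse_entries:
  fixes M N :: "real^2^2"
  assumes "N ** M = mat 1" "unimodular M"
  shows "N$1$1 = det M * M$2$2" "N$1$2 = - det M * M$1$2" "N$2$1 = - det M * M$2$1" "N$2$2 = det M * M$1$1"
proof -
  have d: "det M * det M = 1" using assms(2) by (auto simp: unimodular_def)
  have e: "N$1$1 * M$1$1 + N$1$2 * M$2$1 = 1" "N$1$1 * M$1$2 + N$1$2 * M$2$2 = 0"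
    "N$2$1 * M$1$1 + N$2$2 * M$2$1 = 0" "N$2$1 * M$1$2 + N$2$2 * M$2$2 = 1"
    using assms(1) by (simp_all add: mat2_eq mat_def)
  have solve: "p * det M = u * M$2$2 - v * M$2$1 \<and> q * det M = v * M$1$1 - u * M$1$2"
    if "p * M$1$1 + q * M$2$1 = u" "p * M$1$2 + q * M$2$2 = v" for p q u v
    unfolding that[symmetric] det_2 by (simp add: algebra_simps)
  have s: "N$1$1 * det M = M$2$2" "N$1$2 * det M = - M$1$2" "N$2$1 * det M = - M$2$1" "N$2$2 * det M = M$1$1"
    using solve[OF e(1,2)] solve[OF e(3,4)] by simp_all
  have flip_det: "p = det M * q" if "p * det M = q" for p q
    using d unfolding that[symmetric] by (simp add: mult.left_commute)
  show "N$1$1 = det M * M$2$2" "N$1$2 = - det M * M$1$2" "N$2$1 = - det M * M$2$1" "N$2$2 = det M * M$1$1"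
    using flip_det[OF s(1)] flip_det[OF s(2)] flip_det[OF s(3)] flip_det[OF s(4)] by simp_all
qed

text \<open>If the lower row of \<open>N\<close> is orthogonal to \<open>v\<close>, then the lower row of \<open>N ** P\<close> is orthogonal to \<open>M *v v\<close>
for the inverse \<open>M\<close> of \<open>P\<close>. The exact factor shows that the sign \<open>\<delta>\<close> stays a sign. For the ray of
direction \<open>\<theta>\<close> the lower row is \<open>(- sin \<theta>, cos \<theta>)\<close>, so this compares the reflected ray with the
reflected direction.\<close>

lemma orthogonal_row:
  fixes M N P :: "real^2^2" and v :: "real^2"
  assumes "M ** P = mat 1" "P ** M = mat 1" "unimodular M"
    and row: "N$2$1 = \<delta> * - v$2" "N$2$2 = \<delta> * v$1"
  shows "(N ** P)$2$1 = \<delta> * det M * - (M *v v)$2" "(N ** P)$2$2 = \<delta> * det M * (M *v v)$1"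
  using row inverse_entries[OF assms(2,3)] by (simp_all add: algebra_simps)

lemma ray_row:
  assumes "\<And>j. j < n \<Longrightarrow> s j < 8"
  shows "\<exists>\<delta>. \<delta> * \<delta> = 1 \<and> (ray_matrix \<theta> ** gamma_word s n)$2$1 = \<delta> * - (reflected_direction s (vector [cos \<theta>, sin \<theta>]) n)$2 \<and>
     (ray_matrix \<theta> ** gamma_word s n)$2$2 = \<delta> * (reflected_direction s (vector [cos \<theta>, sin \<theta>]) n)$1"
  using assms
proof (induction n)
  case 0
  show ?case by (intro exI[of _ 1]) (simp add: ray_matrix_def del: mult2_nth)
next
  case (Suc n)
  then obtain \<delta> where d: "\<delta> * \<delta> = 1"
    "(ray_matrix \<theta> ** gamma_word s n)$2$1 = \<delta> * - (reflected_direction s (vector [cos \<theta>, sin \<theta>]) n)$2"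
    "(ray_matrix \<theta> ** gamma_word s n)$2$2 = \<delta> * (reflected_direction s (vector [cos \<theta>, sin \<theta>]) n)$1" by auto
  have sn: "s n < 8" using Suc.prems by simp
  note g = gamma_i_facts[OF sn]
  have "(\<delta> * det (gamma_i (s n))) * (\<delta> * det (gamma_i (s n))) = 1"
    using g(1) d(1) by (auto simp: unimodular_def)
  then show ?case using orthogonal_row[OF g(2) g(2) g(1) d(2,3)]
    by (intro exI[of _ "\<delta> * det (gamma_i (s n))"]) (simp add: matrix_mul_assoc del: mult2_nth mult_vec2_nth)
qed

text \<open>The endpoint of the ray lies behind side \<open>i\<close> if and only if the direction lies in sector \<open>i\<close>: for
\<open>w = nu i *v v\<close> the value of \<open>lower_row\<close> is \<open>w$2 * (w$2 - (r2 - 1) * w$1)\<close>, and \<open>r2 - 1\<close> is the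
tangent of \<open>pi / 8\<close>.\<close>

lemma lower_row_cone:
  assumes i: "i < 8" and row: "\<delta> * \<delta> = 1" "N$2$1 = \<delta> * - v$2" "N$2$2 = \<delta> * v$1" and neg: "lower_row N i < 0"
  shows "\<exists>\<epsilon>. (\<epsilon> = 1 \<or> \<epsilon> = -1) \<and> cone (\<epsilon> *\<^sub>R (nu i *v v))"
proof -
  define w where "w = nu i *v v"
  note n = nu_nth_cases[OF i]
  have r: "(N ** transpose (nu i))$2$1 = \<delta> * det (nu i) * - w$2" "(N ** transpose (nu i))$2$2 = \<delta> * det (nu i) * w$1"
    unfolding w_def using orthogonal_row[OF n(2,1,3) row(2,3)] by blast+
  have d: "(\<delta> * det (nu i)) * (\<delta> * det (nu i)) = 1" using n(3) row(1) by (auto simp: unimodular_def)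
  have "lower_row N i = (\<delta> * det (nu i)) * (\<delta> * det (nu i)) * (w$2 * (w$2 - (r2 - 1) * w$1))"
    unfolding lower_row_def r row_form_def by (simp add: algebra_simps)
  then have neg': "w$2 * (w$2 - (r2 - 1) * w$1) < 0" using neg d by simp
  have e: "sg * (r2 - 1) = 1" unfolding sg_def by (simp add: algebra_simps)
  have sg0: "0 < sg" using sg_bounds by simp
  have s: "sg * (w$2 - (r2 - 1) * w$1) = sg * w$2 - w$1"
    using e by (simp add: right_diff_distrib mult.assoc[symmetric])
  consider "0 < w$2" "w$2 - (r2 - 1) * w$1 < 0" | "w$2 < 0" "0 < w$2 - (r2 - 1) * w$1"
    using neg' by (auto simp: mult_less_0_iff)
  then show ?thesis
  proof cases
    case 1
    then have "sg * (w$2 - (r2 - 1) * w$1) < 0" using sg0 by (simp add: mult_pos_neg)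
    then show ?thesis using 1 s unfolding w_def[symmetric] by (intro exI[of _ 1]) (simp add: cone_def)
  next
    case 2
    then have "0 < sg * (w$2 - (r2 - 1) * w$1)" using sg0 by simp
    then show ?thesis using 2 s unfolding w_def[symmetric] by (intro exI[of _ "-1"]) (simp add: cone_def)
  qed
qed

text \<open>Velocities are arbitrary nonzero multiples of the unit vector, so a sector is only determined up to
sign.\<close>

lemma teich_entries_cones:
  assumes e: "\<And>j. j < k \<Longrightarrow> teich_entry \<theta> j (s j)" and r: "r \<noteq> 0" and j: "j < k"
  shows "s j < 8 \<and> (\<exists>\<epsilon>. (\<epsilon> = 1 \<or> \<epsilon> = -1) \<and> cone (\<epsilon> *\<^sub>R (nu (s j) *v reflected_direction s (r *\<^sub>R vector [cos \<theta>, sin \<theta>]) j)))"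
proof -
  have sec: "\<forall>j<k. s j < 8 \<and> lower_row (ray_matrix \<theta> ** gamma_word s j) (s j) < 0"
    using teich_entries_sectors[OF e, of k k] by auto
  have s8: "s i < 8" if "i < k" for i using sec that by blast
  obtain \<delta> where d: "\<delta> * \<delta> = 1"
    "(ray_matrix \<theta> ** gamma_word s j)$2$1 = \<delta> * - (reflected_direction s (vector [cos \<theta>, sin \<theta>]) j)$2"
    "(ray_matrix \<theta> ** gamma_word s j)$2$2 = \<delta> * (reflected_direction s (vector [cos \<theta>, sin \<theta>]) j)$1"
    using ray_row[of j s \<theta>] s8 j by (meson less_trans)
  obtain \<epsilon> where eps: "\<epsilon> = 1 \<or> \<epsilon> = (-1::real)" "cone (\<epsilon> *\<^sub>R (nu (s j) *v reflected_direction s (vector [cos \<theta>, sin \<theta>]) j))"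
    using lower_row_cone[OF s8[OF j] d] sec j by blast
  have scale: "cone (q *\<^sub>R v)" if "cone v" "0 < q" for q v
    using that mult_strict_left_mono[of "sg * v$2" "v$1" q] by (simp add: cone_def mult.left_commute)
  define \<sigma> where "\<sigma> = sgn r"
  have "\<bar>r\<bar> *\<^sub>R (\<epsilon> *\<^sub>R (nu (s j) *v reflected_direction s (vector [cos \<theta>, sin \<theta>]) j)) =
      (\<sigma> * \<epsilon>) *\<^sub>R (nu (s j) *v reflected_direction s (r *\<^sub>R vector [cos \<theta>, sin \<theta>]) j)"
    using r by (simp add: reflected_direction_scale matrix_vector_mult_scaleR \<sigma>_def abs_sgn mult_ac sgn_if)
  then have "cone ((\<sigma> * \<epsilon>) *\<^sub>R (nu (s j) *v reflected_direction s (r *\<^sub>R vector [cos \<theta>, sin \<theta>]) j))"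
    using scale[OF eps(2), of "\<bar>r\<bar>"] r by simp
  moreover have "\<sigma> * \<epsilon> = 1 \<or> \<sigma> * \<epsilon> = -1" using eps(1) r by (auto simp: \<sigma>_def sgn_if)
  ultimately show ?thesis using s8[OF j] by blast
qed

section \<open>Iterated derivation\<close>

text \<open>The words are defined by adding the last reflection; the induction over derivations removes the first.\<close>

lemma gamma_word_Suc: "gamma_word s (Suc k) = gamma_i (s 0) ** gamma_word (\<lambda>j. s (Suc j)) k"
proof (induction k)
  case (Suc k)
  have "gamma_word s (Suc (Suc k)) = gamma_word s (Suc k) ** gamma_i (s (Suc k))" by simp
  also have "\<dots> = gamma_i (s 0) ** gamma_word (\<lambda>j. s (Suc j)) (Suc k)"
    unfolding Suc by (simp add: matrix_mul_assoc)
  finally show ?case .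
qed simp

lemma letter_inj_surj: fixes \<pi> :: "letter \<Rightarrow> letter" assumes "inj \<pi>" shows "surj \<pi>"
proof -
  have "UNIV = {LA, LB, LC, LD}" using letter.exhaust by blast
  then have "finite (UNIV :: letter set)" by (metis finite.emptyI finite.insertI)
  then show ?thesis using assms finite_UNIV_inj_surj by blast
qed

lemma derived_relabel:
  assumes "inj \<pi>" shows "derived (\<pi> \<circ> w) (\<pi> \<circ> w') \<longleftrightarrow> derived w w'" "derived (\<pi> \<circ> w) w'' \<Longrightarrow> \<exists>w'. derived w w'"
proof -
  have "sandwiched (\<pi> \<circ> w) = sandwiched w" by (auto simp: sandwiched_def inj_eq[OF assms])
  moreover have "\<pi> \<circ> w' = (\<pi> \<circ> w) \<circ> f \<longleftrightarrow> w' = w \<circ> f" for f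
    unfolding comp_assoc using assms by (metis fun.inj_map_strong inj_eq comp_assoc inv_o_cancel id_comp)
  ultimately show "derived (\<pi> \<circ> w) (\<pi> \<circ> w') \<longleftrightarrow> derived w w'" "derived (\<pi> \<circ> w) w'' \<Longrightarrow> \<exists>w'. derived w w'"
    unfolding derived_def by auto
qed

context octagonal_surface
begin

lemma cutting_sequence_transfer:
  assumes "surj \<pi>" "\<And>t L. crosses V F \<tau>' t (\<pi> L) \<longleftrightarrow> crosses V G \<tau> t L"
  shows "cutting_sequence V F \<tau>' (\<pi> \<circ> w) \<longleftrightarrow> cutting_sequence V G \<tau> w"
proof -
  have "(\<exists>L. crosses V F \<tau>' t L) \<longleftrightarrow> (\<exists>L. crosses V G \<tau> t L)" for t
    using assms by (metis surjD)
  then show ?thesis unfolding cutting_sequence_def by (simp add: assms(2))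
qed

lemma image_mem_iff:
  assumes "\<And>p. p \<in> cls ` Oct \<Longrightarrow> g (f p) = p" "A \<subseteq> cls ` Oct" "p \<in> cls ` Oct"
  shows "f p \<in> f ` A \<longleftrightarrow> p \<in> A"
proof
  assume "f p \<in> f ` A"
  then obtain q where q: "f p = f q" "q \<in> A" by (rule imageE)
  have "p = g (f p)" using assms(1)[OF assms(3)] by simp
  also have "\<dots> = q" unfolding q(1) using assms(1,2) q(2) by (simp add: subset_iff)
  finally show "p \<in> A" using q(2) by simp
qed simp

text \<open>The automorphism is the conjugate of the one with derivative \<open>gamma\<close> by the symmetry \<open>nu i\<close>. The sign
\<open>\<epsilon>\<close> cancels in the conjugation, and is free to be chosen so that the direction is in the first sector.\<close>

lemma gamma_i_automorphism:
  assumes i: "i < 8" and eps: "\<epsilon> = 1 \<or> \<epsilon> = (-1::real)"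
  obtains f N h \<pi> G where "symmetry_pair (\<epsilon> *\<^sub>R nu i) f N h \<pi>" "affine_automorphism V gamma G"
    "\<forall>p\<in>cls ` Oct. G (G p) = p" "\<forall>x y. twist x y \<longrightarrow> G (cls x) = cls y"
    "affine_automorphism V (gamma_i i) (h \<circ> (G \<circ> f))"
    "\<forall>p\<in>cls ` Oct. (h \<circ> (G \<circ> f)) ((h \<circ> (G \<circ> f)) p) = p"
proof -
  obtain f N h \<pi> where sp: "symmetry_pair (\<epsilon> *\<^sub>R nu i) f N h \<pi>" using nu_symmetry[OF i eps] by blast
  obtain G where G: "affine_automorphism V gamma G" "\<forall>p\<in>cls ` Oct. G (G p) = p" "\<forall>x y. twist x y \<longrightarrow> G (cls x) = cls y"
    using gamma_automorphism_exists by blast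
  have af: "affine_automorphism V (\<epsilon> *\<^sub>R nu i) f" "affine_automorphism V N h" and NM: "N ** (\<epsilon> *\<^sub>R nu i) = mat 1"
    and fh: "\<And>p. p \<in> cls ` Oct \<Longrightarrow> f (h p) = p" "\<And>p. p \<in> cls ` Oct \<Longrightarrow> h (f p) = p"
    using sp unfolding symmetry_pair_def by metis+
  have ee: "\<epsilon> * \<epsilon> = 1" using eps by auto
  have sc: "(a *\<^sub>R A) ** (b *\<^sub>R B) = (a * b) *\<^sub>R (A ** B)" for a b and A B :: "real^2^2"
    by (simp add: mat2_eq algebra_simps)
  have inv: "(\<epsilon> *\<^sub>R nu i) ** (\<epsilon> *\<^sub>R transpose (nu i)) = mat 1" unfolding sc ee using nu_nth_cases(2)[OF i] by simp
  have "N = N ** ((\<epsilon> *\<^sub>R nu i) ** (\<epsilon> *\<^sub>R transpose (nu i)))" unfolding inv by simp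
  also have "\<dots> = \<epsilon> *\<^sub>R transpose (nu i)" unfolding matrix_mul_assoc NM by simp
  finally have N: "N = \<epsilon> *\<^sub>R transpose (nu i)" .
  have "N ** (gamma ** (\<epsilon> *\<^sub>R nu i)) = gamma_i i"
  proof -
    have "gamma ** (\<epsilon> *\<^sub>R nu i) = \<epsilon> *\<^sub>R (gamma ** nu i)" by (simp add: mat2_eq algebra_simps)
    then have "N ** (gamma ** (\<epsilon> *\<^sub>R nu i)) = transpose (nu i) ** (gamma ** nu i)"
      unfolding N by (simp only: sc ee scaleR_one)
    then show ?thesis unfolding gamma_i_eq[OF i] by (simp only: matrix_mul_assoc)
  qed
  then have aut: "affine_automorphism V (gamma_i i) (h \<circ> (G \<circ> f))"
    using affine_automorphism_compose[OF af(2) affine_automorphism_compose[OF G(1) af(1)]] by simp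
  have fO: "f p \<in> cls ` Oct" "G p \<in> cls ` Oct" if "p \<in> cls ` Oct" for p
    using affine_automorphism_surface(2)[OF af(1)] affine_automorphism_surface(2)[OF G(1)] that by blast+
  have "(h \<circ> (G \<circ> f)) ((h \<circ> (G \<circ> f)) p) = p" if p: "p \<in> cls ` Oct" for p
  proof -
    have "f (h (G (f p))) = G (f p)" "G (G (f p)) = f p" "h (f p) = p"
      using fh(1)[OF fO(2)[OF fO(1)[OF p]]] bspec[OF G(2) fO(1)[OF p]] fh(2)[OF p] .
    then show ?thesis by simp
  qed
  then show ?thesis using that[OF sp G aut] by blast
qed

lemma gamma_word_automorphism:
  assumes "\<And>j. j < k \<Longrightarrow> s j < 8" shows "\<exists>f. affine_automorphism V (gamma_word s k) f"
  using assms
proof (induction k)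
  case 0
  obtain f N h \<pi> where "symmetry_pair (1 *\<^sub>R nu 0) f N h \<pi>" using nu_symmetry[of 0 1] by auto
  moreover have "1 *\<^sub>R nu 0 = mat 1" by (simp add: nu_def mat2_one)
  ultimately show ?case unfolding symmetry_pair_def by auto
next
  case (Suc k)
  then obtain f where "affine_automorphism V (gamma_word s k) f" by auto
  moreover obtain g where "affine_automorphism V (gamma_i (s k)) g"
    using gamma_i_automorphism[of "s k" 1] Suc.prems by (metis lessI)
  ultimately have "affine_automorphism V (gamma_word s (Suc k)) (f \<circ> g)"
    using affine_automorphism_compose by simp
  then show ?case by blast
qed

text \<open>The symmetry moves the trajectory into the first sector. It permutes the labels, and this commutes
with derivation.\<close>

lemma derivation_step:
  assumes tr: "traj_on UNIV a \<tau>" and i: "i < 8" and eps: "\<epsilon> = 1 \<or> \<epsilon> = (-1::real)" and c: "cone (\<epsilon> *\<^sub>R (nu i *v a))"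
    and cs: "cutting_sequence V id \<tau> w"
  shows "\<exists>g. affine_automorphism V (gamma_i i) g \<and> (\<forall>p\<in>cls ` Oct. g (g p) = p) \<and> (\<exists>w'. derived w w') \<and>
    (\<forall>w'. derived w w' \<longrightarrow> cutting_sequence V g \<tau> w')"
proof -
  obtain f N h \<pi> G where sp: "symmetry_pair (\<epsilon> *\<^sub>R nu i) f N h \<pi>" and G0: "affine_automorphism V gamma G"
    "\<forall>p\<in>cls ` Oct. G (G p) = p" "\<forall>x y. twist x y \<longrightarrow> G (cls x) = cls y"
    and g: "affine_automorphism V (gamma_i i) (h \<circ> (G \<circ> f))"
    "\<forall>p\<in>cls ` Oct. (h \<circ> (G \<circ> f)) ((h \<circ> (G \<circ> f)) p) = p"
    by (rule gamma_i_automorphism[OF i eps])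
  note G = G0(1) bspec[OF G0(2)] G0(3)[rule_format]
  have af: "affine_automorphism V (\<epsilon> *\<^sub>R nu i) f" and inj: "inj \<pi>" and lab: "\<And>L. f ` label_side L = label_side (\<pi> L)"
    and fh: "\<And>p. p \<in> cls ` Oct \<Longrightarrow> f (h p) = p" "\<And>p. p \<in> cls ` Oct \<Longrightarrow> h (f p) = p"
    using sp unfolding symmetry_pair_def by metis+
  have surj: "surj \<pi>" using letter_inj_surj[OF inj] .
  have \<tau>O: "\<tau> t \<in> cls ` Oct" for t using tr unfolding traj_on_def surface_eq by blast
  have "(\<epsilon> *\<^sub>R nu i) *v a = \<epsilon> *\<^sub>R (nu i *v a)" by (simp add: vec2_eq algebra_simps)
  then have tr': "traj_on UNIV (\<epsilon> *\<^sub>R (nu i *v a)) (f \<circ> \<tau>)" using traj_on_automorphism[OF tr af] by simp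
  have "crosses V id (f \<circ> \<tau>) t (\<pi> L) \<longleftrightarrow> crosses V id \<tau> t L" for t L
    unfolding crosses_eq lab[symmetric] using image_mem_iff[of h f, OF fh(2) label_side_subset \<tau>O] by simp
  from cutting_sequence_transfer[OF surj this]
  have cs': "cutting_sequence V id (f \<circ> \<tau>) (\<pi> \<circ> w)" using cs by simp
  obtain T x j k where "sector_trajectory V c \<rho> (\<epsilon> *\<^sub>R (nu i *v a)) (f \<circ> \<tau>) (\<pi> \<circ> w) T x j k"
    using sector_trajectory_exists[OF tr' c cs'] by blast
  then interpret st: sector_trajectory V c \<rho> "\<epsilon> *\<^sub>R (nu i *v a)" "f \<circ> \<tau>" "\<pi> \<circ> w" T x j k .
  note d = st.derived_crossings[OF G]
  have "\<exists>w'. derived w w'" using d(1) derived_relabel(2)[OF inj] by blast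
  moreover have "cutting_sequence V (h \<circ> (G \<circ> f)) \<tau> w'" if "derived w w'" for w'
  proof -
    have "derived (\<pi> \<circ> w) (\<pi> \<circ> w')" using derived_relabel(1)[OF inj] that by blast
    then have cG: "cutting_sequence V G (f \<circ> \<tau>) (\<pi> \<circ> w')" using d(2) by blast
    have "crosses V G (f \<circ> \<tau>) t (\<pi> L) \<longleftrightarrow> crosses V (h \<circ> (G \<circ> f)) \<tau> t L" for t L
    proof -
      have sub: "G ` f ` label_side L \<subseteq> cls ` Oct"
        using affine_automorphism_surface(2)[OF af] affine_automorphism_surface(2)[OF G(1)] label_side_subset[of L] by (metis image_mono)
      have "f (\<tau> t) \<in> cls ` Oct" using affine_automorphism_surface(2)[OF af] \<tau>O[of t] by blast
      then have "h (f (\<tau> t)) \<in> h ` G ` f ` label_side L \<longleftrightarrow> f (\<tau> t) \<in> G ` f ` label_side L"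
        using image_mem_iff[of f h, OF fh(1) sub] by blast
      then show ?thesis unfolding crosses_eq lab[symmetric] using fh(2)[OF \<tau>O[of t]] by (simp add: image_comp)
    qed
    from cutting_sequence_transfer[OF surj this] cG show ?thesis by simp
  qed
  ultimately show ?thesis using g by blast
qed

text \<open>For \<open>g\<close> with derivative \<open>gamma_i (s 0)\<close>, the derived sequence is the cutting sequence of \<open>g \<circ> \<tau>\<close> with
respect to the original octagon, as \<open>g\<close> is an involution. The induction hypothesis applies to \<open>g \<circ> \<tau>\<close>
and to the automorphism \<open>g \<circ> f\<close>, whose derivative is the word without its first reflection. That \<open>f\<close>
is arbitrary matters only for the empty word, where \<open>f\<close> has derivative 1 and fixes the sides.\<close>

lemma iterated_derivation:
  assumes "traj_on UNIV a \<tau>" and "cutting_sequence V id \<tau> w"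
    and "\<And>j. j < k \<Longrightarrow> s j < 8 \<and> (\<exists>\<epsilon>. (\<epsilon> = 1 \<or> \<epsilon> = -1) \<and> cone (\<epsilon> *\<^sub>R (nu (s j) *v reflected_direction s a j)))"
    and "affine_automorphism V (gamma_word s k) f"
  shows "(\<exists>w'. (derived ^^ k) w w') \<and> (\<forall>w'. (derived ^^ k) w w' \<longrightarrow> cutting_sequence V f \<tau> w')"
  using assms
proof (induction k arbitrary: a \<tau> w s f)
  case 0
  have "crosses V f \<tau> t (id L) \<longleftrightarrow> crosses V id \<tau> t L" for t L
    unfolding crosses_eq using identity_derivative_label_side 0(4) by simp
  from cutting_sequence_transfer[OF surj_id this] have "cutting_sequence V f \<tau> w"
    using 0(2) unfolding id_comp by blast
  then show ?case by simp
next
  case (Suc k)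
  note tr = Suc.prems(1)
  obtain \<epsilon> where e: "\<epsilon> = 1 \<or> \<epsilon> = (-1::real)" "cone (\<epsilon> *\<^sub>R (nu (s 0) *v a))" using Suc.prems(3)[of 0] by auto
  have s0: "s 0 < 8" using Suc.prems(3)[of 0] by simp
  obtain g where g: "affine_automorphism V (gamma_i (s 0)) g" "\<And>p. p \<in> cls ` Oct \<Longrightarrow> g (g p) = p" "\<exists>w'. derived w w'"
    "\<And>w'. derived w w' \<Longrightarrow> cutting_sequence V g \<tau> w'"
    using derivation_step[OF tr s0 e Suc.prems(2)] by blast
  have \<tau>O: "\<tau> t \<in> cls ` Oct" for t using tr unfolding traj_on_def surface_eq by blast
  let ?s = "\<lambda>j. s (Suc j)"
  have tr': "traj_on UNIV (gamma_i (s 0) *v a) (g \<circ> \<tau>)" using traj_on_automorphism[OF tr g(1)] .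
  have word: "gamma_i (s 0) ** gamma_word s (Suc k) = gamma_word ?s k"
    unfolding gamma_word_Suc using gamma_i_facts(2)[OF s0] by (simp add: matrix_mul_assoc)
  have gf: "affine_automorphism V (gamma_word ?s k) (g \<circ> f)"
    using affine_automorphism_compose[OF g(1) Suc.prems(4)] unfolding word .
  have cones: "?s j < 8 \<and> (\<exists>\<epsilon>. (\<epsilon> = 1 \<or> \<epsilon> = -1) \<and> cone (\<epsilon> *\<^sub>R (nu (?s j) *v reflected_direction ?s (gamma_i (s 0) *v a) j)))"
    if "j < k" for j
    using Suc.prems(3)[of "Suc j"] that unfolding reflected_direction_Suc by simp
  have fL: "f ` label_side L \<subseteq> cls ` Oct" for L
    using affine_automorphism_surface(2)[OF Suc.prems(4)] label_side_subset[of L] by (metis image_mono)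
  have c1: "crosses V id (g \<circ> \<tau>) t (id L) \<longleftrightarrow> crosses V g \<tau> t L" for t L
  proof -
    have "g (g (\<tau> t)) = \<tau> t" using g(2)[OF \<tau>O] .
    moreover have "g (\<tau> t) \<in> cls ` Oct" using affine_automorphism_surface(2)[OF g(1)] \<tau>O[of t] by blast
    ultimately show ?thesis unfolding crosses_eq using image_mem_iff[of g g, OF g(2) label_side_subset, of "g (\<tau> t)" L] by simp
  qed
  have c2: "crosses V (g \<circ> f) (g \<circ> \<tau>) t (id L) \<longleftrightarrow> crosses V f \<tau> t L" for t L
    unfolding crosses_eq using image_mem_iff[of g g, OF g(2) fL \<tau>O] by (simp add: image_comp)
  have step: "(\<exists>w'. (derived ^^ k) w1 w') \<and> (\<forall>w'. (derived ^^ k) w1 w' \<longrightarrow> cutting_sequence V f \<tau> w')" if "derived w w1" for w1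
  proof -
    have "cutting_sequence V id (g \<circ> \<tau>) w1"
      using cutting_sequence_transfer[OF surj_id c1, of w1] g(4)[OF that] unfolding id_comp by blast
    from Suc.IH[OF tr' this cones gf] show ?thesis
      using cutting_sequence_transfer[OF surj_id c2] unfolding id_comp by blast
  qed
  obtain w1 where "derived w w1" using g(3) by blast
  then have "\<exists>w'. (derived ^^ Suc k) w w'" using step relpowp_Suc_I2 by metis
  moreover have "cutting_sequence V f \<tau> w'" if "(derived ^^ Suc k) w w'" for w'
    using relpowp_Suc_D2[OF that] step by blast
  ultimately show ?case by blast
qed

end

theorem proposition3p5:
  fixes V :: "nat \<Rightarrow> real^2" and \<theta> :: real and \<tau> :: "real \<Rightarrow> surface_point"
    and w :: "int \<Rightarrow> letter" and k :: nat and s :: "nat \<Rightarrow> nat"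
  assumes "regular_octagon V"
    and "0 \<le> \<theta>" and "\<theta> < pi"
    and "linear_trajectory V \<theta> \<tau>"
    and "cutting_sequence V id \<tau> w"
    and "1 \<le> k"
    and "\<forall>j<k. teich_entry \<theta> j (s j)"
  shows "(\<exists>w'. (derived ^^ k) w w') \<and>
    (\<forall>w'. (derived ^^ k) w w' \<longrightarrow> cutting_sequence V (Psi V (gamma_word s k)) \<tau> w')"
proof -
  obtain c \<rho> where "octagonal_surface V c \<rho>" using regular_octagon_normalized[OF assms(1)] by blast
  then interpret octagonal_surface V c \<rho> .
  obtain r where r: "r \<noteq> 0" "traj_on UNIV (r *\<^sub>R vector [cos \<theta>, sin \<theta>]) \<tau>"
    using linear_trajectory_traj_on[OF assms(4)] by blast
  have cones: "s j < 8 \<and> (\<exists>\<epsilon>. (\<epsilon> = 1 \<or> \<epsilon> = -1) \<and>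
      cone (\<epsilon> *\<^sub>R (nu (s j) *v reflected_direction s (r *\<^sub>R vector [cos \<theta>, sin \<theta>]) j)))" if "j < k" for j
    using teich_entries_cones[of k \<theta> s r j] assms(7) r(1) that by blast
  then have "\<exists>f. affine_automorphism V (gamma_word s k) f" using gamma_word_automorphism[of k s] by blast
  then have "affine_automorphism V (gamma_word s k) (Psi V (gamma_word s k))"
    unfolding Psi_def by (rule someI_ex)
  from iterated_derivation[OF r(2) assms(5) cones this] show ?thesis .
qed

end
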